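(* Let $X$ and $X'$ be two (potentially different) complex Grassmannians, and let $X_\theta\subseteq X$ and $X'_{\theta'}\subseteq X'$ be (non-empty) Richardson varieties indexed by skew diagrams $\theta$ and $\theta'$. If the posets $P(\theta)$ and $P(\theta')$ are semi-isomorphic, then $X_\theta\cong X'_{\theta'}$ as varieties.
   Context: Let $X=\mathrm{Gr}(m,n)$ be the Grassmannian of $m$-dimensional subspaces of $\mathbb{C}^n$, let $e_1,\dots,e_n$ be the standard basis of $\mathbb{C}^n$, and let $k=n-m$. For a partition $\lambda=(\lambda_1,\dots,\lambda_m)$ with $k\ge\lambda_1\ge\dots\ge\lambda_m\ge0$ (identified with its Young diagram, whose $i$-th row from the top has $\lambda_i$ left-justified boxes), the Schubert variety is $$X_\lambda=\{\Sigma\in X:\ \dim(\Sigma\cap \mathrm{Span}\{e_1,\dots,e_{\lambda_i+m-i+1}\})\ge m-i+1\ \text{ for } i=1,\dots,m\}$$ and the opposite Schubert variety is $$X^\lambda=\{\Sigma\in X:\ \dim(\Sigma\cap \mathrm{Span}\{e_n,e_{n-1},\dots,e_{\lambda_i+m-i+1}\})\ge i\ \text{ for } i=1,\dots,m\}.$$ Write $\mu^\vee=(k-\mu_m,\dots,k-\mu_1)$ for the Poincaré dual partition of $\mu$. Richardson varieties: if $\lambda\subseteq\mu^\vee$ (containment of Young diagrams), the skew diagram $\theta=\mu^\vee/\lambda$ consists of the boxes in $\mu^\vee$ that are not in $\lambda$, and the corresponding (non-empty) Richardson variety is $X_\theta=X_{\mu^\vee}\cap X^\lambda$. (Its isomorphism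 class depends only on the boxes of $\theta$ and their relative positions.) The same definitions apply to $X'$. The poset $P(\theta)$ is the set of boxes of $\theta$ with the partial order induced by the covering relations: $x<y$ if $x$ is immediately to the left of $y$ or immediately above $y$. For a poset $P$, $P^{op}$ denotes the opposite poset (same set, all orders reversed). The connected components of a poset are the equivalence classes of the equivalence relation generated by comparability. Two posets $P,Q$ are semi-isomorphic, written $P\sim Q$, if there is a bijection $f$ from the set of connected components of $P$ to that of $Q$ such that for each connected component $P_i$ of $P$, either $P_i\cong f(P_i)$ or $P_i^{op}\cong f(P_i)$ as posets. *)

theory Defs
  imports Complex_Main "HOL-Library.Function_Algebras" "Jordan_Normal_Form.Determinant"
begin

section \<open>Coordinate spaces\<close>

definition fscale :: "complex \<Rightarrow> ('a \<Rightarrow> complex) \<Rightarrow> 'a \<Rightarrow> complex" where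
  "fscale c v = (\<lambda>i. c * v i)"

interpretation cvec: vector_space fscale
  by unfold_locales (auto simp: fscale_def fun_eq_iff algebra_simps)

text \<open>
  Vectors of \<open>\<complex>\<^sup>n\<close> are functions on the naturals supported in \<open>{1..n}\<close>, so that
  \<open>\<complex>\<^sup>n\<close> is the span of \<open>e\<^sub>1, \<dots>, e\<^sub>n\<close>.
\<close>

definition std_basis :: "nat \<Rightarrow> nat \<Rightarrow> complex" where
  "std_basis i = (\<lambda>j. if j = i then 1 else 0)"

definition coord_span :: "nat set \<Rightarrow> (nat \<Rightarrow> complex) set" where
  "coord_span J = cvec.span (std_basis ` J)"


section \<open>Projective sets and regular maps\<close>

text \<open>
  \<open>proj_space I\<close> is the set of lines in \<open>\<complex>\<^sup>I\<close>, for a finite set \<open>I\<close> of homogeneous coordinates.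
\<close>

definition proj_space :: "'a set \<Rightarrow> ('a \<Rightarrow> complex) set set" where
  "proj_space I = {cvec.span {v} | v. v \<noteq> 0 \<and> (\<forall>i. i \<notin> I \<longrightarrow> v i = 0)}"

text \<open>Polynomials over \<open>\<complex>\<close> are identified with the functions they induce.\<close>

inductive homog_poly :: "'a set \<Rightarrow> nat \<Rightarrow> (('a \<Rightarrow> complex) \<Rightarrow> complex) \<Rightarrow> bool"
  for I :: "'a set" where
  const: "homog_poly I 0 (\<lambda>x. c)"
| var: "i \<in> I \<Longrightarrow> homog_poly I 1 (\<lambda>x. x i)"
| add: "homog_poly I d F \<Longrightarrow> homog_poly I d G \<Longrightarrow> homog_poly I d (\<lambda>x. F x + G x)"
| mult: "homog_poly I d F \<Longrightarrow> homog_poly I d' G \<Longrightarrow> homog_poly I (d + d') (\<lambda>x. F x * G x)"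

definition zariski_closed :: "'a set \<Rightarrow> ('a \<Rightarrow> complex) set set \<Rightarrow> bool" where
  "zariski_closed I C \<longleftrightarrow>
    (\<exists>S. (\<forall>F\<in>S. \<exists>d. homog_poly I d F) \<and>
         C = {L \<in> proj_space I. \<forall>F\<in>S. \<forall>v\<in>L. F v = 0})"

definition zariski_open_in ::
  "'a set \<Rightarrow> ('a \<Rightarrow> complex) set set \<Rightarrow> ('a \<Rightarrow> complex) set set \<Rightarrow> bool" where
  "zariski_open_in I Z U \<longleftrightarrow> (\<exists>C. zariski_closed I C \<and> U = Z - C)"

text \<open>
  A map between subsets of projective spaces is regular if, Zariski-locally on the source, it is
  given by homogeneous polynomials of one common degree without common zero.
\<close>

definition regular_map ::
  "'a set \<Rightarrow> ('a \<Rightarrow> complex) set set \<Rightarrow> 'b set \<Rightarrow> ('b \<Rightarrow> complex) set set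
    \<Rightarrow> (('a \<Rightarrow> complex) set \<Rightarrow> ('b \<Rightarrow> complex) set) \<Rightarrow> bool" where
  "regular_map I Z J W \<phi> \<longleftrightarrow>
    \<phi> ` Z \<subseteq> W \<and>
    (\<forall>L\<in>Z. \<exists>U d F. L \<in> U \<and> zariski_open_in I Z U \<and> (\<forall>j\<in>J. homog_poly I d (F j)) \<and>
      (\<forall>M\<in>U. \<forall>v\<in>M. v \<noteq> 0 \<longrightarrow>
        (\<exists>j\<in>J. F j v \<noteq> 0) \<and> \<phi> M = cvec.span {\<lambda>j. if j \<in> J then F j v else 0}))"

definition isomorphic_varieties ::
  "'a set \<Rightarrow> ('a \<Rightarrow> complex) set set \<Rightarrow> 'b set \<Rightarrow> ('b \<Rightarrow> complex) set set \<Rightarrow> bool" where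
  "isomorphic_varieties I Z J W \<longleftrightarrow>
    (\<exists>\<phi> \<psi>. regular_map I Z J W \<phi> \<and> regular_map J W I Z \<psi> \<and>
      (\<forall>L\<in>Z. \<psi> (\<phi> L) = L) \<and> (\<forall>M\<in>W. \<phi> (\<psi> M) = M))"


section \<open>Grassmannians and the Pluecker embedding\<close>

definition grassmannian :: "nat \<Rightarrow> nat \<Rightarrow> (nat \<Rightarrow> complex) set set" where
  "grassmannian m n = {\<Sigma>. cvec.subspace \<Sigma> \<and> \<Sigma> \<subseteq> coord_span {1..n} \<and> cvec.dim \<Sigma> = m}"

definition ordered_basis :: "nat \<Rightarrow> (nat \<Rightarrow> nat \<Rightarrow> complex) \<Rightarrow> (nat \<Rightarrow> complex) set \<Rightarrow> bool" where
  "ordered_basis m b \<Sigma> \<longleftrightarrow>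
    inj_on b {..<m} \<and> cvec.independent (b ` {..<m}) \<and> cvec.span (b ` {..<m}) = \<Sigma>"

definition pluecker_index :: "nat \<Rightarrow> nat \<Rightarrow> nat set set" where
  "pluecker_index m n = {I. I \<subseteq> {1..n} \<and> card I = m}"

definition pluecker_coords ::
  "nat \<Rightarrow> nat \<Rightarrow> (nat \<Rightarrow> nat \<Rightarrow> complex) \<Rightarrow> nat set \<Rightarrow> complex" where
  "pluecker_coords m n b = (\<lambda>I. if I \<in> pluecker_index m n
     then det (mat m m (\<lambda>(r, c). b r (sorted_list_of_set I ! c))) else 0)"

text \<open>
  The coordinate vectors of two bases of the same subspace are proportional, so this is a line.
\<close>

definition pluecker :: "nat \<Rightarrow> nat \<Rightarrow> (nat \<Rightarrow> complex) set \<Rightarrow> (nat set \<Rightarrow> complex) set" where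
  "pluecker m n \<Sigma> = cvec.span {pluecker_coords m n b | b. ordered_basis m b \<Sigma>}"


section \<open>Partitions, Schubert and Richardson varieties\<close>

text \<open>Only the values of a partition on \<open>{1..m}\<close> are relevant.\<close>

definition partition_in_box :: "nat \<Rightarrow> nat \<Rightarrow> (nat \<Rightarrow> nat) \<Rightarrow> bool" where
  "partition_in_box m k lam \<longleftrightarrow>
    (\<forall>i\<in>{1..m}. lam i \<le> k) \<and> (\<forall>i\<in>{1..m}. \<forall>j\<in>{1..m}. i \<le> j \<longrightarrow> lam j \<le> lam i)"

definition dual_partition :: "nat \<Rightarrow> nat \<Rightarrow> (nat \<Rightarrow> nat) \<Rightarrow> nat \<Rightarrow> nat" where
  "dual_partition m k mu = (\<lambda>i. k - mu (m + 1 - i))"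

text \<open>Boxes are pairs (row, column), rows being counted from the top.\<close>

definition young_diagram :: "nat \<Rightarrow> (nat \<Rightarrow> nat) \<Rightarrow> (nat \<times> nat) set" where
  "young_diagram m lam = {(i, j). i \<in> {1..m} \<and> j \<in> {1..lam i}}"

definition schubert :: "nat \<Rightarrow> nat \<Rightarrow> (nat \<Rightarrow> nat) \<Rightarrow> (nat \<Rightarrow> complex) set set" where
  "schubert m n lam = {\<Sigma> \<in> grassmannian m n.
     \<forall>i\<in>{1..m}. cvec.dim (\<Sigma> \<inter> coord_span {1..lam i + m - i + 1}) \<ge> m - i + 1}"

definition opp_schubert :: "nat \<Rightarrow> nat \<Rightarrow> (nat \<Rightarrow> nat) \<Rightarrow> (nat \<Rightarrow> complex) set set" where
  "opp_schubert m n lam = {\<Sigma> \<in> grassmannian m n.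
     \<forall>i\<in>{1..m}. cvec.dim (\<Sigma> \<inter> coord_span {lam i + m - i + 1..n}) \<ge> i}"

definition skew_diagram :: "nat \<Rightarrow> nat \<Rightarrow> (nat \<Rightarrow> nat) \<Rightarrow> (nat \<Rightarrow> nat) \<Rightarrow> (nat \<times> nat) set" where
  "skew_diagram m n lam mu =
     young_diagram m (dual_partition m (n - m) mu) - young_diagram m lam"

definition richardson :: "nat \<Rightarrow> nat \<Rightarrow> (nat \<Rightarrow> nat) \<Rightarrow> (nat \<Rightarrow> nat) \<Rightarrow> (nat \<Rightarrow> complex) set set" where
  "richardson m n lam mu =
     schubert m n (dual_partition m (n - m) mu) \<inter> opp_schubert m n lam"


section \<open>Posets and semi-isomorphism\<close>

text \<open>A poset is given by its carrier and its reflexive order relation.\<close>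

definition box_cover :: "(nat \<times> nat) set \<Rightarrow> ((nat \<times> nat) \<times> (nat \<times> nat)) set" where
  "box_cover \<theta> = {((i, j), (i', j')). (i, j) \<in> \<theta> \<and> (i', j') \<in> \<theta> \<and>
     (i' = i \<and> j' = j + 1 \<or> i' = i + 1 \<and> j' = j)}"

definition box_order :: "(nat \<times> nat) set \<Rightarrow> ((nat \<times> nat) \<times> (nat \<times> nat)) set" where
  "box_order \<theta> = Restr ((box_cover \<theta>)\<^sup>*) \<theta>"

definition poset_isomorphic :: "'a set \<Rightarrow> 'a rel \<Rightarrow> 'b set \<Rightarrow> 'b rel \<Rightarrow> bool" where
  "poset_isomorphic A r B s \<longleftrightarrow>
    (\<exists>f. bij_betw f A B \<and> (\<forall>x\<in>A. \<forall>y\<in>A. (x, y) \<in> r \<longleftrightarrow> (f x, f y) \<in> s))"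

definition components :: "'a set \<Rightarrow> 'a rel \<Rightarrow> 'a set set" where
  "components A r = A // Restr ((r \<union> r\<inverse>)\<^sup>*) A"

definition semi_isomorphic :: "'a set \<Rightarrow> 'a rel \<Rightarrow> 'b set \<Rightarrow> 'b rel \<Rightarrow> bool" where
  "semi_isomorphic A r B s \<longleftrightarrow>
    (\<exists>f. bij_betw f (components A r) (components B s) \<and>
      (\<forall>C\<in>components A r.
        poset_isomorphic C (Restr r C) (f C) (Restr s (f C)) \<or>
        poset_isomorphic C ((Restr r C)\<inverse>) (f C) (Restr s (f C))))"

end

theory Submission
  imports Defs
begin

text \<open>
  A point of \<open>X\<^sub>\<theta>\<close> is the row space of a matrix whose maximal minors \<open>p\<^sub>I\<close> vanish unless
  the lattice path of \<open>I\<close> lies between the two boundary paths of \<open>\<theta>\<close>.  The cone of Pluecker vectors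
  with such a support changes only by a signed relabelling of the coordinates if the columns are
  permuted, and also if \<open>I\<close> is replaced by its symmetric difference with a set \<open>D\<close> of columns that
  meets all admissible \<open>I\<close> in equally many elements: then the matrix is block diagonal up to row
  operations, and Jacobi's theorem on complementary minors dualises one block only.  An
  isomorphism or anti-isomorphism between two connected skew shapes is a translation, a
  transposition, a rotation by 180 degrees or a composition of these.  On the steps of the
  boundary paths it is a shift or a reversal, combined with the exchange of horizontal and
  vertical steps in case of a transposition or its composition with the rotation.
  Hence dualising these components and the steps that both boundary paths share, and then
  permuting the columns, carries one cone to the other by a linear bijection.
\<close>

section \<open>Monomial maps between projective sets\<close>

text \<open>All signs, whether from reordering columns or from Jacobi's theorem, depend on the index
  set and not on the point. So the isomorphism is linear on Pluecker vectors, and one formula of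
  degree 1 is regular everywhere. Blocks appear because a fixed value of
  \<open>card (I \<inter> D)\<close> forbids exchanging a column of \<open>D\<close> for one
  outside, while in a matrix with an identity block the entries are, up to sign, the coordinates
  reached by one exchange. On the columns of a component this value is fixed since the two boundary
  paths meet where the component begins and ends. Dualising the vertical steps shared by both paths
  turns them into columns that no admissible set uses; shared horizontal steps are such columns
  already. Deleting both kinds leaves the columns that touch a box, and this is how Grassmannians
  with different \<open>m\<close> and \<open>n\<close> become comparable. Schubert conditions count
  over whole prefixes; rewritten through the distance \<open>d\<close> from the upper path they
  become local, so each component can be shifted, reversed or complemented independently of the
  others.\<close>

definition proj_lines :: "('a \<Rightarrow> complex) set \<Rightarrow> ('a \<Rightarrow> complex) set set" where
  "proj_lines V = (\<lambda>v. cvec.span {v}) ` V"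

definition monomial_map :: "('b \<Rightarrow> complex) \<Rightarrow> ('b \<Rightarrow> 'a) \<Rightarrow> ('a \<Rightarrow> complex) \<Rightarrow> 'b \<Rightarrow> complex" where
  "monomial_map \<epsilon> \<tau> v = (\<lambda>j. \<epsilon> j * v (\<tau> j))"

text \<open>The inverse laws are demanded on the cones only, because the coefficients may vanish on
  index sets outside the support.\<close>

definition monomial_equiv :: "('a \<Rightarrow> complex) set \<Rightarrow> ('b \<Rightarrow> complex) set \<Rightarrow> bool" where
  "monomial_equiv V W \<longleftrightarrow> (\<exists>\<epsilon> \<tau> \<delta> \<sigma>.
     (\<forall>v\<in>V. monomial_map \<epsilon> \<tau> v \<in> W \<and> monomial_map \<delta> \<sigma> (monomial_map \<epsilon> \<tau> v) = v) \<and>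
     (\<forall>w\<in>W. monomial_map \<delta> \<sigma> w \<in> V \<and> monomial_map \<epsilon> \<tau> (monomial_map \<delta> \<sigma> w) = w))"

lemma monomial_equivI:
  assumes "\<And>v. v \<in> V \<Longrightarrow> monomial_map \<epsilon> \<tau> v \<in> W"
    and "\<And>v. v \<in> V \<Longrightarrow> monomial_map \<delta> \<sigma> (monomial_map \<epsilon> \<tau> v) = v"
    and "\<And>w. w \<in> W \<Longrightarrow> monomial_map \<delta> \<sigma> w \<in> V"
    and "\<And>w. w \<in> W \<Longrightarrow> monomial_map \<epsilon> \<tau> (monomial_map \<delta> \<sigma> w) = w"
  shows "monomial_equiv V W"
  unfolding monomial_equiv_def using assms by blast

lemma monomial_equiv_sym: "monomial_equiv V W \<Longrightarrow> monomial_equiv W V"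
  unfolding monomial_equiv_def by blast

lemma monomial_map_comp:
  "monomial_map \<epsilon>' \<tau>' (monomial_map \<epsilon> \<tau> v) = monomial_map (\<lambda>j. \<epsilon>' j * \<epsilon> (\<tau>' j)) (\<tau> \<circ> \<tau>') v"
  by (simp add: monomial_map_def fun_eq_iff)

lemma monomial_equiv_trans:
  assumes "monomial_equiv U V" and "monomial_equiv V W"
  shows "monomial_equiv U W"
proof -
  obtain e t d s where 1: "\<forall>v\<in>U. monomial_map e t v \<in> V \<and> monomial_map d s (monomial_map e t v) = v"
    "\<forall>w\<in>V. monomial_map d s w \<in> U \<and> monomial_map e t (monomial_map d s w) = w"
    using assms(1) unfolding monomial_equiv_def by blast
  obtain e' t' d' s' where 2: "\<forall>v\<in>V. monomial_map e' t' v \<in> W \<and> monomial_map d' s' (monomial_map e' t' v) = v"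
    "\<forall>w\<in>W. monomial_map d' s' w \<in> V \<and> monomial_map e' t' (monomial_map d' s' w) = w"
    using assms(2) unfolding monomial_equiv_def by blast
  show ?thesis
    by (rule monomial_equivI[where \<epsilon> = "\<lambda>j. e' j * e (t' j)" and \<tau> = "t \<circ> t'"
          and \<delta> = "\<lambda>j. d j * d' (s j)" and \<sigma> = "s' \<circ> s"])
       (use 1 2 in \<open>auto simp: monomial_map_comp[symmetric]\<close>)
qed

lemma mem_span_singleton: "v \<in> cvec.span {w} \<longleftrightarrow> (\<exists>c. v = fscale c w)"
  by (auto simp: cvec.span_singleton)

lemma span_singleton_fscale: 
  assumes "c \<noteq> 0" shows "cvec.span {fscale c w} = cvec.span {w}"
proof -
  have "w = fscale (inverse c) (fscale c w)" using assms by (simp add: fscale_def fun_eq_iff)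
  then have "w \<in> cvec.span {fscale c w}" unfolding mem_span_singleton by blast
  moreover have "fscale c w \<in> cvec.span {w}" unfolding mem_span_singleton by blast
  ultimately show ?thesis unfolding cvec.span_eq by blast
qed

lemma monomial_map_fscale: "monomial_map \<epsilon> \<tau> (fscale c v) = fscale c (monomial_map \<epsilon> \<tau> v)"
  by (simp add: monomial_map_def fscale_def fun_eq_iff)

lemma monomial_map_span:
  "monomial_map \<epsilon> \<tau> ` cvec.span {v} = cvec.span {monomial_map \<epsilon> \<tau> v}"
  by (simp add: cvec.span_singleton image_image monomial_map_fscale)

lemma zariski_open_in_refl: "zariski_open_in I Z Z"
proof -
  have "zariski_closed I {}"
    unfolding zariski_closed_def
  proof (rule exI[of _ "{\<lambda>x. 1 :: complex}"], intro conjI ballI)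
    show "\<exists>d. homog_poly I d F" if "F \<in> {\<lambda>x. 1}" for F :: "_ \<Rightarrow> complex"
      using that homog_poly.const[of I 1] by auto
    show "{} = {L \<in> proj_space I. \<forall>F\<in>{\<lambda>x. 1 :: complex}. \<forall>v\<in>L. F v = 0}"
      by (auto simp: proj_space_def intro: cvec.span_base)
  qed
  then show ?thesis unfolding zariski_open_in_def by (intro exI[of _ "{}"]) auto
qed

text \<open>The whole source serves as the open set: the coordinates of the map are linear forms,
  and they have no common zero because the vectors of \<open>W\<close> are nonzero.\<close>

lemma regular_map_monomial:
  assumes V: "\<And>v. v \<in> V \<Longrightarrow> v \<noteq> 0 \<and> (\<forall>i. i \<notin> I \<longrightarrow> v i = 0)"
    and W: "\<And>w. w \<in> W \<Longrightarrow> w \<noteq> 0 \<and> (\<forall>j. j \<notin> J \<longrightarrow> w j = 0)"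
    and T: "\<And>v. v \<in> V \<Longrightarrow> monomial_map \<epsilon> \<tau> v \<in> W"
  shows "regular_map I (proj_lines V) J (proj_lines W) (\<lambda>L. monomial_map \<epsilon> \<tau> ` L)"
  unfolding regular_map_def
proof (intro conjI ballI)
  show "(`) (monomial_map \<epsilon> \<tau>) ` proj_lines V \<subseteq> proj_lines W"
    using T by (auto simp: proj_lines_def monomial_map_span)
next
  fix L assume L: "L \<in> proj_lines V"
  then obtain v0 where v0: "v0 \<in> V" by (auto simp: proj_lines_def)
  then obtain i0 where i0: "i0 \<in> I" using V[OF v0] by (auto simp: fun_eq_iff) 
  \<comment> \<open>A coordinate \<open>\<tau> j\<close> outside \<open>I\<close> is zero on the
    cone. Its polynomial must still have degree 1, and constants have degree 0, so zero is written
    as a multiple of some variable \<open>i0\<close>.\<close>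
  define F where "F j = (if \<tau> j \<in> I then (\<lambda>x. \<epsilon> j * x (\<tau> j)) else (\<lambda>x. 0 * x i0))" for j
  have hom: "homog_poly I 1 (F j)" for j
  proof (cases "\<tau> j \<in> I")
    case True
    then show ?thesis
      using homog_poly.mult[OF homog_poly.const homog_poly.var, of "\<tau> j" I "\<epsilon> j"] by (simp add: F_def)
  next
    case False
    then show ?thesis
      using homog_poly.mult[OF homog_poly.const homog_poly.var, of i0 I 0] i0 by (simp add: F_def)
  qed
  have key: "(\<exists>j\<in>J. F j v \<noteq> 0) \<and>
      monomial_map \<epsilon> \<tau> ` M = cvec.span {\<lambda>j. if j \<in> J then F j v else 0}"
    if M: "M \<in> proj_lines V" and v: "v \<in> M" "v \<noteq> 0" for M v
  proof -
    obtain w where w: "w \<in> V" "M = cvec.span {w}" using M by (auto simp: proj_lines_def)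
    then obtain c where c: "v = fscale c w" using v by (auto simp: mem_span_singleton)
    then have c0: "c \<noteq> 0" using v by (auto simp: fscale_def fun_eq_iff)
    have supp: "v i = 0" if "i \<notin> I" for i using V[OF w(1)] that by (simp add: c fscale_def)
    have Fv: "F j v = fscale c (monomial_map \<epsilon> \<tau> w) j" for j
      using supp[of "\<tau> j"] by (auto simp: F_def monomial_map_def c fscale_def)
    have Tw: "monomial_map \<epsilon> \<tau> w \<in> W" by (rule T[OF w(1)])
    have "(\<lambda>j. if j \<in> J then F j v else 0) = fscale c (monomial_map \<epsilon> \<tau> w)"
      using W[OF Tw] by (auto simp: fun_eq_iff Fv) (simp add: fscale_def)
    then have 1: "monomial_map \<epsilon> \<tau> ` M = cvec.span {\<lambda>j. if j \<in> J then F j v else 0}"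
      by (simp add: w monomial_map_span span_singleton_fscale[OF c0])
    obtain j where "monomial_map \<epsilon> \<tau> w j \<noteq> 0" using W[OF Tw] by (auto simp: fun_eq_iff)
    then have "j \<in> J" "F j v \<noteq> 0" using W[OF Tw] c0 by (auto simp: Fv fscale_def)
    with 1 show ?thesis by blast
  qed
  show "\<exists>U d F. L \<in> U \<and> zariski_open_in I (proj_lines V) U \<and> (\<forall>j\<in>J. homog_poly I d (F j)) \<and>
      (\<forall>M\<in>U. \<forall>v\<in>M. v \<noteq> 0 \<longrightarrow> (\<exists>j\<in>J. F j v \<noteq> 0) \<and>
        monomial_map \<epsilon> \<tau> ` M = cvec.span {\<lambda>j. if j \<in> J then F j v else 0})"
    by (rule exI[of _ "proj_lines V"], rule exI[of _ 1], rule exI[of _ F])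
       (use L zariski_open_in_refl hom key in blast)
qed

theorem monomial_equiv_isomorphic:
  assumes "monomial_equiv V W"
    and V: "\<And>v. v \<in> V \<Longrightarrow> v \<noteq> 0 \<and> (\<forall>i. i \<notin> I \<longrightarrow> v i = 0)"
    and W: "\<And>w. w \<in> W \<Longrightarrow> w \<noteq> 0 \<and> (\<forall>j. j \<notin> J \<longrightarrow> w j = 0)"
  shows "isomorphic_varieties I (proj_lines V) J (proj_lines W)"
proof -
  obtain e t d s where 1: "\<forall>v\<in>V. monomial_map e t v \<in> W \<and> monomial_map d s (monomial_map e t v) = v"
    "\<forall>w\<in>W. monomial_map d s w \<in> V \<and> monomial_map e t (monomial_map d s w) = w"
    using assms(1) unfolding monomial_equiv_def by blast
  show ?thesis unfolding isomorphic_varieties_def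
  proof (intro exI conjI ballI)
    show "regular_map I (proj_lines V) J (proj_lines W) (\<lambda>L. monomial_map e t ` L)"
      by (rule regular_map_monomial[OF V W]) (use 1 in auto)
    show "regular_map J (proj_lines W) I (proj_lines V) (\<lambda>L. monomial_map d s ` L)"
      by (rule regular_map_monomial[OF W V]) (use 1 in auto)
    fix L assume "L \<in> proj_lines V"
    then obtain v where "v \<in> V" "L = cvec.span {v}" unfolding proj_lines_def by blast
    then show "monomial_map d s ` monomial_map e t ` L = L"
      using 1 by (simp only: monomial_map_span)
  next
    fix L assume "L \<in> proj_lines W"
    then obtain v where "v \<in> W" "L = cvec.span {v}" unfolding proj_lines_def by blast
    then show "monomial_map e t ` monomial_map d s ` L = L"
      using 1 by (simp only: monomial_map_span)
  qed
qed

section \<open>Cones of Pluecker vectors\<close>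

text \<open>Columns are selected by a function instead of a set: permutations then act by
  composition, and a single column is exchanged by \<open>f(i := j)\<close>.\<close>

definition minor :: "nat \<Rightarrow> (nat \<Rightarrow> nat \<Rightarrow> complex) \<Rightarrow> (nat \<Rightarrow> nat) \<Rightarrow> complex" where
  "minor m M f = det (mat m m (\<lambda>(r, c). M r (f c)))"

lemma minor_cong:
  assumes "\<And>r c. r < m \<Longrightarrow> c < m \<Longrightarrow> M r (f c) = M' r (f' c)"
  shows "minor m M f = minor m M' f'"
  unfolding minor_def by (rule arg_cong[where f = det]) (use assms in auto)

lemma minor_expand:
  "minor m M f = (\<Sum>p | p permutes {0..<m}. signof p * (\<Prod>i = 0..<m. M i (f (p i))))"
  unfolding minor_def
  by (subst det_def'[where n = m]) (auto intro!: sum.cong prod.cong simp: permutes_def)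

lemma minor_permute:
  assumes "p permutes {0..<m}"
  shows "minor m M (\<lambda>c. f (p c)) = signof p * minor m M f"
proof -
  let ?A = "mat m m (\<lambda>(c, r). M r (f c))"
  have tr: "minor m M g = det (mat m m (\<lambda>(c, r). M r (g c)))" for g
    unfolding minor_def
    by (subst det_transpose[symmetric, where n = m]) (auto intro!: arg_cong[where f = det])
  have "mat m m (\<lambda>(c, r). M r (f (p c))) = mat m m (\<lambda>(i, j). ?A $$ (p i, j))"
    using assms by (auto simp: permutes_in_image[OF assms, simplified])
  then show ?thesis
    unfolding tr using det_permute_rows[of ?A m p] assms by simp
qed

lemma minor_mult_rows:
  "minor m (\<lambda>r s. \<Sum>k<m. g r k * M k s) f = det (mat m m (\<lambda>(r, k). g r k)) * minor m M f"
proof -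
  have "mat m m (\<lambda>(r, c). \<Sum>k<m. g r k * M k (f c)) =
      mat m m (\<lambda>(r, k). g r k) * mat m m (\<lambda>(r, c). M r (f c))"
    by (auto simp: scalar_prod_def lessThan_atLeast0)
  then show ?thesis unfolding minor_def by (simp add: det_mult[of _ m])
qed

lemma minor_eq_0_iff:
  "minor m M f = 0 \<longleftrightarrow> (\<exists>x. (\<exists>r<m. x r \<noteq> 0) \<and> (\<forall>c<m. (\<Sum>r<m. x r * M r (f c)) = 0))"
proof -
  let ?A = "mat m m (\<lambda>(c, r). M r (f c))"
  have "minor m M f = det ?A"
    unfolding minor_def
    by (subst det_transpose[symmetric, where n = m]) (auto intro!: arg_cong[where f = det])
  also have "det ?A = 0 \<longleftrightarrow> (\<exists>v. v \<in> carrier_vec m \<and> v \<noteq> 0\<^sub>v m \<and> ?A *\<^sub>v v = 0\<^sub>v m)"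
    by (rule det_0_iff_vec_prod_zero) simp
  also have "\<dots> \<longleftrightarrow> (\<exists>x. (\<exists>r<m. x r \<noteq> 0) \<and> (\<forall>c<m. (\<Sum>r<m. x r * M r (f c)) = 0))"
  proof
    assume "\<exists>v. v \<in> carrier_vec m \<and> v \<noteq> 0\<^sub>v m \<and> ?A *\<^sub>v v = 0\<^sub>v m"
    then obtain v where v: "v \<in> carrier_vec m" "v \<noteq> 0\<^sub>v m" "?A *\<^sub>v v = 0\<^sub>v m" by blast
    have "(\<Sum>r<m. v $ r * M r (f c)) = (?A *\<^sub>v v) $ c" if "c < m" for c
      using that v(1) by (auto simp: scalar_prod_def lessThan_atLeast0 mult.commute intro!: sum.cong)
    moreover have "\<exists>r<m. v $ r \<noteq> 0"
      using v(1,2) by (auto intro!: eq_vecI)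
    ultimately show "\<exists>x. (\<exists>r<m. x r \<noteq> 0) \<and> (\<forall>c<m. (\<Sum>r<m. x r * M r (f c)) = 0)"
      using v by (intro exI[of _ "\<lambda>r. v $ r"]) auto
  next
    assume "\<exists>x. (\<exists>r<m. x r \<noteq> 0) \<and> (\<forall>c<m. (\<Sum>r<m. x r * M r (f c)) = 0)"
    then obtain x r where x: "r < m" "x r \<noteq> 0" "\<forall>c<m. (\<Sum>r<m. x r * M r (f c)) = 0" by blast
    have "vec m x $ r \<noteq> 0\<^sub>v m $ r" using x by simp
    then have "vec m x \<noteq> 0\<^sub>v m" by metis
    moreover have "?A *\<^sub>v vec m x = 0\<^sub>v m"
      using x(3) by (auto simp: scalar_prod_def lessThan_atLeast0 mult.commute intro!: eq_vecI)
    ultimately show "\<exists>v. v \<in> carrier_vec m \<and> v \<noteq> 0\<^sub>v m \<and> ?A *\<^sub>v v = 0\<^sub>v m"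
      by (intro exI[of _ "vec m x"]) simp
  qed
  finally show ?thesis .
qed

definition nth_elem :: "nat set \<Rightarrow> nat \<Rightarrow> nat" where
  "nth_elem I = nth (sorted_list_of_set I)"

lemma nth_elem_bij:
  assumes "finite I" "card I = m"
  shows "bij_betw (nth_elem I) {0..<m} I"
  unfolding nth_elem_def
  using bij_betw_nth[of "sorted_list_of_set I" "{..<m}" I] assms
  by (simp add: lessThan_atLeast0)

lemma nth_elem_in: "finite I \<Longrightarrow> c < card I \<Longrightarrow> nth_elem I c \<in> I"
  using nth_elem_bij[of I "card I"] by (auto simp: bij_betw_def)

lemma nth_elem_surj:
  assumes "finite I" "card I = m" "s \<in> I"
  obtains k where "k < m" "nth_elem I k = s"
  using bij_betw_imp_surj_on[OF nth_elem_bij[OF assms(1,2)]] assms(3) by (metis atLeastLessThan_iff imageE)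

lemma bij_betw_factor_permutes:
  assumes "bij_betw f {0..<m::nat} I" "bij_betw f' {0..<m} I"
  shows "\<exists>p. p permutes {0..<m} \<and> (\<forall>c<m. f c = f' (p c))"
proof -
  define p where "p c = (if c < m then inv_into {0..<m} f' (f c) else c)" for c
  have "bij_betw (\<lambda>c. inv_into {0..<m} f' (f c)) {0..<m} {0..<m}"
    using bij_betw_trans[OF assms(1) bij_betw_inv_into[OF assms(2)]] by (simp add: comp_def)
  then have "bij_betw p {0..<m} {0..<m}"
    by (subst bij_betw_cong[where g = "\<lambda>c. inv_into {0..<m} f' (f c)"]) (auto simp: p_def)
  then have "p permutes {0..<m}"
    by (intro bij_imp_permutes) (auto simp: p_def)
  moreover have "f c = f' (p c)" if "c < m" for c
    using that assms by (auto simp: p_def f_inv_into_f bij_betw_def)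
  ultimately show ?thesis by blast
qed

lemma signof_complex: "signof p = (1::complex) \<or> signof p = (-1::complex)"
  by (auto simp: sign_def)

text \<open>The sign is chosen before \<open>M\<close>: it depends on the two enumerations only,
  which makes it admissible as a coefficient of a monomial map.\<close>

lemma minor_reorder:
  assumes "bij_betw f {0..<m::nat} I" "bij_betw f' {0..<m} I"
  shows "\<exists>\<epsilon>. \<epsilon> * \<epsilon> = 1 \<and> (\<forall>M. minor m M f = \<epsilon> * minor m M f')"
proof -
  obtain p where p: "p permutes {0..<m}" "\<forall>c<m. f c = f' (p c)"
    using bij_betw_factor_permutes[OF assms] by blast
  have "minor m M f = signof p * minor m M f'" for M
    using minor_permute[OF p(1), of M f'] p(2) minor_cong[of m M f M "\<lambda>c. f' (p c)"] by simp
  moreover have "signof p * signof p = (1::complex)" using signof_complex[of p] by auto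
  ultimately show ?thesis by blast
qed

text \<open>
  \<open>S\<close> is the set of columns and \<open>\<I>\<close> bounds the support.  The scalar \<open>c\<close> matters only for
  \<open>m = 0\<close>, where it cannot be absorbed by a row of \<open>M\<close>.
\<close>

definition pluecker_cone :: "nat \<Rightarrow> nat set \<Rightarrow> nat set set \<Rightarrow> (nat set \<Rightarrow> complex) set" where
  "pluecker_cone m S \<I> = {v. v \<noteq> 0 \<and> (\<forall>I. I \<notin> \<I> \<longrightarrow> v I = 0) \<and>
     (\<exists>M c. \<forall>I. v I = (if I \<subseteq> S \<and> card I = m then c * minor m M (nth_elem I) else 0))}"

lemma pluecker_coneI:
  assumes "v J \<noteq> 0" and "\<And>I. I \<notin> \<I> \<Longrightarrow> v I = 0"
    and "\<And>I. v I = (if I \<subseteq> S \<and> card I = m then c * minor m M (nth_elem I) else 0)"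
  shows "v \<in> pluecker_cone m S \<I>"
  unfolding pluecker_cone_def using assms by fastforce

lemma pluecker_coneE:
  assumes "v \<in> pluecker_cone m S \<I>"
  obtains M c J where "v J \<noteq> 0" and "\<And>I. I \<notin> \<I> \<Longrightarrow> v I = 0"
    and "\<And>I. v I = (if I \<subseteq> S \<and> card I = m then c * minor m M (nth_elem I) else 0)"
proof -
  obtain J where "v J \<noteq> 0" using assms unfolding pluecker_cone_def by (auto simp: fun_eq_iff)
  then show thesis using assms that unfolding pluecker_cone_def by blast
qed

lemma pluecker_cone_fscale: "v \<in> pluecker_cone m S \<I> \<Longrightarrow> k \<noteq> 0 \<Longrightarrow> fscale k v \<in> pluecker_cone m S \<I>"
  unfolding pluecker_cone_def fscale_def
  apply (auto simp: fun_eq_iff)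
  subgoal for I M c by (rule exI[of _ M], rule exI[of _ "k * c"]) auto
  done

text \<open>The new matrix is the old one with its columns renamed through \<open>h\<close>;
  \<open>\<epsilon>\<close> compensates for \<open>g\<close> not being increasing. The sign is kept
  abstract so that the lemma applies to \<open>g\<close> and to its inverse alike.\<close>

lemma pluecker_cone_relabel_into:
  assumes S: "finite S" and g: "inj_on g S" and h: "\<And>s. s \<in> S \<Longrightarrow> h (g s) = s"
    and \<epsilon>: "\<And>I M. I \<subseteq> S \<Longrightarrow> card I = m \<Longrightarrow>
      minor m M (nth_elem (g ` I)) = \<epsilon> (g ` I) * minor m (\<lambda>r s. M r (g s)) (nth_elem I)"
    and nz: "\<And>I. I \<subseteq> S \<Longrightarrow> \<epsilon> (g ` I) \<noteq> 0" "\<And>J. \<not> J \<subseteq> g ` S \<Longrightarrow> \<epsilon> J = 0"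
    and \<I>: "\<And>I. I \<in> \<I> \<Longrightarrow> I \<subseteq> S"
    and v: "v \<in> pluecker_cone m S \<I>"
  shows "monomial_map \<epsilon> ((`) h) v \<in> pluecker_cone m (g ` S) ((`) g ` \<I>)"
proof -
  from v obtain M c I0 where I0: "v I0 \<noteq> 0" and vI: "\<And>I. I \<notin> \<I> \<Longrightarrow> v I = 0"
    and Mc: "\<And>I. v I = (if I \<subseteq> S \<and> card I = m then c * minor m M (nth_elem I) else 0)"
    by (rule pluecker_coneE) (rule that)
  have hg: "h ` g ` I = I" if "I \<subseteq> S" for I using that h by force
  let ?M = "\<lambda>r s. M r (h s)"
  show ?thesis
  proof (rule pluecker_coneI)
    show "monomial_map \<epsilon> ((`) h) v (g ` I0) \<noteq> 0"
    proof -
      have "I0 \<subseteq> S" using I0 vI \<I> by blast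
      then show ?thesis using I0 hg[of I0] nz(1)[of I0] by (simp add: monomial_map_def)
    qed
    show "monomial_map \<epsilon> ((`) h) v J = 0" if J: "J \<notin> (`) g ` \<I>" for J
    proof (cases "J \<subseteq> g ` S")
      case True
      then obtain I where "I \<subseteq> S" "J = g ` I" by (auto simp: subset_image_iff)
      then show ?thesis using J vI[of I] hg[of I] by (auto simp: monomial_map_def)
    qed (simp add: monomial_map_def nz)
    show "monomial_map \<epsilon> ((`) h) v J = (if J \<subseteq> g ` S \<and> card J = m then c * minor m ?M (nth_elem J) else 0)" for J
    proof (cases "J \<subseteq> g ` S")
      case True
      then obtain I where I: "I \<subseteq> S" "J = g ` I" by (auto simp: subset_image_iff)
      have cI: "card (g ` I) = card I" using I g by (auto intro: card_image inj_on_subset)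
      have fI: "finite I" using I S finite_subset by blast
      have "minor m ?M (nth_elem J) = \<epsilon> J * minor m M (nth_elem I)" if "card I = m"
      proof -
        have "minor m (\<lambda>r s. M r (h (g s))) (nth_elem I) = minor m M (nth_elem I)"
          by (rule minor_cong) (use nth_elem_in[OF fI] that h I in \<open>auto simp: subset_iff\<close>)
        then show ?thesis using \<epsilon>[OF I(1) that, of ?M] I by simp
      qed
      then show ?thesis using I cI True hg by (auto simp: monomial_map_def Mc)
    qed (simp add: monomial_map_def nz)
  qed
qed

lemma pluecker_cone_relabel:
  assumes S: "finite S" and g: "inj_on g S" and \<I>: "\<And>I. I \<in> \<I> \<Longrightarrow> I \<subseteq> S"
  shows "monomial_equiv (pluecker_cone m S \<I>) (pluecker_cone m (g ` S) ((`) g ` \<I>))"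
proof -
  have "\<exists>\<epsilon>. \<epsilon> * \<epsilon> = 1 \<and> (card I = m \<longrightarrow> (\<forall>M. minor m M (nth_elem (g ` I)) = \<epsilon> * minor m (\<lambda>r s. M r (g s)) (nth_elem I)))"
    if I: "I \<subseteq> S" for I
  proof (cases "card I = m")
    case True
    have gI: "inj_on g I" and fI: "finite I" using I g S by (auto intro: inj_on_subset finite_subset)
    have "bij_betw (g \<circ> nth_elem I) {0..<m} (g ` I)"
      using bij_betw_trans[OF nth_elem_bij[OF fI True] inj_on_imp_bij_betw[OF gI]] .
    moreover have "bij_betw (nth_elem (g ` I)) {0..<m} (g ` I)"
      using nth_elem_bij[of "g ` I" m] fI gI True by (simp add: card_image)
    ultimately obtain \<epsilon> where "\<epsilon> * \<epsilon> = 1" "\<forall>M. minor m M (nth_elem (g ` I)) = \<epsilon> * minor m M (g \<circ> nth_elem I)"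
      using minor_reorder by blast
    then show ?thesis by (auto simp: minor_def)
  qed (auto intro: exI[of _ 1])
  then obtain \<epsilon> where \<epsilon>: "\<And>I. I \<subseteq> S \<Longrightarrow> \<epsilon> I * \<epsilon> I = (1::complex)"
    "\<And>I M. I \<subseteq> S \<Longrightarrow> card I = m \<Longrightarrow> minor m M (nth_elem (g ` I)) = \<epsilon> I * minor m (\<lambda>r s. M r (g s)) (nth_elem I)"
    by metis
  define h where "h = inv_into S g"
  have h: "h (g s) = s" if "s \<in> S" for s using g that by (simp add: h_def)
  have hinj: "inj_on h (g ` S)" by (rule inj_onI) (use h in auto)
  have hg: "h ` g ` I = I" if "I \<subseteq> S" for I using that h by force
  have gh: "g ` h ` J = J" if "J \<subseteq> g ` S" for J using that h by force
  have hS: "h ` g ` S = S" using hg by blast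
  have nz: "\<epsilon> I \<noteq> 0" if "I \<subseteq> S" for I using \<epsilon>(1)[OF that] by auto
  \<comment> \<open>Both directions use the same sign, indexed by the target for
    \<open>\<alpha>\<close> and by the source for \<open>\<beta>\<close>, since it is its own
    inverse.\<close>
  define \<alpha> where "\<alpha> J = (if J \<subseteq> g ` S then \<epsilon> (h ` J) else 0)" for J
  define \<beta> where "\<beta> I = (if I \<subseteq> S then \<epsilon> I else 0)" for I
  have hI: "(`) h ` (`) g ` \<I> = \<I>" using \<I> hg by (force simp: image_iff)
  have supp: "v I = 0" if "v \<in> pluecker_cone m S' \<J>" "\<not> I \<subseteq> S'" for v I S' \<J>
    using that unfolding pluecker_cone_def by (smt (verit) mem_Collect_eq)
  have into1: "monomial_map \<alpha> ((`) h) v \<in> pluecker_cone m (g ` S) ((`) g ` \<I>)"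
    if "v \<in> pluecker_cone m S \<I>" for v
    by (rule pluecker_cone_relabel_into[OF S g h _ _ _ \<I> that])
       (use \<epsilon>(2) hg nz in \<open>auto simp: \<alpha>_def subset_image_iff image_mono\<close>)
  have into2: "monomial_map \<beta> ((`) g) w \<in> pluecker_cone m S \<I>"
    if w: "w \<in> pluecker_cone m (g ` S) ((`) g ` \<I>)" for w
  proof -
    have "monomial_map \<beta> ((`) g) w \<in> pluecker_cone m (h ` g ` S) ((`) h ` (`) g ` \<I>)"
    proof (rule pluecker_cone_relabel_into[OF _ hinj _ _ _ _ _ w])
      show "finite (g ` S)" using S by simp
      show "g (h s) = s" if "s \<in> g ` S" for s using that h by auto
      fix J M assume J: "J \<subseteq> g ` S" "card J = m"
      then obtain I where I: "I \<subseteq> S" "J = g ` I" by (auto simp: subset_image_iff)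
      then have cI: "card I = m" using J g by (metis card_image inj_on_subset)
      have fI: "finite I" using I S finite_subset by blast
      have "minor m (\<lambda>r s. M r (h s)) (nth_elem (g ` I)) = \<epsilon> I * minor m (\<lambda>r s. M r (h (g s))) (nth_elem I)"
        by (rule \<epsilon>(2)[OF I(1) cI])
      also have "minor m (\<lambda>r s. M r (h (g s))) (nth_elem I) = minor m M (nth_elem I)"
        by (rule minor_cong) (use nth_elem_in[OF fI] cI h I in \<open>auto simp: subset_iff\<close>)
      finally have "\<epsilon> I * minor m (\<lambda>r s. M r (h s)) (nth_elem (g ` I)) = minor m M (nth_elem I)"
        using \<epsilon>(1)[OF I(1)] by (simp add: mult.assoc[symmetric])
      then show "minor m M (nth_elem (h ` J)) = \<beta> (h ` J) * minor m (\<lambda>r s. M r (h s)) (nth_elem J)"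
        using I hg by (simp add: \<beta>_def)
    next
      fix J assume "J \<subseteq> g ` S" then show "\<beta> (h ` J) \<noteq> 0"
        using nz image_mono[of J "g ` S" h] by (simp add: \<beta>_def hS)
    next
      fix I assume "\<not> I \<subseteq> h ` g ` S" then show "\<beta> I = 0" by (simp add: \<beta>_def hS)
    next
      fix J assume "J \<in> (`) g ` \<I>" then show "J \<subseteq> g ` S" using \<I> by auto
    qed
    then show ?thesis by (simp add: hS hI)
  qed
  show ?thesis
  proof (rule monomial_equivI[OF into1 _ into2])
    fix v assume v: "v \<in> pluecker_cone m S \<I>"
    show "monomial_map \<beta> ((`) g) (monomial_map \<alpha> ((`) h) v) = v"
    proof
      fix I show "monomial_map \<beta> ((`) g) (monomial_map \<alpha> ((`) h) v) I = v I"
        using \<epsilon>(1)[of I] hg[of I] supp[OF v, of I]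
        by (cases "I \<subseteq> S") (auto simp: monomial_map_def \<alpha>_def \<beta>_def image_mono mult.assoc[symmetric])
    qed
  next
    fix w assume w: "w \<in> pluecker_cone m (g ` S) ((`) g ` \<I>)"
    show "monomial_map \<alpha> ((`) h) (monomial_map \<beta> ((`) g) w) = w"
    proof
      fix J show "monomial_map \<alpha> ((`) h) (monomial_map \<beta> ((`) g) w) J = w J"
      proof (cases "J \<subseteq> g ` S")
        case True
        then have "h ` J \<subseteq> S" using hS by blast
        then show ?thesis using \<epsilon>(1)[of "h ` J"] gh[OF True] True
          by (auto simp: monomial_map_def \<alpha>_def \<beta>_def mult.assoc[symmetric])
      qed (use supp[OF w] in \<open>simp add: monomial_map_def \<alpha>_def\<close>)
    qed
  qed
qed

text \<open>Columns that lie in no admissible set can be deleted or added: minors through them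
  vanish by the support condition in one direction, and filling them with zeros makes these minors
  vanish in the other.\<close>

lemma pluecker_cone_restrict:
  assumes "finite S" "S' \<subseteq> S" and \<I>: "\<And>I. I \<in> \<I> \<Longrightarrow> I \<subseteq> S'"
  shows "pluecker_cone m S \<I> = pluecker_cone m S' \<I>"
proof (intro equalityI subsetI)
  fix v assume v: "v \<in> pluecker_cone m S \<I>"
  then obtain M c I0 where I0: "v I0 \<noteq> 0" and vI: "\<And>I. I \<notin> \<I> \<Longrightarrow> v I = 0"
    and Mc: "\<And>I. v I = (if I \<subseteq> S \<and> card I = m then c * minor m M (nth_elem I) else 0)"
    by (rule pluecker_coneE) (rule that)
  have "v I = (if I \<subseteq> S' \<and> card I = m then c * minor m M (nth_elem I) else 0)" for I
  proof (cases "I \<in> \<I>")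
    case True
    then show ?thesis using Mc[of I] \<I>[of I] assms(2) by (simp add: subset_trans)
  next
    case False
    then show ?thesis using Mc[of I] vI[of I] assms(2) by (metis subset_trans)
  qed
  then show "v \<in> pluecker_cone m S' \<I>" by (intro pluecker_coneI[of v I0, OF I0 vI])
next
  fix v assume v: "v \<in> pluecker_cone m S' \<I>"
  then obtain M c I0 where I0: "v I0 \<noteq> 0" and vI: "\<And>I. I \<notin> \<I> \<Longrightarrow> v I = 0"
    and Mc: "\<And>I. v I = (if I \<subseteq> S' \<and> card I = m then c * minor m M (nth_elem I) else 0)"
    by (rule pluecker_coneE) (rule that)
  let ?M = "\<lambda>r s. if s \<in> S' then M r s else 0"
  have "v I = (if I \<subseteq> S \<and> card I = m then c * minor m ?M (nth_elem I) else 0)" for I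
  proof (cases "I \<subseteq> S \<and> card I = m")
    case True
    then have fI: "finite I" using assms(1) finite_subset by blast
    show ?thesis
    proof (cases "I \<subseteq> S'")
      case sub: True
      have "minor m M (nth_elem I) = minor m ?M (nth_elem I)"
        by (rule minor_cong) (use sub nth_elem_in[OF fI] True in auto)
      then show ?thesis using Mc[of I] True sub by simp
    next
      case False
      then obtain s where s: "s \<in> I" "s \<notin> S'" by blast
      then obtain k where k: "k < m" "nth_elem I k = s"
        using nth_elem_surj[OF fI, of m s] True by blast
      have zero: "(\<Prod>i = 0..<m. ?M i (nth_elem I (p i))) = 0" if p: "p permutes {0..<m}" for p
      proof -
        obtain i where "i \<in> {0..<m}" "p i = k" using permutes_image[OF p] k(1) by (metis atLeastLessThan_iff image_iff zero_le)
        then show ?thesis using k s by (intro prod_zero) auto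
      qed
      have "minor m ?M (nth_elem I) = 0"
        unfolding minor_expand by (rule sum.neutral) (use zero in auto)
      then show ?thesis using Mc[of I] False by simp
    qed
  next
    case False
    then show ?thesis using Mc[of I] assms(2) by auto
  qed
  then show "v \<in> pluecker_cone m S \<I>" by (intro pluecker_coneI[of v I0, OF I0 vI])
qed

section \<open>Complementary minors\<close>

lemma sorted_list_of_set_append:
  assumes "finite A" "finite B" and "\<And>a b. a \<in> A \<Longrightarrow> b \<in> B \<Longrightarrow> a < (b::nat)"
  shows "sorted_list_of_set (A \<union> B) = sorted_list_of_set A @ sorted_list_of_set B"
proof -
  have "A \<inter> B = {}" using assms(3) by fastforce
  moreover have "sorted (sorted_list_of_set A @ sorted_list_of_set B)"
    using assms by (auto simp: sorted_append intro: less_imp_le)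
  ultimately have "sorted_list_of_set (set (sorted_list_of_set A @ sorted_list_of_set B))
      = sorted_list_of_set A @ sorted_list_of_set B"
    using assms by (intro sorted_list_of_set.idem_if_sorted_distinct) auto
  then show ?thesis using assms by simp
qed

lemma nth_elem_append:
  assumes "finite A" "finite B" and "\<And>a b. a \<in> A \<Longrightarrow> b \<in> B \<Longrightarrow> a < (b::nat)"
  shows "nth_elem (A \<union> B) c = (if c < card A then nth_elem A c else nth_elem B (c - card A))"
  using assms by (simp add: nth_elem_def sorted_list_of_set_append nth_append)

lemma minor_transpose: "minor m M f = minor m (\<lambda>r c. M c (f r)) (\<lambda>c. c)"
  unfolding minor_def
  by (subst det_transpose[symmetric, where n = m]) (auto intro!: arg_cong[where f = det])

lemma minor_delta: 
  assumes "\<And>i c. i < m \<Longrightarrow> c < m \<Longrightarrow> M i (f c) = (if i = c then 1 else 0)"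
  shows "minor m M f = 1"
proof -
  have "mat m m (\<lambda>(r, c). M r (f c)) = 1\<^sub>m m" using assms by auto
  then show ?thesis unfolding minor_def by simp
qed

lemma minor_lower_left_zero:
  assumes "r \<le> m" and "\<And>i c. r \<le> i \<Longrightarrow> i < m \<Longrightarrow> c < r \<Longrightarrow> M i (f c) = 0"
  shows "minor m M f = minor r M f * minor (m - r) (\<lambda>i. M (i + r)) (\<lambda>c. f (c + r))"
proof -
  let ?q = "m - r"
  have "mat m m (\<lambda>(r, c). M r (f c)) = four_block_mat (mat r r (\<lambda>(i, c). M i (f c)))
     (mat r ?q (\<lambda>(i, c). M i (f (c + r)))) (0\<^sub>m ?q r) (mat ?q ?q (\<lambda>(i, c). M (i + r) (f (c + r))))"
    using assms by (auto simp: four_block_mat_def)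
  then show ?thesis unfolding minor_def
    using det_four_block_mat_lower_left_zero[of "mat r r (\<lambda>(i, c). M i (f c))" r
      "mat r ?q (\<lambda>(i, c). M i (f (c + r)))" ?q "0\<^sub>m ?q r" "mat ?q ?q (\<lambda>(i, c). M (i + r) (f (c + r)))"]
    by simp
qed

lemma minor_upper_right_zero:
  assumes "r \<le> m" and "\<And>i c. i < r \<Longrightarrow> r \<le> c \<Longrightarrow> c < m \<Longrightarrow> M i (f c) = 0"
  shows "minor m M f = minor r M f * minor (m - r) (\<lambda>i. M (i + r)) (\<lambda>c. f (c + r))"
proof -
  have "minor m (\<lambda>i c. M c (f i)) (\<lambda>c. c) = minor r (\<lambda>i c. M c (f i)) (\<lambda>c. c) *
      minor (m - r) (\<lambda>i c. M c (f (i + r))) (\<lambda>c. c + r)"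
    by (rule minor_lower_left_zero) (use assms in auto)
  moreover have "minor (m - r) (\<lambda>i c. M c (f (i + r))) (\<lambda>c. c + r) = 
     minor (m - r) (\<lambda>i. M (i + r)) (\<lambda>c. f (c + r))"
    by (subst (2) minor_transpose) (rule minor_cong, simp)
  ultimately show ?thesis by (simp add: minor_transpose[of m M f] minor_transpose[of r M f])
qed

text \<open>A nonzero Leibniz term would match the first \<open>q\<close> rows bijectively with the
  selected columns below \<open>s\<close>.\<close>

lemma minor_block_mismatch:
  assumes q: "q \<le> m" and M: "\<And>i j. i < m \<Longrightarrow> M i j \<noteq> 0 \<Longrightarrow> i < q \<longleftrightarrow> j < s"
    and "card {c \<in> {0..<m}. f c < s} \<noteq> q"
  shows "minor m M f = 0"
  unfolding minor_expand
proof (rule sum.neutral, safe)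
  fix p assume p: "p permutes {0..<m}"
  have "\<exists>i\<in>{0..<m}. M i (f (p i)) = 0"
  proof (rule ccontr)
    assume neg: "\<not> ?thesis"
    have bij: "bij_betw p {0..<m} {0..<m}" using p by (rule permutes_imp_bij)
    have "bij_betw p {0..<q} {c \<in> {0..<m}. f c < s}"
    proof (rule bij_betwI')
      fix x y assume "x \<in> {0..<q}" "y \<in> {0..<q}"
      then show "(p x = p y) = (x = y)" using bij q by (auto simp: bij_betw_def inj_on_def)
    next
      fix x assume "x \<in> {0..<q}"
      then show "p x \<in> {c \<in> {0..<m}. f c < s}" using neg M[of x] q permutes_in_image[OF p, of x] by auto
    next
      fix y assume y: "y \<in> {c \<in> {0..<m}. f c < s}"
      then obtain x where "x \<in> {0..<m}" "y = p x" using bij unfolding bij_betw_def by blast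
      moreover have "x < q" using neg M[of x "f (p x)"] y calculation by auto
      ultimately show "\<exists>x\<in>{0..<q}. y = p x" by auto
    qed
    then show False using assms(3) bij_betw_same_card by force
  qed
  then show "signof p * (\<Prod>i = 0..<m. M i (f (p i))) = (0::complex)" by (auto intro: prod_zero)
qed

lemma matrix_inverse:
  assumes "minor m A f \<noteq> 0"
  obtains B :: "nat \<Rightarrow> nat \<Rightarrow> complex" where
    "\<And>i k. i < m \<Longrightarrow> k < m \<Longrightarrow> (\<Sum>j<m. A i (f j) * B j k) = (if i = k then 1 else 0)"
    "\<And>i k. i < m \<Longrightarrow> k < m \<Longrightarrow> (\<Sum>j<m. B i j * A j (f k)) = (if i = k then 1 else 0)"
proof -
  define A' where "A' = mat m m (\<lambda>(i, j). A i (f j))"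
  have A': "A' \<in> carrier_mat m m" by (simp add: A'_def)
  have d: "det A' \<noteq> 0" using assms by (simp add: A'_def minor_def)
  define B where "B = adj_mat A'"
  have B: "B \<in> carrier_mat m m" using adj_mat(1)[OF A'] by (simp add: B_def)
  have AB: "A' * B = det A' \<cdot>\<^sub>m 1\<^sub>m m" "B * A' = det A' \<cdot>\<^sub>m 1\<^sub>m m" using adj_mat[OF A'] by (simp_all add: B_def)
  have 1: "(\<Sum>j<m. A i (f j) * (B $$ (j, k) / det A')) = (if i = k then 1 else 0)" if "i < m" "k < m" for i k
  proof -
    have "(A' * B) $$ (i, k) = (\<Sum>j<m. A i (f j) * B $$ (j, k))"
      using that A' B by (simp add: A'_def scalar_prod_def lessThan_atLeast0)
    then have "(\<Sum>j<m. A i (f j) * B $$ (j, k)) = (if i = k then det A' else 0)"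
      using AB that by (auto split: if_splits)
    then show ?thesis using d by (simp add: sum_divide_distrib[symmetric])
  qed
  have 2: "(\<Sum>j<m. (B $$ (i, j) / det A') * A j (f k)) = (if i = k then 1 else 0)" if "i < m" "k < m" for i k
  proof -
    have "(B * A') $$ (i, k) = (\<Sum>j<m. B $$ (i, j) * A j (f k))"
      using that A' B by (simp add: A'_def scalar_prod_def lessThan_atLeast0)
    then have "(\<Sum>j<m. B $$ (i, j) * A j (f k)) = (if i = k then det A' else 0)"
      using AB that by (auto split: if_splits)
    then show ?thesis using d by (simp add: sum_divide_distrib[symmetric])
  qed
  show thesis by (rule that[of "\<lambda>i j. B $$ (i, j) / det A'"]) (use 1 2 in auto)
qed

text \<open>The last \<open>s - r\<close> columns of the inverse \<open>R\<close> span the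
  orthogonal complement of the first \<open>r\<close> rows of \<open>Q\<close>, so the right-hand
  side is a complementary minor of the dual space. The factor that involves \<open>Q\<close> does
  not depend on \<open>p\<close>.\<close>

lemma jacobi_complementary_minor:
  assumes QR: "\<And>i k. i < s \<Longrightarrow> k < s \<Longrightarrow> (\<Sum>j<s. Q i j * R j k) = (if i = k then 1 else 0)"
    and p: "p permutes {0..<s}" and r: "r \<le> s"
  shows "minor r Q p = signof p * minor s Q (\<lambda>c. c) *
    minor (s - r) (\<lambda>i j. R j (i + r)) (\<lambda>c. p (c + r))"
proof -
  \<comment> \<open>\<open>B\<close> consists of unit columns followed by columns of
    \<open>R\<close> with permuted rows. Multiplying the permuted \<open>Q\<close> by it keeps the
    first \<open>r\<close> columns and turns the others into unit columns; the claim compares the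
    determinants.\<close>
  define B where "B k c = (if c < r then (if k = c then 1 else 0) else R (p k) c)" for k c
  have re: "(\<Sum>k<s. Q i (p k) * R (p k) c) = (\<Sum>k<s. Q i k * R k c)" for i c
    using sum.permute[OF p, of "\<lambda>k. Q i k * R k c"] by (simp add: lessThan_atLeast0 comp_def)
  have QB: "(\<Sum>k<s. Q i (p k) * B k c) = (if c < r then Q i (p c) else if i = c then 1 else 0)"
    if "i < s" "c < s" for i c
  proof (cases "c < r")
    case True
    then have "(\<Sum>k<s. Q i (p k) * B k c) = (\<Sum>k<s. if k = c then Q i (p k) else 0)"
      by (intro sum.cong) (auto simp: B_def)
    then show ?thesis using True that by simp
  next
    case False
    then show ?thesis using re[of i c] QR[OF that] by (simp add: B_def)
  qed
  let ?P = "\<lambda>i c. \<Sum>k<s. Q i (p k) * B k c"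
  have "minor s ?P (\<lambda>c. c) = minor r ?P (\<lambda>c. c) * minor (s - r) (\<lambda>i. ?P (i + r)) (\<lambda>c. c + r)"
    by (rule minor_upper_right_zero[OF r]) (use QB r in auto)
  moreover have "minor r ?P (\<lambda>c. c) = minor r Q p"
    by (rule minor_cong) (use QB r in auto)
  moreover have "minor (s - r) (\<lambda>i. ?P (i + r)) (\<lambda>c. c + r) = 1"
    by (rule minor_delta) (use QB r in auto)
  moreover have "minor s ?P (\<lambda>c. c) = minor s Q p * minor s B (\<lambda>c. c)"
    unfolding minor_mult_rows by (simp add: minor_def)
  moreover have "minor s B (\<lambda>c. c) = minor r B (\<lambda>c. c) * minor (s - r) (\<lambda>i. B (i + r)) (\<lambda>c. c + r)"
    by (rule minor_lower_left_zero[OF r]) (auto simp: B_def)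
  moreover have "minor r B (\<lambda>c. c) = 1"
    by (rule minor_delta) (auto simp: B_def)
  moreover have "minor (s - r) (\<lambda>i. B (i + r)) (\<lambda>c. c + r) =
      minor (s - r) (\<lambda>i j. R j (i + r)) (\<lambda>c. p (c + r))"
    by (subst (2) minor_transpose) (rule minor_cong, simp add: B_def)
  moreover have "minor s Q p = signof p * minor s Q (\<lambda>c. c)"
    using minor_permute[OF p, of Q "\<lambda>c. c"] by simp
  ultimately show ?thesis by simp
qed

text \<open>This is the shuffle that lists \<open>J\<close> and then its complement in
  \<open>{0..<s}\<close>, both increasingly. Its sign is the one in Laplace expansion and in
  Jacobi's theorem.\<close>

definition split_perm :: "nat \<Rightarrow> nat set \<Rightarrow> nat \<Rightarrow> nat" where
  "split_perm s J c = (if c < s then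
     if c < card J then nth_elem J c else nth_elem ({0..<s} - J) (c - card J) else c)"

lemma split_perm_permutes:
  assumes J: "J \<subseteq> {0..<s}"
  shows "split_perm s J permutes {0..<s}"
proof (rule bij_imp_permutes)
  let ?r = "card J" and ?K = "{0..<s} - J"
  have fin: "finite J" using J finite_subset by blast
  have cK: "card ?K = s - ?r" using J by (simp add: card_Diff_subset fin)
  have r: "?r \<le> s" using card_mono[OF _ J] by simp
  have "bij_betw (split_perm s J) {0..<?r} J"
    by (subst bij_betw_cong[where g = "nth_elem J"]) (use r nth_elem_bij[OF fin refl] in \<open>auto simp: split_perm_def\<close>)
  moreover have "bij_betw (split_perm s J) {?r..<s} ?K"
  proof -
    have "bij_betw (\<lambda>c. c - ?r) {?r..<s} {0..<s - ?r}"
      by (rule bij_betw_byWitness[where f' = "\<lambda>c. c + ?r"]) auto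
    from bij_betw_trans[OF this nth_elem_bij[of ?K, OF _ cK]]
    have "bij_betw (\<lambda>c. nth_elem ?K (c - ?r)) {?r..<s} ?K" by (simp add: comp_def)
    then show ?thesis
      by (subst bij_betw_cong[where g = "\<lambda>c. nth_elem ?K (c - ?r)"]) (auto simp: split_perm_def)
  qed
  ultimately have "bij_betw (split_perm s J) ({0..<?r} \<union> {?r..<s}) (J \<union> ?K)"
    by (rule bij_betw_combine) auto
  moreover have "{0..<?r} \<union> {?r..<s} = {0..<s}" "J \<union> ?K = {0..<s}" using r J by auto
  ultimately show "bij_betw (split_perm s J) {0..<s} {0..<s}" by simp
qed (simp add: split_perm_def)

text \<open>
  The sign in Jacobi's theorem depends on \<open>J\<close>; dualising twice must give the identity up to a
  scalar that does not.
\<close>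

lemma sign_split_perm_complement:
  "\<exists>\<kappa>. \<kappa> * \<kappa> = (1::complex) \<and> (\<forall>J. J \<subseteq> {0..<s} \<and> card J = r \<longrightarrow>
     signof (split_perm s ({0..<s} - J)) = \<kappa> * signof (split_perm s J))"
proof (cases "r \<le> s")
  case True
  \<comment> \<open>Listing the complement first differs from listing \<open>J\<close> first by a
    rotation of the positions, which depends only on \<open>s\<close> and \<open>r\<close>. Its sign
    is the required scalar.\<close>
  define rot where "rot c = (if c < s then if c < s - r then c + r else c - (s - r) else c)" for c
  have rot: "rot permutes {0..<s}"
  proof (rule bij_imp_permutes)
    show "bij_betw rot {0..<s} {0..<s}"
      by (rule bij_betw_byWitness[where f' = "\<lambda>c. if c < r then c + (s - r) else c - r"])
         (use True in \<open>auto simp: rot_def\<close>)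
  qed (simp add: rot_def)
  have perm: "permutation p" if "p permutes {0..<s}" for p
    using that permutation_permutes by blast
  have "signof (split_perm s ({0..<s} - J)) = signof rot * (signof (split_perm s J) :: complex)"
    if J: "J \<subseteq> {0..<s}" "card J = r" for J
  proof -
    have cK: "card ({0..<s} - J) = s - r" using J by (simp add: card_Diff_subset finite_subset[OF J(1)])
    have "{0..<s} - ({0..<s} - J) = J" using J by auto
    then have "split_perm s ({0..<s} - J) = split_perm s J \<circ> rot"
      using True J cK by (auto simp: fun_eq_iff split_perm_def rot_def)
    then show ?thesis
      using sign_compose[OF perm perm, of "split_perm s J" rot] split_perm_permutes[OF J(1)] rot
      by simp
  qed
  then show ?thesis using signof_complex[of rot] by (intro exI[of _ "signof rot"]) auto
next
  case False
  then have "\<not> (J \<subseteq> {0..<s} \<and> card J = r)" for J using card_mono[of "{0..<s}" J] by auto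
  then show ?thesis by (intro exI[of _ 1]) auto
qed

definition symdiff :: "'a set \<Rightarrow> 'a set \<Rightarrow> 'a set" where
  "symdiff A B = (A - B) \<union> (B - A)"

lemma symdiff_symdiff [simp]: "symdiff (symdiff A B) B = A"
  by (auto simp: symdiff_def)

text \<open>Multiplying by the inverse of the block at \<open>I0\<close> changes all maximal minors
  by one common factor, which \<open>c\<close> absorbs.\<close>

lemma pluecker_cone_normal_form:
  assumes v: "v \<in> pluecker_cone m S \<I>" and I0: "v I0 \<noteq> 0"
  obtains M c where "\<And>I. v I = (if I \<subseteq> S \<and> card I = m then c * minor m M (nth_elem I) else 0)"
    and "\<And>i k. i < m \<Longrightarrow> k < m \<Longrightarrow> M i (nth_elem I0 k) = (if i = k then 1 else 0)"
proof -
  obtain M c where Mc: "\<And>I. v I = (if I \<subseteq> S \<and> card I = m then c * minor m M (nth_elem I) else 0)"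
    using v unfolding pluecker_cone_def by blast
  have "minor m M (nth_elem I0) \<noteq> 0" using I0 Mc[of I0] by (auto split: if_splits)
  then obtain B where B: "\<And>i k. i < m \<Longrightarrow> k < m \<Longrightarrow> (\<Sum>j<m. B i j * M j (nth_elem I0 k)) = (if i = k then 1 else 0)"
    by (rule matrix_inverse) blast
  define M' where "M' i k = (\<Sum>j<m. B i j * M j k)" for i k
  define b where "b = det (mat m m (\<lambda>(r, k). B r k))"
  have mm: "minor m M' f = b * minor m M f" for f
    unfolding M'_def b_def by (rule minor_mult_rows)
  have "minor m M' (nth_elem I0) = 1" by (rule minor_delta) (use B in \<open>auto simp: M'_def\<close>)
  then have "b \<noteq> 0" using mm by auto
  then have "c * minor m M f = c / b * minor m M' f" for f by (simp add: mm)
  then have "v I = (if I \<subseteq> S \<and> card I = m then c / b * minor m M' (nth_elem I) else 0)" for I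
    using Mc[of I] by simp
  moreover have "M' i (nth_elem I0 k) = (if i = k then 1 else 0)" if "i < m" "k < m" for i k
    using B that by (simp add: M'_def)
  ultimately show thesis by (rule that)
qed

lemma minor_nonzero_cong_image:
  assumes "bij_betw f {0..<m} I" "bij_betw f' {0..<m} I" "minor m M f \<noteq> 0"
  shows "minor m M f' \<noteq> 0"
  using minor_reorder[OF assms(1,2)] assms(3) by auto

text \<open>
  In normal form the entries of the matrix are Pluecker coordinates up to sign, so a restriction on
  the support forces them to vanish.
\<close>

lemma normal_form_entry:
  assumes nf: "\<And>i k. i < m \<Longrightarrow> k < m \<Longrightarrow> M i (f k) = (if i = k then 1 else 0)"
    and i: "i < m" and ne: "M i j \<noteq> 0"
  shows "minor m M (f(i := j)) \<noteq> 0"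
proof
  assume "minor m M (f(i := j)) = 0"
  then obtain x r where x: "r < m" "x r \<noteq> 0" "\<And>c. c < m \<Longrightarrow> (\<Sum>r<m. x r * M r ((f(i := j)) c)) = 0"
    unfolding minor_eq_0_iff by blast
  \<comment> \<open>The columns other than \<open>i\<close> are still unit vectors, so a relation
    between the rows can only involve row \<open>i\<close>.\<close>
  have x0: "x c = 0" if "c < m" "c \<noteq> i" for c
  proof -
    have "(\<Sum>r<m. x r * M r ((f(i := j)) c)) = (\<Sum>r<m. if r = c then x r else 0)"
      by (rule sum.cong) (use that nf in auto)
    then show ?thesis using x(3)[OF that(1)] that by simp
  qed
  have "(\<Sum>r<m. x r * M r ((f(i := j)) i)) = (\<Sum>r<m. if r = i then x r * M r j else 0)"
    by (rule sum.cong) (use x0 in auto)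
  then have "x i = 0" using x(3)[OF i] i ne by simp
  then show False using x0[OF x(1)] x(2) by (cases "r = i") auto
qed

section \<open>Partial duality\<close>

lemma nth_elem_prefix_split:
  assumes "I \<subseteq> {0..<n}"
  shows "nth_elem I c = (if c < card (I \<inter> {0..<s}) then nth_elem (I \<inter> {0..<s}) c
     else nth_elem (I - {0..<s}) (c - card (I \<inter> {0..<s})))"
proof -
  have f: "finite I" using assms finite_subset by blast
  have "nth_elem ((I \<inter> {0..<s}) \<union> (I - {0..<s})) c = (if c < card (I \<inter> {0..<s}) then nth_elem (I \<inter> {0..<s}) c
     else nth_elem (I - {0..<s}) (c - card (I \<inter> {0..<s})))"
    by (rule nth_elem_append) (use f in auto)
  then show ?thesis by (simp add: Int_Diff_Un)
qed

lemma nth_elem_less_iff: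
  assumes "I \<subseteq> {0..<n}" "c < card I"
  shows "nth_elem I c < s \<longleftrightarrow> c < card (I \<inter> {0..<s})"
proof -
  have f: "finite I" using assms finite_subset by blast
  have cI: "card I = card (I \<inter> {0..<s}) + card (I - {0..<s})"
    using card_Int_Diff[OF f] .
  show ?thesis
  proof (cases "c < card (I \<inter> {0..<s})")
    case True
    then show ?thesis using nth_elem_in[of "I \<inter> {0..<s}" c] f nth_elem_prefix_split[OF assms(1), of c s] by auto
  next
    case False
    then show ?thesis using nth_elem_in[of "I - {0..<s}" "c - card (I \<inter> {0..<s})"] f assms(2) cI
        nth_elem_prefix_split[OF assms(1), of c s] by auto
  qed
qed

lemma card_prefix_nth_elem:
  assumes "I \<subseteq> {0..<n}" "card I = m"
  shows "card {c \<in> {0..<m}. nth_elem I c < s} = card (I \<inter> {0..<s})"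
proof -
  have f: "finite I" using assms finite_subset by blast
  have "card (I \<inter> {0..<s}) \<le> m" using assms(2) card_mono[OF f, of "I \<inter> {0..<s}"] by auto
  moreover have "{c \<in> {0..<m}. nth_elem I c < s} = {c \<in> {0..<m}. c < card (I \<inter> {0..<s})}"
    using nth_elem_less_iff[OF assms(1)] assms(2) by auto
  moreover have "{c \<in> {0..<m}. c < card (I \<inter> {0..<s})} = {0..<card (I \<inter> {0..<s})}" using calculation(1) by auto
  ultimately show ?thesis by simp
qed

lemma minor_block_diagonal:
  assumes I: "I \<subseteq> {0..<n}" "card I = m" and q: "card (I \<inter> {0..<s}) = q"
    and M: "\<And>i j. i < m \<Longrightarrow> j < n \<Longrightarrow> M i j \<noteq> 0 \<Longrightarrow> i < q \<longleftrightarrow> j < s"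
  shows "minor m M (nth_elem I) = minor q M (nth_elem (I \<inter> {0..<s})) *
    minor (m - q) (\<lambda>i. M (i + q)) (nth_elem (I - {0..<s}))"
proof -
  have f: "finite I" using I finite_subset by blast
  have qm: "q \<le> m" using I(2) q card_mono[OF f, of "I \<inter> {0..<s}"] by auto
  have "minor m M (nth_elem I) = minor q M (nth_elem I) *
    minor (m - q) (\<lambda>i. M (i + q)) (\<lambda>c. nth_elem I (c + q))"
  proof (rule minor_lower_left_zero[OF qm])
    fix i c assume ic: "q \<le> i" "i < m" "c < q"
    have "nth_elem I c < s" using nth_elem_less_iff[OF I(1), of c s] ic qm I(2) q by auto
    moreover have "nth_elem I c < n" using nth_elem_in[OF f, of c] ic qm I by auto
    ultimately show "M i (nth_elem I c) = 0" using M[of i "nth_elem I c"] ic by auto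
  qed
  moreover have "minor q M (nth_elem I) = minor q M (nth_elem (I \<inter> {0..<s}))"
    by (rule minor_cong) (simp add: nth_elem_prefix_split[OF I(1), of _ s] q)
  moreover have "minor (m - q) (\<lambda>i. M (i + q)) (\<lambda>c. nth_elem I (c + q)) =
     minor (m - q) (\<lambda>i. M (i + q)) (nth_elem (I - {0..<s}))"
    by (rule minor_cong) (simp add: nth_elem_prefix_split[OF I(1), of _ s] q)
  ultimately show ?thesis by simp
qed

text \<open>In normal form \<open>r\<close> rows live on the first \<open>s\<close> columns and
  \<open>m - r\<close> rows on the remaining ones. The first block is replaced by a basis of its
  orthogonal complement, which has \<open>s - r\<close> rows, and the second is kept. For the image
  \<open>J\<close> of \<open>I\<close> the set \<open>{0..<s} - J\<close> equals
  \<open>I \<inter> {0..<s}\<close>, so the coefficient is the Jacobi sign of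
  \<open>I\<close>.\<close>

lemma pluecker_cone_partial_dual_into:
  assumes sn: "s \<le> n" and \<I>: "\<And>I. I \<in> \<I> \<Longrightarrow> I \<subseteq> {0..<n} \<and> card (I \<inter> {0..<s}) = r"
    and v: "v \<in> pluecker_cone m {0..<n} \<I>"
  defines "\<epsilon> \<equiv> \<lambda>J. if J \<subseteq> {0..<n} then signof (split_perm s ({0..<s} - J)) else 0"
  shows "monomial_map \<epsilon> (\<lambda>J. symdiff J {0..<s}) v
     \<in> pluecker_cone ((s - r) + (m - r)) {0..<n} ((\<lambda>I. symdiff I {0..<s}) ` \<I>)"
proof -
  let ?T = "{0..<s}" and ?m' = "(s - r) + (m - r)"
  have vI: "v I = 0" if "I \<notin> \<I>" for I using v that unfolding pluecker_cone_def by blast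
  obtain I0 where I0: "v I0 \<noteq> 0" using v unfolding pluecker_cone_def by (auto simp: fun_eq_iff)
  obtain M c where Mc: "\<And>I. v I = (if I \<subseteq> {0..<n} \<and> card I = m then c * minor m M (nth_elem I) else 0)"
    and nf: "\<And>i k. i < m \<Longrightarrow> k < m \<Longrightarrow> M i (nth_elem I0 k) = (if i = k then 1 else 0)"
    by (rule pluecker_cone_normal_form[OF v I0]) (rule that)
  have I0n: "I0 \<subseteq> {0..<n}" and I0m: "card I0 = m" and c0: "c \<noteq> 0" using Mc[of I0] I0 by (auto split: if_splits)
  have fI0: "finite I0" using I0n finite_subset by blast
  have I0r: "card (I0 \<inter> ?T) = r" using \<I>[of I0] vI[of I0] I0 by blast
  have rs: "r \<le> s" using card_mono[of ?T "I0 \<inter> ?T"] I0r by simp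
  have rm: "r \<le> m" using card_mono[of I0 "I0 \<inter> ?T"] fI0 I0r I0m by simp
  let ?f = "nth_elem I0"
  have fbij: "bij_betw ?f {0..<m} I0" by (rule nth_elem_bij[OF fI0 I0m])
  \<comment> \<open>A nonzero entry lets column \<open>?f i\<close> of \<open>I0\<close> be
    exchanged for \<open>j\<close> without killing the coordinate. The new index set must again have
    \<open>r\<close> elements below \<open>s\<close>, so both columns lie on the same side of
    \<open>s\<close>.\<close>
  have block: "i < r \<longleftrightarrow> j < s" if "i < m" "j < n" "M i j \<noteq> 0" for i j
  proof -
    have fi: "?f i < s \<longleftrightarrow> i < r" using nth_elem_less_iff[OF I0n, of i s] that I0m I0r by simp
    show ?thesis
    proof (cases "j \<in> I0")
      case True
      then obtain k where "k < m" "j = ?f k" using nth_elem_surj[OF fI0 I0m] by metis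
      then show ?thesis using nf[of i k] that fi by (auto split: if_splits)
    next
      case False
      let ?I = "insert j (I0 - {?f i})"
      have fiI: "?f i \<in> I0" using nth_elem_in[OF fI0] that I0m by auto
      have bij: "bij_betw (?f(i := j)) {0..<m} ?I"
      proof -
        have "bij_betw ?f ({0..<m} - {i}) (I0 - {?f i})"
          using bij_betw_DiffI[OF fbij, of "{i}" "{?f i}"] that fiI by (simp add: bij_betw_def)
        then have "bij_betw (?f(i := j)) ({0..<m} - {i}) (I0 - {?f i})"
          by (subst bij_betw_cong[where g = ?f]) auto
        moreover have "bij_betw (?f(i := j)) {i} {j}" by (simp add: bij_betw_def)
        ultimately have "bij_betw (?f(i := j)) (({0..<m} - {i}) \<union> {i}) ((I0 - {?f i}) \<union> {j})"
          by (rule bij_betw_combine) (use False in auto)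
        moreover have "({0..<m} - {i}) \<union> {i} = {0..<m}" using that by auto
        ultimately show ?thesis by simp
      qed
      have cI: "card ?I = m" using bij_betw_same_card[OF bij] by simp
      have "minor m M (?f(i := j)) \<noteq> 0" by (rule normal_form_entry[of m M ?f, OF nf that(1,3)])
      then have "minor m M (nth_elem ?I) \<noteq> 0"
        by (rule minor_nonzero_cong_image[OF bij nth_elem_bij, rotated -1]) (use fI0 cI in auto)
      then have "v ?I \<noteq> 0" using Mc[of ?I] cI I0n that c0 by auto
      then have "card (?I \<inter> ?T) = r" using \<I> vI by blast
      moreover have "card (?I \<inter> ?T) = card (I0 \<inter> ?T) + (if j < s then 1 else 0) - (if ?f i < s then 1 else 0)"
      proof -
        have e: "?I \<inter> ?T = (if j < s then insert j ((I0 \<inter> ?T) - {?f i}) else (I0 \<inter> ?T) - {?f i})" by auto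
        have pos: "?f i < s \<Longrightarrow> Suc (card (I0 \<inter> ?T) - Suc 0) = card (I0 \<inter> ?T)"
          by (rule Suc_pred) (use fiI fI0 in \<open>auto simp: card_gt_0_iff\<close>)
        show ?thesis unfolding e using False fI0 fiI pos
          by (cases "j < s"; cases "?f i < s") (simp_all add: card_Diff_singleton_if)
      qed
      moreover have "?f i < s \<Longrightarrow> card (I0 \<inter> ?T) \<noteq> 0" using fiI fI0 by auto
      ultimately show ?thesis using fi I0r by (auto split: if_splits)
    qed
  qed
  define \<pi>0 where "\<pi>0 = split_perm s (I0 \<inter> ?T)"
  have \<pi>0: "\<pi>0 permutes {0..<s}" unfolding \<pi>0_def by (rule split_perm_permutes) auto
  \<comment> \<open>The first block is completed to an invertible square matrix by unit rows at the
    columns below \<open>s\<close> that are missing from \<open>I0\<close>; \<open>\<pi>0\<close>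
    lists those of \<open>I0\<close> first.\<close>
  define Q where "Q i j = (if i < r then M i j else if j = \<pi>0 i then 1 else (0::complex))" for i j
  have "minor s Q \<pi>0 = minor r Q \<pi>0 * minor (s - r) (\<lambda>i. Q (i + r)) (\<lambda>c. \<pi>0 (c + r))"
    by (rule minor_lower_left_zero[OF rs]) (use permutes_inj[OF \<pi>0] in \<open>auto simp: Q_def inj_eq\<close>)
  moreover have "minor r Q \<pi>0 = 1"
  proof (rule minor_delta)
    fix i c assume ic: "i < r" "c < r"
    then have "\<pi>0 c = ?f c" using nth_elem_prefix_split[OF I0n, of c s] I0r rs by (simp add: \<pi>0_def split_perm_def)
    then show "Q i (\<pi>0 c) = (if i = c then 1 else 0)" using nf[of i c] ic rm by (simp add: Q_def)
  qed
  moreover have "minor (s - r) (\<lambda>i. Q (i + r)) (\<lambda>c. \<pi>0 (c + r)) = 1"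
    by (rule minor_delta) (use permutes_inj[OF \<pi>0] in \<open>auto simp: Q_def inj_eq\<close>)
  ultimately have "minor s Q \<pi>0 = 1" by simp
  then have dQ: "minor s Q (\<lambda>c. c) \<noteq> 0" using minor_permute[OF \<pi>0, of Q "\<lambda>c. c"] by auto
  then obtain R where R: "\<And>i k. i < s \<Longrightarrow> k < s \<Longrightarrow> (\<Sum>j<s. Q i j * R j k) = (if i = k then 1 else 0)"
    by (rule matrix_inverse) blast
  \<comment> \<open>Its first \<open>s - r\<close> rows are the last columns of \<open>R\<close>,
    transposed; then come the rows of \<open>M\<close> from row \<open>r\<close> on, whence the
    index shift.\<close>
  define M' where "M' i j = (if i < s - r then if j < s then R j (i + r) else 0
      else if j < s then 0 else M (i - (s - r) + r) j)" for i j
  have block': "i < s - r \<longleftrightarrow> j < s" if "M' i j \<noteq> 0" for i j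
    using that by (auto simp: M'_def split: if_splits)
  \<comment> \<open>Both minors factor along the blocks. The factors beyond \<open>s\<close>
    coincide, and Jacobi's theorem relates those below \<open>s\<close>; the determinant of
    \<open>Q\<close> is common to all \<open>I\<close>.\<close>
  have key: "signof (split_perm s (I \<inter> ?T)) * minor m M (nth_elem I) =
      minor s Q (\<lambda>c. c) * minor ?m' M' (nth_elem (symdiff I ?T))"
    if I: "I \<subseteq> {0..<n}" "card I = m" "card (I \<inter> ?T) = r" for I
  proof -
    let ?J = "symdiff I ?T" and ?\<pi> = "split_perm s (I \<inter> ?T)"
    have fI: "finite I" using I finite_subset by blast
    have \<pi>: "?\<pi> permutes {0..<s}" by (rule split_perm_permutes) auto
    have JT: "?J \<inter> ?T = ?T - I \<inter> ?T" "?J - ?T = I - ?T" by (auto simp: symdiff_def)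
    have cJT: "card (?J \<inter> ?T) = s - r" using I unfolding JT by (subst card_Diff_subset) auto
    have cJT': "card (?J - ?T) = m - r" using I card_Int_Diff[OF fI, of ?T] unfolding JT by simp
    have Jn: "?J \<subseteq> {0..<n}" using I sn by (auto simp: symdiff_def)
    then have fJ: "finite ?J" using finite_subset by blast
    have cJ: "card ?J = ?m'" using card_Int_Diff[OF fJ, of ?T] cJT cJT' by simp
    have "minor ?m' M' (nth_elem ?J) = minor (s - r) M' (nth_elem (?J \<inter> ?T)) *
        minor (?m' - (s - r)) (\<lambda>i. M' (i + (s - r))) (nth_elem (?J - ?T))"
      by (rule minor_block_diagonal[OF Jn cJ cJT]) (use block' in auto)
    also have "minor (s - r) M' (nth_elem (?J \<inter> ?T)) = minor (s - r) (\<lambda>i j. R j (i + r)) (\<lambda>c. ?\<pi> (c + r))"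
    proof (rule minor_cong)
      fix i c assume ic: "i < s - r" "c < s - r"
      then have "nth_elem (?J \<inter> ?T) c \<in> ?J \<inter> ?T" using nth_elem_in[of "?J \<inter> ?T" c] cJT by auto
      then show "M' i (nth_elem (?J \<inter> ?T) c) = R (?\<pi> (c + r)) (i + r)"
        using ic I(3) less_diff_conv[of c s r] by (simp add: M'_def split_perm_def JT)
    qed
    also have "minor (?m' - (s - r)) (\<lambda>i. M' (i + (s - r))) (nth_elem (?J - ?T)) =
        minor (m - r) (\<lambda>i. M (i + r)) (nth_elem (I - ?T))"
    proof (simp only: diff_add_inverse JT, rule minor_cong)
      fix i c assume ic: "i < m - r" "c < m - r"
      then have "nth_elem (I - ?T) c \<in> I - ?T" using nth_elem_in[of "I - ?T" c] fI cJT' JT by auto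
      then show "M' (i + (s - r)) (nth_elem (I - ?T) c) = M (i + r) (nth_elem (I - ?T) c)"
        by (simp add: M'_def)
    qed
    finally have 1: "minor ?m' M' (nth_elem ?J) = minor (s - r) (\<lambda>i j. R j (i + r)) (\<lambda>c. ?\<pi> (c + r)) *
        minor (m - r) (\<lambda>i. M (i + r)) (nth_elem (I - ?T))" .
    have 2: "minor m M (nth_elem I) = minor r M (nth_elem (I \<inter> ?T)) *
        minor (m - r) (\<lambda>i. M (i + r)) (nth_elem (I - ?T))"
      by (rule minor_block_diagonal[OF I]) (use block in auto)
    have 3: "minor r M (nth_elem (I \<inter> ?T)) = minor r Q ?\<pi>"
      by (rule minor_cong) (use I(3) rs in \<open>auto simp: Q_def split_perm_def\<close>)
    have 4: "minor r Q ?\<pi> = signof ?\<pi> * minor s Q (\<lambda>c. c) *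
        minor (s - r) (\<lambda>i j. R j (i + r)) (\<lambda>c. ?\<pi> (c + r))"
      by (rule jacobi_complementary_minor[OF R \<pi> rs])
    have "signof ?\<pi> * signof ?\<pi> = (1::complex)" using signof_complex[of ?\<pi>] by auto
    then show ?thesis unfolding 1 2 3 4 by (simp add: mult.assoc[symmetric])
  qed
  have Tn: "symdiff J ?T \<subseteq> {0..<n} \<longleftrightarrow> J \<subseteq> {0..<n}" for J using sn by (auto simp: symdiff_def)
  show ?thesis
  proof (rule pluecker_coneI)
    have "?T - symdiff I0 ?T = I0 \<inter> ?T" by (auto simp: symdiff_def)
    then show "monomial_map \<epsilon> (\<lambda>J. symdiff J ?T) v (symdiff I0 ?T) \<noteq> 0"
      using I0 Tn I0n signof_complex[of "split_perm s (I0 \<inter> ?T)"] by (auto simp: monomial_map_def \<epsilon>_def)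
    show "monomial_map \<epsilon> (\<lambda>J. symdiff J ?T) v J = 0" if "J \<notin> (\<lambda>I. symdiff I ?T) ` \<I>" for J
    proof -
      have "symdiff J ?T \<notin> \<I>" using that by (metis image_eqI symdiff_symdiff)
      then show ?thesis using vI by (simp add: monomial_map_def)
    qed
    fix J
    let ?I = "symdiff J ?T"
    have JI: "J = symdiff ?I ?T" by simp
    show "monomial_map \<epsilon> (\<lambda>J. symdiff J ?T) v J =
      (if J \<subseteq> {0..<n} \<and> card J = ?m' then c * minor s Q (\<lambda>c. c) * minor ?m' M' (nth_elem J) else 0)"
    proof (cases "J \<subseteq> {0..<n}")
      case True
      have fJ: "finite J" using True finite_subset by blast
      have In: "?I \<subseteq> {0..<n}" using True Tn by simp
      have IT: "?I \<inter> ?T = ?T - J \<inter> ?T" "?I - ?T = J - ?T" by (auto simp: symdiff_def)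
      have eT: "?T - J = ?I \<inter> ?T" by (auto simp: symdiff_def)
      have cIT: "card (?I \<inter> ?T) = s - card (J \<inter> ?T)" unfolding IT by (subst card_Diff_subset) auto
      have cIT': "card (?I - ?T) = card J - card (J \<inter> ?T)"
        using card_Int_Diff[OF fJ, of ?T] unfolding IT by simp
      have cI: "card ?I = card (?I \<inter> ?T) + card (?I - ?T)" using card_Int_Diff[of ?I ?T] In finite_subset by blast
      have JTs: "card (J \<inter> ?T) \<le> s" using card_mono[of ?T "J \<inter> ?T"] by simp
      have JTJ: "card (J \<inter> ?T) \<le> card J" using card_mono[of J "J \<inter> ?T"] fJ by simp
      show ?thesis
      proof (cases "card (?I \<inter> ?T) = r")
        case r: True
        then have "card J = ?m' \<longleftrightarrow> card ?I = m" using cIT cIT' cI JTs JTJ rs rm by linarith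
        moreover have "card ?I = m \<Longrightarrow> signof (split_perm s (?I \<inter> ?T)) * minor m M (nth_elem ?I) =
            minor s Q (\<lambda>c. c) * minor ?m' M' (nth_elem J)"
          using key[OF In _ r] by simp
        ultimately show ?thesis using True In
          by (auto simp: monomial_map_def \<epsilon>_def Mc eT mult.assoc mult.left_commute)
      next
        case False
        then have "?I \<notin> \<I>" using \<I> by blast
        then have 0: "v ?I = 0" by (rule vI)
        \<comment> \<open>A set \<open>J\<close> of the right size with a wrong number of columns
          below \<open>s\<close> corresponds to no admissible set. The minor of \<open>M'\<close>
          has to vanish there on its own, and it does because of the block form.\<close>
        have "minor ?m' M' (nth_elem J) = 0" if "card J = ?m'"
        proof (rule minor_block_mismatch[where q = "s - r" and s = s])
          show "card {c \<in> {0..<?m'}. nth_elem J c < s} \<noteq> s - r"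
            using card_prefix_nth_elem[OF True that, of s] False cIT JTs rs by auto
        qed (use block' in auto)
        then show ?thesis using 0 by (auto simp: monomial_map_def)
      qed
    qed (simp add: monomial_map_def \<epsilon>_def)
  qed
qed

text \<open>The way back is the same construction with \<open>s - r\<close> in place of
  \<open>r\<close>. It produces signs of complementary shuffles, whereas the exact inverse of
  \<open>\<epsilon>\<close> needs the coefficients \<open>\<delta>\<close>. On the support the two
  differ by one constant \<open>\<kappa>\<close>, and the cone is stable under nonzero
  scalars.\<close>

lemma pluecker_cone_partial_dual_prefix:
  assumes sn: "s \<le> n" and \<I>: "\<And>I. I \<in> \<I> \<Longrightarrow> I \<subseteq> {0..<n} \<and> card (I \<inter> {0..<s}) = r"
    and rm: "r \<le> s" "r \<le> m"
  shows "monomial_equiv (pluecker_cone m {0..<n} \<I>)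
     (pluecker_cone ((s - r) + (m - r)) {0..<n} ((\<lambda>I. symdiff I {0..<s}) ` \<I>))"
proof -
  let ?T = "{0..<s}" and ?m' = "(s - r) + (m - r)"
  let ?D = "\<lambda>I. symdiff I {0..<s}"
  define \<epsilon> :: "nat set \<Rightarrow> complex" where "\<epsilon> = (\<lambda>J. if J \<subseteq> {0..<n} then signof (split_perm s (?T - J)) else 0)"
  define \<delta> :: "nat set \<Rightarrow> complex" where "\<delta> = (\<lambda>J. if J \<subseteq> {0..<n} then signof (split_perm s (J \<inter> ?T)) else 0)"
  have Tn: "?D J \<subseteq> {0..<n} \<longleftrightarrow> J \<subseteq> {0..<n}" for J using sn by (auto simp: symdiff_def)
  have eT: "?T - ?D J = J \<inter> ?T" "?D J \<inter> ?T = ?T - J" for J by (auto simp: symdiff_def)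
  have supp: "u I = 0" if "u \<in> pluecker_cone k {0..<n} \<J>" "\<not> I \<subseteq> {0..<n}" for u k \<J> I
    using that unfolding pluecker_cone_def by (smt (verit) mem_Collect_eq)
  have sq: "signof p * signof p = (1::complex)" for p using signof_complex[of p] by auto
  have into: "monomial_map \<delta> ?D w \<in> pluecker_cone m {0..<n} \<I>"
    if w: "w \<in> pluecker_cone ?m' {0..<n} (?D ` \<I>)" for w
  proof -
    have 1: "monomial_map \<epsilon> ?D w \<in> pluecker_cone ((s - (s - r)) + (?m' - (s - r))) {0..<n} (?D ` ?D ` \<I>)"
      unfolding \<epsilon>_def
    proof (rule pluecker_cone_partial_dual_into[OF sn _ w])
      fix J assume "J \<in> ?D ` \<I>"
      then obtain I where I: "I \<in> \<I>" "J = ?D I" by blast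
      have "card (?T - I \<inter> ?T) = s - r" using \<I>[OF I(1)] by (subst card_Diff_subset) auto
      moreover have "?T - I \<inter> ?T = ?T - I" by auto
      ultimately show "J \<subseteq> {0..<n} \<and> card (J \<inter> ?T) = s - r"
        using \<I>[OF I(1)] I(2) Tn eT by simp
    qed
    obtain \<kappa> where \<kappa>: "\<kappa> * \<kappa> = (1::complex)" "\<And>J. J \<subseteq> ?T \<Longrightarrow> card J = r \<Longrightarrow>
        signof (split_perm s (?T - J)) = \<kappa> * signof (split_perm s J)"
      using sign_split_perm_complement[of s r] by blast
    have "fscale \<kappa> (monomial_map \<epsilon> ?D w) = monomial_map \<delta> ?D w"
    proof
      fix I show "fscale \<kappa> (monomial_map \<epsilon> ?D w) I = monomial_map \<delta> ?D w I"
      proof (cases "I \<in> \<I>")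
        case True
        have "signof (split_perm s (?T - I)) = \<kappa> * signof (split_perm s (I \<inter> ?T))"
          using \<kappa>(2)[of "I \<inter> ?T"] \<I>[OF True] by (simp add: Diff_Int)
        then show ?thesis using \<kappa>(1) \<I>[OF True]
          by (simp add: fscale_def monomial_map_def \<epsilon>_def \<delta>_def mult.assoc[symmetric])
      next
        case False
        have "?D I \<notin> ?D ` \<I>"
        proof
          assume "?D I \<in> ?D ` \<I>"
          then obtain I' where "I' \<in> \<I>" "?D I = ?D I'" by blast
          then have "I' \<in> \<I>" "?D (?D I) = ?D (?D I')" by simp_all
          then have "I' \<in> \<I>" "I = I'" by (simp_all only: symdiff_symdiff)
          then show False using False by blast
        qed
        then have "w (?D I) = 0" using w unfolding pluecker_cone_def by blast
        then show ?thesis by (simp add: fscale_def monomial_map_def)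
      qed
    qed
    moreover have "\<kappa> \<noteq> 0" using \<kappa>(1) by auto
    ultimately have "monomial_map \<delta> ?D w \<in> pluecker_cone ((s - (s - r)) + (?m' - (s - r))) {0..<n} (?D ` ?D ` \<I>)"
      using pluecker_cone_fscale[OF 1] by metis
    moreover have "?D ` ?D ` \<I> = \<I>" by (simp add: image_image)
    ultimately show ?thesis using rm by simp
  qed
  show ?thesis
  proof (rule monomial_equivI[OF _ _ into])
    fix v assume v: "v \<in> pluecker_cone m {0..<n} \<I>"
    show "monomial_map \<epsilon> ?D v \<in> pluecker_cone ?m' {0..<n} (?D ` \<I>)"
      unfolding \<epsilon>_def by (rule pluecker_cone_partial_dual_into[OF sn \<I> v])
    show "monomial_map \<delta> ?D (monomial_map \<epsilon> ?D v) = v"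
      using supp[OF v] sq by (auto simp: fun_eq_iff monomial_map_def \<epsilon>_def \<delta>_def Tn eT mult.assoc[symmetric])
  next
    fix w assume w: "w \<in> pluecker_cone ?m' {0..<n} (?D ` \<I>)"
    show "monomial_map \<epsilon> ?D (monomial_map \<delta> ?D w) = w"
      using supp[OF w] sq by (auto simp: fun_eq_iff monomial_map_def \<epsilon>_def \<delta>_def Tn eT mult.assoc[symmetric])
  qed
qed

lemma image_symdiff: "inj_on g S \<Longrightarrow> I \<subseteq> S \<Longrightarrow> D \<subseteq> S \<Longrightarrow> g ` symdiff I D = symdiff (g ` I) (g ` D)"
  unfolding symdiff_def by (auto dest: inj_onD)

text \<open>A relabelling of the columns that moves \<open>D\<close> to an initial segment reduces
  this to the previous case; the same relabelling is undone after dualising.\<close>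

lemma pluecker_cone_partial_dual:
  assumes S: "finite S" and D: "D \<subseteq> S" and \<I>: "\<And>I. I \<in> \<I> \<Longrightarrow> I \<subseteq> S \<and> card (I \<inter> D) = r"
    and rm: "r \<le> card D" "r \<le> m"
  shows "monomial_equiv (pluecker_cone m S \<I>)
     (pluecker_cone ((card D - r) + (m - r)) S ((\<lambda>I. symdiff I D) ` \<I>))"
proof -
  let ?s = "card D" and ?n = "card S"
  have fD: "finite D" using D S finite_subset by blast
  have sn: "?s \<le> ?n" by (rule card_mono[OF S D])
  obtain g1 where g1: "bij_betw g1 D {0..<?s}" using ex_bij_betw_finite_nat[OF fD] by blast
  have "card (S - D) = card {?s..<?n}" using D S fD by (simp add: card_Diff_subset)
  then obtain g2 where g2: "bij_betw g2 (S - D) {?s..<?n}"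
    using finite_same_card_bij[of "S - D" "{?s..<?n}"] S by auto
  define g where "g x = (if x \<in> D then g1 x else g2 x)" for x
  have b1: "bij_betw g D {0..<?s}" using g1 by (subst bij_betw_cong[where g = g1]) (auto simp: g_def)
  have b2: "bij_betw g (S - D) {?s..<?n}" using g2 by (subst bij_betw_cong[where g = g2]) (auto simp: g_def)
  have "bij_betw g (D \<union> (S - D)) ({0..<?s} \<union> {?s..<?n})" by (rule bij_betw_combine[OF b1 b2]) auto
  moreover have "D \<union> (S - D) = S" "{0..<?s} \<union> {?s..<?n} = {0..<?n}" using D sn by auto
  ultimately have b: "bij_betw g S {0..<?n}" by simp
  have gi: "inj_on g S" and gS: "g ` S = {0..<?n}" and gD: "g ` D = {0..<?s}"
    using b b1 by (auto simp: bij_betw_def)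
  let ?m' = "(?s - r) + (m - r)"
  let ?J = "(`) g ` \<I>"
  have 1: "monomial_equiv (pluecker_cone m S \<I>) (pluecker_cone m {0..<?n} ?J)"
    using pluecker_cone_relabel[OF S gi, of \<I> m] \<I> by (simp add: gS)
  have 2: "monomial_equiv (pluecker_cone m {0..<?n} ?J)
     (pluecker_cone ?m' {0..<?n} ((\<lambda>I. symdiff I {0..<?s}) ` ?J))"
  proof (rule pluecker_cone_partial_dual_prefix[OF sn _ rm])
    fix J assume "J \<in> ?J"
    then obtain I where I: "I \<in> \<I>" "J = g ` I" by blast
    have IS: "I \<subseteq> S" using \<I>[OF I(1)] by blast
    have "J \<inter> {0..<?s} = g ` (I \<inter> D)"
      using inj_on_image_Int[OF gi IS D] I by (simp add: gD)
    moreover have "card (g ` (I \<inter> D)) = card (I \<inter> D)"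
      by (rule card_image) (use gi IS in \<open>auto intro: inj_on_subset\<close>)
    ultimately show "J \<subseteq> {0..<?n} \<and> card (J \<inter> {0..<?s}) = r"
      using \<I>[OF I(1)] I(2) image_mono[OF IS, of g] by (simp add: gS)
  qed
  have eq: "(\<lambda>I. symdiff I {0..<?s}) ` ?J = (`) g ` (\<lambda>I. symdiff I D) ` \<I>"
    unfolding image_image
  proof (rule image_cong[OF refl])
    fix I assume "I \<in> \<I>"
    then have "I \<subseteq> S" using \<I> by blast
    then show "symdiff (g ` I) {0..<?s} = g ` symdiff I D"
      using image_symdiff[OF gi _ D] by (simp add: gD)
  qed
  have 3: "monomial_equiv (pluecker_cone ?m' S ((\<lambda>I. symdiff I D) ` \<I>)) 
     (pluecker_cone ?m' {0..<?n} ((\<lambda>I. symdiff I {0..<?s}) ` ?J))"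
    unfolding eq gS[symmetric]
    by (rule pluecker_cone_relabel[OF S gi]) (use \<I> D in \<open>auto simp: symdiff_def\<close>)
  show ?thesis
    using monomial_equiv_trans[OF monomial_equiv_trans[OF 1 2] monomial_equiv_sym[OF 3]] .
qed

section \<open>The cone of a Richardson variety\<close>

lemma sum_fun_apply: "(\<Sum>x\<in>A. f x) i = (\<Sum>x\<in>A. f x (i :: 'a) :: complex)"
  by (induction A rule: infinite_finite_induct) auto

lemma mem_coord_span_iff:
  assumes "finite J"
  shows "v \<in> coord_span J \<longleftrightarrow> (\<forall>i. i \<notin> J \<longrightarrow> v i = 0)"
proof
  have sub: "cvec.subspace {v. \<forall>i. i \<notin> J \<longrightarrow> v i = (0::complex)}"
    by (auto simp: cvec.subspace_def fscale_def)
  have "coord_span J \<subseteq> {v. \<forall>i. i \<notin> J \<longrightarrow> v i = (0::complex)}"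
    unfolding coord_span_def by (rule cvec.span_minimal[OF _ sub]) (auto simp: std_basis_def)
  then show "v \<in> coord_span J \<Longrightarrow> \<forall>i. i \<notin> J \<longrightarrow> v i = 0" by blast
next
  assume v: "\<forall>i. i \<notin> J \<longrightarrow> v i = 0"
  have "v = (\<Sum>j\<in>J. fscale (v j) (std_basis j))"
  proof
    fix i
    have "(\<Sum>j\<in>J. fscale (v j) (std_basis j)) i = (\<Sum>j\<in>J. if j = i then v j else 0)"
      unfolding sum_fun_apply by (rule sum.cong) (auto simp: fscale_def std_basis_def)
    then show "v i = (\<Sum>j\<in>J. fscale (v j) (std_basis j)) i" using v assms by simp
  qed
  also have "\<dots> \<in> coord_span J"
    unfolding coord_span_def by (intro cvec.span_sum cvec.span_scale cvec.span_base) auto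
  finally show "v \<in> coord_span J" .
qed

section \<open>Bases of subspaces and the coordinate sets that detect them\<close>

definition row_comb :: "nat \<Rightarrow> (nat \<Rightarrow> nat \<Rightarrow> complex) \<Rightarrow> (nat \<Rightarrow> complex) \<Rightarrow> nat \<Rightarrow> complex" where
  "row_comb m b x = (\<lambda>i. \<Sum>r<m. x r * b r i)"

lemma row_comb_sum: "row_comb m b x = (\<Sum>r<m. fscale (x r) (b r))"
  by (simp add: row_comb_def fun_eq_iff sum_fun_apply fscale_def)

text \<open>Independence and span of a set of vectors are traded for coefficients indexed by rows,
  the form in which kernels of minors appear.\<close>

lemma ordered_basis_iff:
  "ordered_basis m b \<Sigma> \<longleftrightarrow>
    (\<forall>x. row_comb m b x = 0 \<longrightarrow> (\<forall>r<m. x r = 0)) \<and> \<Sigma> = range (row_comb m b)" (is "?L \<longleftrightarrow> ?R")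
proof -
  have span: "cvec.span (b ` {..<m}) = range (row_comb m b)" if inj: "inj_on b {..<m}"
  proof -
    have re: "(\<Sum>v\<in>b ` {..<m}. fscale (u v) v) = row_comb m b (\<lambda>r. u (b r))" for u
      by (simp add: row_comb_sum sum.reindex[OF inj])
    have "row_comb m b x = row_comb m b (\<lambda>r. x (inv_into {..<m} b (b r)))" for x
      unfolding row_comb_def using inv_into_f_f[OF inj] by (auto simp: fun_eq_iff intro!: sum.cong)
    then have "row_comb m b x \<in> range (\<lambda>u. row_comb m b (\<lambda>r. u (b r)))" for x
      by (rule range_eqI[where x = "\<lambda>v. x (inv_into {..<m} b v)"])
    then show ?thesis by (auto simp: cvec.span_finite re)
  qed
  show ?thesis
  proof
    assume L: ?L
    then have inj: "inj_on b {..<m}" and ind: "cvec.independent (b ` {..<m})" by (auto simp: ordered_basis_def)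
    have "x r = 0" if z: "row_comb m b x = 0" and r: "r < m" for x r
    proof (rule ccontr)
      assume "x r \<noteq> 0"
      let ?u = "\<lambda>v. x (inv_into {..<m} b v)"
      have "(\<Sum>v\<in>b ` {..<m}. fscale (?u v) v) = row_comb m b x"
        using inv_into_f_f[OF inj] by (simp add: row_comb_sum sum.reindex[OF inj])
      then have "(\<Sum>v\<in>b ` {..<m}. fscale (?u v) v) = 0" using z by simp
      moreover have "?u (b r) \<noteq> 0" using inv_into_f_f[OF inj] r \<open>x r \<noteq> 0\<close> by simp
      ultimately have "cvec.dependent (b ` {..<m})"
        using r by (subst cvec.dependent_finite) auto
      then show False using ind by blast
    qed
    then show ?R using span[OF inj] L by (auto simp: ordered_basis_def)
  next
    assume R: ?R
    have inj: "inj_on b {..<m}"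
    proof (rule inj_onI, rule ccontr)
      fix r s assume rs: "r \<in> {..<m}" "s \<in> {..<m}" "b r = b s" "r \<noteq> s"
      let ?x = "\<lambda>k. if k = r then 1 else if k = s then -1 else (0::complex)"
      have "row_comb m b ?x i = 0" for i
      proof -
        have "row_comb m b ?x i = (\<Sum>k<m. (if k = r then b r i else 0) + (if k = s then - b s i else 0))"
          unfolding row_comb_def by (rule sum.cong) (use rs in auto)
        also have "\<dots> = b r i - b s i" using rs by (subst sum.distrib) (simp)
        finally show ?thesis using rs by simp
      qed
      then have "row_comb m b ?x = 0" by (simp add: fun_eq_iff)
      then have "?x r = 0" using R rs(1) by blast
      then show False by simp
    qed
    have "\<not> cvec.dependent (b ` {..<m})"
    proof
      assume "cvec.dependent (b ` {..<m})"
      then obtain u v where u: "v \<in> b ` {..<m}" "u v \<noteq> 0" "(\<Sum>v\<in>b ` {..<m}. fscale (u v) v) = 0"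
        by (subst (asm) cvec.dependent_finite) auto
      have "row_comb m b (\<lambda>r. u (b r)) = 0" using u(3) by (simp add: row_comb_sum sum.reindex[OF inj])
      then have "\<forall>r<m. u (b r) = 0" using R by blast
      then show False using u by auto
    qed
    then show ?L using inj span[OF inj] R by (simp add: ordered_basis_def)
  qed
qed

text \<open>If \<open>card I = dim \<Sigma>\<close>, this says that \<open>p\<^sub>I(\<Sigma>)\<close> is nonzero.\<close>

definition detects :: "(nat \<Rightarrow> complex) set \<Rightarrow> nat set \<Rightarrow> bool" where
  "detects \<Sigma> I \<longleftrightarrow> (\<forall>v\<in>\<Sigma>. (\<forall>i\<in>I. v i = 0) \<longrightarrow> v = 0)"

text \<open>A linear relation between the rows restricted to the columns in \<open>I\<close> is the
  same as a nonzero vector of \<open>\<Sigma>\<close> that vanishes on \<open>I\<close>.\<close>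

lemma minor_eq_0_iff_not_detects:
  assumes b: "ordered_basis m b \<Sigma>" and I: "finite I" "card I = m"
  shows "minor m b (nth_elem I) = 0 \<longleftrightarrow> \<not> detects \<Sigma> I"
proof -
  have ind: "\<And>x. row_comb m b x = 0 \<Longrightarrow> \<forall>r<m. x r = 0" and S: "\<Sigma> = range (row_comb m b)"
    using b unfolding ordered_basis_iff by blast+
  have van: "(\<forall>i\<in>I. v i = 0) \<longleftrightarrow> (\<forall>c<m. v (nth_elem I c) = 0)" for v :: "nat \<Rightarrow> complex"
    using nth_elem_surj[OF I] nth_elem_in[OF I(1)] I(2) by metis
  have nz: "row_comb m b x \<noteq> 0 \<longleftrightarrow> (\<exists>r<m. x r \<noteq> 0)" for x
  proof
    assume "row_comb m b x \<noteq> 0"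
    then obtain i where "(\<Sum>r<m. x r * b r i) \<noteq> 0" by (auto simp: row_comb_def fun_eq_iff)
    then show "\<exists>r<m. x r \<noteq> 0" by (metis (no_types, lifting) lessThan_iff mult_zero_left sum.neutral)
  next
    assume "\<exists>r<m. x r \<noteq> 0"
    then show "row_comb m b x \<noteq> 0" using ind by blast
  qed
  show ?thesis unfolding minor_eq_0_iff detects_def S
    by (auto simp: van nz) (auto simp: row_comb_def)
qed

lemma coord_span_detects:
  assumes "finite J" "T \<subseteq> coord_span J"
  shows "detects T J"
  unfolding detects_def
proof (intro ballI impI ext)
  fix v i assume "v \<in> T" "\<forall>i\<in>J. v i = 0"
  then show "v i = 0 i" using assms mem_coord_span_iff[OF assms(1), of v] by (cases "i \<in> J") auto
qed

text \<open>Take a detecting subset of least cardinality. Dropping \<open>i\<close> from it destroys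
  detection, so some nonzero vector of \<open>T\<close> vanishes on the other elements of
  \<open>I\<close>; scaled, these vectors form a basis dual to the coordinates in
  \<open>I\<close>.\<close>

lemma detecting_basis:
  assumes T: "cvec.subspace T" and J: "finite J" "detects T J"
  obtains I w where "I \<subseteq> J" "detects T I" "card I = cvec.dim T"
    and "\<And>i. i \<in> I \<Longrightarrow> w i \<in> T" and "\<And>i j. i \<in> I \<Longrightarrow> j \<in> I \<Longrightarrow> w i j = (if i = j then 1 else 0)"
    and "\<And>v. v \<in> T \<Longrightarrow> v = (\<Sum>i\<in>I. fscale (v i) (w i))"
proof -
  obtain I where I: "I \<subseteq> J" "detects T I" and min: "\<And>I'. I' \<subseteq> J \<Longrightarrow> detects T I' \<Longrightarrow> card I \<le> card I'"
    using ex_has_least_nat[of "\<lambda>I. I \<subseteq> J \<and> detects T I" J card] J by auto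
  have fI: "finite I" using I J finite_subset by blast
  have "\<exists>w\<in>T. \<forall>j\<in>I. w j = (if i = j then 1 else 0)" if i: "i \<in> I" for i
  proof -
    have "\<not> detects T (I - {i})"
    proof
      assume "detects T (I - {i})"
      then have "card I \<le> card (I - {i})" using min I(1) by blast
      then show False using fI i by (metis card_Diff1_less not_le)
    qed
    then obtain v where v: "v \<in> T" "\<forall>j\<in>I - {i}. v j = 0" "v \<noteq> 0" unfolding detects_def by blast
    have vi: "v i \<noteq> 0" using v I(2) unfolding detects_def by (metis DiffI singletonD)
    have "fscale (inverse (v i)) v \<in> T" using T v(1) by (simp add: cvec.subspace_scale)
    moreover have "\<forall>j\<in>I. fscale (inverse (v i)) v j = (if i = j then 1 else 0)"
      using v(2) vi by (auto simp: fscale_def)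
    ultimately show ?thesis by blast
  qed
  then obtain w where w: "\<And>i. i \<in> I \<Longrightarrow> w i \<in> T" "\<And>i j. i \<in> I \<Longrightarrow> j \<in> I \<Longrightarrow> w i j = (if i = j then 1 else 0)"
    by metis
  have ev: "(\<Sum>i\<in>I. fscale (u i) (w i)) j = u j" if "j \<in> I" for u j
  proof -
    have "(\<Sum>i\<in>I. fscale (u i) (w i)) j = (\<Sum>i\<in>I. if i = j then u i else 0)"
      unfolding sum_fun_apply by (rule sum.cong) (use w that in \<open>auto simp: fscale_def\<close>)
    then show ?thesis using that fI by simp
  qed
  have rep: "v = (\<Sum>i\<in>I. fscale (v i) (w i))" if v: "v \<in> T" for v
  proof -
    let ?d = "v - (\<Sum>i\<in>I. fscale (v i) (w i))"
    have "?d \<in> T" using v w(1) T by (intro cvec.subspace_diff cvec.subspace_sum cvec.subspace_scale) auto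
    moreover have "\<forall>j\<in>I. ?d j = 0" using ev by simp
    ultimately have "?d = 0" using I(2) unfolding detects_def by blast
    then show ?thesis by simp
  qed
  have inj: "inj_on w I"
  proof (rule inj_onI)
    fix i j assume ij: "i \<in> I" "j \<in> I" "w i = w j"
    have "w i i = 1" by (simp add: w(2) ij(1))
    then have "w j i \<noteq> 0" using ij(3) by (metis zero_neq_one)
    then show "i = j" using w(2)[OF ij(2,1)] by (auto split: if_splits)
  qed
  have "cvec.span (w ` I) = T"
  proof
    show "cvec.span (w ` I) \<subseteq> T" by (rule cvec.span_minimal[OF _ T]) (use w in auto)
    show "T \<subseteq> cvec.span (w ` I)"
    proof
      fix v assume "v \<in> T"
      then have "v = (\<Sum>i\<in>I. fscale (v i) (w i))" by (rule rep)
      also have "\<dots> \<in> cvec.span (w ` I)" by (intro cvec.span_sum cvec.span_scale cvec.span_base) auto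
      finally show "v \<in> cvec.span (w ` I)" .
    qed
  qed
  then have sp: "cvec.span (w ` I) = cvec.span T"
    by (rule trans) (simp only: cvec.span_eq_iff[THEN iffD2, OF T])
  have "\<not> cvec.dependent (w ` I)"
  proof
    assume "cvec.dependent (w ` I)"
    then obtain u v where u: "v \<in> w ` I" "u v \<noteq> 0" "(\<Sum>v\<in>w ` I. fscale (u v) v) = 0"
      using fI by (subst (asm) cvec.dependent_finite) auto
    then obtain j where j: "j \<in> I" "v = w j" by blast
    have "(\<Sum>i\<in>I. fscale (u (w i)) (w i)) j = 0" using u(3) by (simp add: sum.reindex[OF inj])
    then show False using ev[OF j(1), of "\<lambda>i. u (w i)"] u j by simp
  qed
  then have "cvec.dim T = card (w ` I)" by (rule cvec.dim_eq_card[OF sp])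
  then have "card I = cvec.dim T" using card_image[OF inj] by simp
  from that[OF I this w rep] show thesis by blast
qed

lemma detecting_subset:
  assumes "cvec.subspace T" "finite J" "detects T J"
  obtains I where "I \<subseteq> J" "detects T I" "card I = cvec.dim T"
  by (rule detecting_basis[OF assms]) (rule that)

lemma grassmannian_ordered_basis:
  assumes "\<Sigma> \<in> grassmannian m n"
  obtains b where "ordered_basis m b \<Sigma>"
proof -
  have S: "cvec.subspace \<Sigma>" "\<Sigma> \<subseteq> coord_span {1..n}" "cvec.dim \<Sigma> = m"
    using assms by (auto simp: grassmannian_def)
  have "detects \<Sigma> {1..n}"
    by (rule coord_span_detects[OF _ S(2)]) simp
  then obtain I w where I: "I \<subseteq> {1..n}" "detects \<Sigma> I" "card I = cvec.dim \<Sigma>"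
    and w: "\<And>i. i \<in> I \<Longrightarrow> w i \<in> \<Sigma>" "\<And>i j. i \<in> I \<Longrightarrow> j \<in> I \<Longrightarrow> w i j = (if i = j then 1 else 0)"
    and rep: "\<And>v. v \<in> \<Sigma> \<Longrightarrow> v = (\<Sum>i\<in>I. fscale (v i) (w i))"
    by (rule detecting_basis[OF S(1) finite_atLeastAtMost]) (rule that)
  note I = I(1) I(3)[unfolded S(3)]
  have fI: "finite I" using I finite_subset by blast
  have bij: "bij_betw (nth_elem I) {..<m} I" using nth_elem_bij[OF fI I(2)] by (simp add: lessThan_atLeast0)
  let ?b = "\<lambda>r. w (nth_elem I r)"
  have nI: "nth_elem I r \<in> I" if "r < m" for r using nth_elem_in[OF fI] that I by simp
  have "x r = 0" if "row_comb m ?b x = 0" "r < m" for x r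
  proof -
    have "row_comb m ?b x (nth_elem I r) = (\<Sum>k<m. if k = r then x k else 0)"
      unfolding row_comb_def
      by (rule sum.cong) (use w(2) nI that bij in \<open>auto simp: bij_betw_def inj_on_def\<close>)
    then show ?thesis using that by simp
  qed
  moreover have "\<Sigma> = range (row_comb m ?b)"
  proof (intro equalityI subsetI)
    fix v assume "v \<in> \<Sigma>"
    then have "v = (\<Sum>i\<in>I. fscale (v i) (w i))" by (rule rep)
    also have "\<dots> = row_comb m ?b (\<lambda>r. v (nth_elem I r))"
      unfolding row_comb_sum by (rule sum.reindex_bij_betw[OF bij, symmetric])
    finally show "v \<in> range (row_comb m ?b)" by blast
  next
    fix v assume "v \<in> range (row_comb m ?b)"
    then show "v \<in> \<Sigma>" unfolding row_comb_sum
      using S(1) w(1) nI by (auto intro!: cvec.subspace_sum cvec.subspace_scale)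
  qed
  ultimately show thesis using that unfolding ordered_basis_iff by blast
qed

text \<open>The dimension is the minimum of \<open>card (I \<inter> L)\<close> over the bases
  \<open>I\<close> of the matroid of \<open>\<Sigma>\<close>. It is a lower bound because
  \<open>I \<inter> L\<close> detects the vectors of \<open>\<Sigma>\<close> supported in
  \<open>L\<close>.\<close>

lemma dim_Int_coord_span_ge_iff:
  assumes S: "\<Sigma> \<in> grassmannian m n" and L: "L \<subseteq> {1..n}"
  shows "p \<le> cvec.dim (\<Sigma> \<inter> coord_span L) \<longleftrightarrow>
    (\<forall>I. I \<subseteq> {1..n} \<and> card I = m \<and> detects \<Sigma> I \<longrightarrow> p \<le> card (I \<inter> L))"
proof -
  have sub: "cvec.subspace \<Sigma>" and Sn: "\<Sigma> \<subseteq> coord_span {1..n}" and dim: "cvec.dim \<Sigma> = m"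
    using S by (auto simp: grassmannian_def)
  have fL: "finite L" using L finite_subset by blast
  let ?S = "\<Sigma> \<inter> coord_span L"
  have sub1: "cvec.subspace ?S"
    using sub by (intro cvec.subspace_inter) (auto simp: coord_span_def)
  have le: "cvec.dim ?S \<le> card (I \<inter> L)" if I: "I \<subseteq> {1..n}" "detects \<Sigma> I" for I
  proof -
    have "detects ?S (I \<inter> L)"
      using I(2) mem_coord_span_iff[OF fL] unfolding detects_def by blast
    then obtain I' where "I' \<subseteq> I \<inter> L" "card I' = cvec.dim ?S"
      using detecting_subset[OF sub1, of "I \<inter> L"] fL by blast
    then show ?thesis using card_mono[of "I \<inter> L" I'] fL by simp
  qed
  obtain I where I: "I \<subseteq> {1..n}" "card I = m" "detects \<Sigma> I" "card (I \<inter> L) \<le> cvec.dim ?S"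
  proof -
    have "detects ?S L" by (rule coord_span_detects[OF fL]) simp
    then obtain I1 where I1: "I1 \<subseteq> L" "detects ?S I1" "card I1 = cvec.dim ?S"
      using detecting_subset[OF sub1 fL] by blast
    \<comment> \<open>The minimum is attained: a smallest detecting set inside \<open>L\<close>,
      enlarged by all columns outside \<open>L\<close>, detects \<open>\<Sigma>\<close>, and any
      basis within it meets \<open>L\<close> in few elements.\<close>
    let ?J = "I1 \<union> ({1..n} - L)"
    have "detects \<Sigma> ?J"
      unfolding detects_def
    proof (intro ballI impI)
      fix v assume v: "v \<in> \<Sigma>" "\<forall>i\<in>?J. v i = 0"
      have "v i = 0" if "i \<notin> L" for i
        using v that Sn mem_coord_span_iff[of "{1..n}" v] by (cases "i \<in> {1..n}") auto
      then have "v \<in> ?S" using v mem_coord_span_iff[OF fL] by blast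
      then show "v = 0" using I1(2) v unfolding detects_def by blast
    qed
    moreover have "?J \<subseteq> {1..n}" "finite ?J" using I1 L fL finite_subset by auto
    ultimately obtain I where I: "I \<subseteq> ?J" "detects \<Sigma> I" "card I = m"
      using detecting_subset[OF sub, of ?J] unfolding dim by blast
    have "card (I \<inter> L) \<le> card I1"
      by (rule card_mono) (use I I1 fL finite_subset in auto)
    then show thesis using that I I1(3) \<open>?J \<subseteq> {1..n}\<close> by auto
  qed
  show ?thesis
  proof (intro iffI allI impI)
    fix I' assume "p \<le> cvec.dim ?S" "I' \<subseteq> {1..n} \<and> card I' = m \<and> detects \<Sigma> I'"
    then show "p \<le> card (I' \<inter> L)" using le[of I'] by linarith
  next
    assume "\<forall>I. I \<subseteq> {1..n} \<and> card I = m \<and> detects \<Sigma> I \<longrightarrow> p \<le> card (I \<inter> L)"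
    then have "p \<le> card (I \<inter> L)" using I by blast
    then show "p \<le> cvec.dim ?S" using I(4) by linarith
  qed
qed

lemma pluecker_coords_minor:
  "pluecker_coords m n b = (\<lambda>I. if I \<subseteq> {1..n} \<and> card I = m then minor m b (nth_elem I) else 0)"
  by (simp add: pluecker_coords_def pluecker_index_def minor_def nth_elem_def fun_eq_iff)

lemma pluecker_eq_span:
  assumes b: "ordered_basis m b \<Sigma>"
  shows "pluecker m n \<Sigma> = cvec.span {pluecker_coords m n b}"
proof -
  have "pluecker_coords m n b' \<in> cvec.span {pluecker_coords m n b}" if b': "ordered_basis m b' \<Sigma>" for b'
  proof -
    have "b' r \<in> range (row_comb m b)" if r: "r < m" for r
    proof -
      have "b' r \<in> cvec.span (b' ` {..<m})" using r by (intro cvec.span_base) auto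
      then have "b' r \<in> \<Sigma>" using b' by (simp add: ordered_basis_def)
      then show ?thesis using b by (simp add: ordered_basis_iff)
    qed
    then have "\<forall>r. \<exists>x. r < m \<longrightarrow> b' r = row_comb m b x" by blast
    then obtain g where g: "\<And>r. r < m \<Longrightarrow> b' r = row_comb m b (g r)"
      using choice[of "\<lambda>r x. r < m \<longrightarrow> b' r = row_comb m b x"] by blast
    have "minor m b' f = det (mat m m (\<lambda>(r, k). g r k)) * minor m b f" for f
    proof -
      have "minor m b' f = minor m (\<lambda>r s. \<Sum>k<m. g r k * b k s) f"
        by (rule minor_cong) (simp add: g row_comb_def)
      then show ?thesis by (simp add: minor_mult_rows)
    qed
    then have "pluecker_coords m n b' = fscale (det (mat m m (\<lambda>(r, k). g r k))) (pluecker_coords m n b)"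
      by (simp add: pluecker_coords_minor fscale_def fun_eq_iff)
    then show ?thesis unfolding mem_span_singleton by blast
  qed
  then show ?thesis unfolding pluecker_def using b
    by (intro cvec.span_eq[THEN iffD2] conjI subsetI) (auto intro: cvec.span_base)
qed

text \<open>With the bounds used below, these are the \<open>I\<close> for which the span of the
  basis vectors \<open>e_j\<close>, \<open>j\<close> in \<open>I\<close>, lies in the Richardson
  variety.\<close>

definition richardson_index :: "nat \<Rightarrow> nat \<Rightarrow> (nat \<Rightarrow> nat) \<Rightarrow> (nat \<Rightarrow> nat) \<Rightarrow> nat set set" where
  "richardson_index m n a b = {I. I \<subseteq> {1..n} \<and> card I = m \<and>
     (\<forall>i\<in>{1..m}. m - i + 1 \<le> card (I \<inter> {1..b i}) \<and> i \<le> card (I \<inter> {a i..n}))}"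

text \<open>Each dimension condition bounds a minimum over all nonzero Pluecker coordinates, so it
  may be imposed on every such coordinate separately.\<close>

lemma richardson_iff_index:
  fixes lam mu :: "nat \<Rightarrow> nat"
  assumes S: "\<Sigma> \<in> grassmannian m n" and mn: "m \<le> n"
  defines "nu \<equiv> dual_partition m (n - m) mu"
  shows "\<Sigma> \<in> richardson m n lam mu \<longleftrightarrow>
    (\<forall>I. I \<subseteq> {1..n} \<and> card I = m \<and> detects \<Sigma> I \<longrightarrow>
       I \<in> richardson_index m n (\<lambda>i. lam i + m - i + 1) (\<lambda>i. nu i + m - i + 1))"
proof -
  have 1: "m - i + 1 \<le> cvec.dim (\<Sigma> \<inter> coord_span {1..nu i + m - i + 1}) \<longleftrightarrow>
      (\<forall>I. I \<subseteq> {1..n} \<and> card I = m \<and> detects \<Sigma> I \<longrightarrow> m - i + 1 \<le> card (I \<inter> {1..nu i + m - i + 1}))"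
    if "i \<in> {1..m}" for i
    by (rule dim_Int_coord_span_ge_iff[OF S]) (use that mn in \<open>auto simp: nu_def dual_partition_def\<close>)
  have 2: "i \<le> cvec.dim (\<Sigma> \<inter> coord_span {lam i + m - i + 1..n}) \<longleftrightarrow>
      (\<forall>I. I \<subseteq> {1..n} \<and> card I = m \<and> detects \<Sigma> I \<longrightarrow> i \<le> card (I \<inter> {lam i + m - i + 1..n}))"
    if "i \<in> {1..m}" for i
    by (rule dim_Int_coord_span_ge_iff[OF S]) auto
  have "\<Sigma> \<in> richardson m n lam mu \<longleftrightarrow> (\<forall>i\<in>{1..m}.
      m - i + 1 \<le> cvec.dim (\<Sigma> \<inter> coord_span {1..nu i + m - i + 1}) \<and>
      i \<le> cvec.dim (\<Sigma> \<inter> coord_span {lam i + m - i + 1..n}))"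
    using S by (auto simp: richardson_def schubert_def opp_schubert_def nu_def)
  then show ?thesis using 1 2 unfolding richardson_index_def by auto
qed

text \<open>The Schubert conditions merely restrict the support of the Pluecker vector. Conversely a
  vector of the cone comes with a matrix, and the row space of that matrix is the preimage.\<close>

theorem pluecker_richardson:
  fixes lam mu :: "nat \<Rightarrow> nat"
  assumes mn: "m \<le> n"
  defines "nu \<equiv> dual_partition m (n - m) mu"
  shows "pluecker m n ` richardson m n lam mu = proj_lines (pluecker_cone m {1..n}
     (richardson_index m n (\<lambda>i. lam i + m - i + 1) (\<lambda>i. nu i + m - i + 1)))"
    (is "_ = proj_lines (pluecker_cone m {1..n} ?R)")
proof (intro equalityI subsetI)
  fix P assume "P \<in> pluecker m n ` richardson m n lam mu"
  then obtain \<Sigma> where \<Sigma>: "\<Sigma> \<in> richardson m n lam mu" "P = pluecker m n \<Sigma>" by blast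
  then have S: "\<Sigma> \<in> grassmannian m n" by (simp add: richardson_def schubert_def)
  obtain b where b: "ordered_basis m b \<Sigma>" using grassmannian_ordered_basis[OF S] .
  let ?v = "pluecker_coords m n b"
  have nz: "?v I \<noteq> 0 \<longleftrightarrow> I \<subseteq> {1..n} \<and> card I = m \<and> detects \<Sigma> I" for I
    using minor_eq_0_iff_not_detects[OF b, of I] finite_subset[of I "{1..n}"]
    by (auto simp: pluecker_coords_minor)
  have R: "\<And>I. I \<subseteq> {1..n} \<Longrightarrow> card I = m \<Longrightarrow> detects \<Sigma> I \<Longrightarrow> I \<in> ?R"
    using richardson_iff_index[OF S mn, of lam mu] \<Sigma>(1) by (auto simp: nu_def)
  have sub: "cvec.subspace \<Sigma>" "\<Sigma> \<subseteq> coord_span {1..n}" "cvec.dim \<Sigma> = m"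
    using S by (auto simp: grassmannian_def)
  have "detects \<Sigma> {1..n}"
    by (rule coord_span_detects[OF _ sub(2)]) simp
  then obtain I0 where "I0 \<subseteq> {1..n}" "card I0 = m" "detects \<Sigma> I0"
    using detecting_subset[OF sub(1), of "{1..n}"] unfolding sub(3) by blast
  then have "?v I0 \<noteq> 0" using nz by blast
  then have "?v \<in> pluecker_cone m {1..n} ?R"
  proof (rule pluecker_coneI[where c = 1 and M = b])
    show "?v I = 0" if "I \<notin> ?R" for I using that nz[of I] R[of I] by blast
  qed (simp add: pluecker_coords_minor)
  then show "P \<in> proj_lines (pluecker_cone m {1..n} ?R)"
    unfolding proj_lines_def using \<Sigma>(2) pluecker_eq_span[OF b, of n] by blast
next
  fix P assume "P \<in> proj_lines (pluecker_cone m {1..n} ?R)"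
  then obtain v where v: "v \<in> pluecker_cone m {1..n} ?R" "P = cvec.span {v}" unfolding proj_lines_def by blast
  from v(1) obtain M c I0 where I0: "v I0 \<noteq> 0" and vI: "\<And>I. I \<notin> ?R \<Longrightarrow> v I = 0"
    and Mc: "\<And>I. v I = (if I \<subseteq> {1..n} \<and> card I = m then c * minor m M (nth_elem I) else 0)"
    by (rule pluecker_coneE) (rule that)
  \<comment> \<open>The minors see only the columns in \<open>{1..n}\<close>; other entries of
    \<open>M\<close> are arbitrary and must be cleared for the rows to lie in the ambient
    space.\<close>
  define b where "b r i = (if i \<in> {1..n} then M r i else 0)" for r i
  have bM: "minor m b (nth_elem I) = minor m M (nth_elem I)" if "I \<subseteq> {1..n}" "card I = m" for I
    by (rule minor_cong) (use that nth_elem_in[of I] finite_subset[of I "{1..n}"] in \<open>auto simp: b_def subset_iff\<close>)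
  have vb: "v = fscale c (pluecker_coords m n b)"
    using Mc bM by (auto simp: fun_eq_iff pluecker_coords_minor fscale_def)
  have c: "c \<noteq> 0" and m0: "minor m b (nth_elem I0) \<noteq> 0" "I0 \<subseteq> {1..n}" "card I0 = m"
    using I0 Mc[of I0] bM[of I0] by (auto split: if_splits)
  define \<Sigma> where "\<Sigma> = range (row_comb m b)"
  have "\<forall>r<m. x r = 0" if "row_comb m b x = 0" for x
  proof -
    have "(\<Sum>r<m. x r * b r (nth_elem I0 c)) = 0" for c
      using fun_cong[OF that, of "nth_elem I0 c"] by (simp add: row_comb_def)
    then show ?thesis using m0(1) unfolding minor_eq_0_iff by blast
  qed
  then have ob: "ordered_basis m b \<Sigma>" unfolding ordered_basis_iff \<Sigma>_def by blast
  have sp: "\<Sigma> = cvec.span (b ` {..<m})" using ob by (simp add: ordered_basis_def)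
  have "cvec.dim \<Sigma> = card (b ` {..<m})"
    unfolding sp by (rule cvec.dim_span_eq_card_independent) (use ob in \<open>simp add: ordered_basis_def\<close>)
  moreover have "card (b ` {..<m}) = m" using ob by (simp add: ordered_basis_def card_image)
  moreover have "\<Sigma> \<subseteq> coord_span {1..n}"
    by (auto simp: \<Sigma>_def mem_coord_span_iff row_comb_def b_def)
  ultimately have S: "\<Sigma> \<in> grassmannian m n" by (simp add: grassmannian_def sp)
  have "I \<in> ?R" if "I \<subseteq> {1..n}" "card I = m" "detects \<Sigma> I" for I
  proof -
    have "minor m b (nth_elem I) \<noteq> 0"
      using minor_eq_0_iff_not_detects[OF ob _ that(2)] that finite_subset[OF that(1)] by auto
    then have "v I \<noteq> 0" using that c by (simp add: vb fscale_def pluecker_coords_minor)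
    then show ?thesis using vI by blast
  qed
  then have "\<Sigma> \<in> richardson m n lam mu"
    using richardson_iff_index[OF S mn, of lam mu] by (simp add: nu_def)
  moreover have "P = pluecker m n \<Sigma>"
    using v(2) pluecker_eq_span[OF ob, of n] span_singleton_fscale[OF c] by (simp add: vb)
  ultimately show "P \<in> pluecker m n ` richardson m n lam mu" by blast
qed

section \<open>Rigidity of connected box posets\<close>

text \<open>Integer coordinates, because the rotation by 180 degrees negates them.\<close>

type_synonym box = "int \<times> int"

definition cov :: "box \<Rightarrow> box \<Rightarrow> bool" where
  "cov x y \<longleftrightarrow> y = (fst x, snd x + 1) \<or> y = (fst x + 1, snd x)"

definition cov_connected :: "box set \<Rightarrow> bool" where
  "cov_connected C \<longleftrightarrow> (\<forall>x\<in>C. \<forall>y\<in>C. (x, y) \<in> {(u, v). u \<in> C \<and> v \<in> C \<and> (cov u v \<or> cov v u)}\<^sup>*)"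

text \<open>This is what rigidity needs of a skew shape: a square that contains its upper left and
  lower right box is complete.\<close>

definition square_closed :: "box set \<Rightarrow> bool" where
  "square_closed C \<longleftrightarrow> (\<forall>i j. (i, j) \<in> C \<and> (i + 1, j + 1) \<in> C \<longrightarrow> (i + 1, j) \<in> C \<and> (i, j + 1) \<in> C)"

definition horizontal :: "box \<Rightarrow> box \<Rightarrow> bool" where
  "horizontal x y \<longleftrightarrow> fst x = fst y"

text \<open>A turn at \<open>x\<close> goes around a square whose fourth box is a second element
  between \<open>u\<close> and \<open>w\<close>; along a straight chain the middle box is unique.
  Thus turning is a property of the order.\<close>

lemma bent_iff:
  assumes "square_closed C" "u \<in> C" "w \<in> C" "cov u x" "cov x w"
  shows "horizontal u x \<noteq> horizontal x w \<longleftrightarrow> (\<exists>y\<in>C. y \<noteq> x \<and> cov u y \<and> cov y w)"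
proof -
  obtain i j where u: "u = (i, j)" by (cases u)
  show ?thesis
  proof
    assume "horizontal u x \<noteq> horizontal x w"
    then have w: "w = (i + 1, j + 1)" and x: "x = (i + 1, j) \<or> x = (i, j + 1)"
      using assms(4,5) u by (auto simp: cov_def horizontal_def)
    have "(i + 1, j) \<in> C" "(i, j + 1) \<in> C" using assms(1-3) unfolding u w square_closed_def by blast+
    from x show "\<exists>y\<in>C. y \<noteq> x \<and> cov u y \<and> cov y w"
    proof
      assume "x = (i + 1, j)"
      then show ?thesis using \<open>(i, j + 1) \<in> C\<close> by (intro bexI[of _ "(i, j + 1)"]) (auto simp: u w cov_def)
    next
      assume "x = (i, j + 1)"
      then show ?thesis using \<open>(i + 1, j) \<in> C\<close> by (intro bexI[of _ "(i + 1, j)"]) (auto simp: u w cov_def)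
    qed
  next
    assume "\<exists>y\<in>C. y \<noteq> x \<and> cov u y \<and> cov y w"
    then obtain y where y: "y \<noteq> x" "cov u y" "cov y w" by blast
    obtain a b where "x = (a, b)" by (cases x)
    moreover obtain c d where "y = (c, d)" by (cases y)
    moreover obtain e f where "w = (e, f)" by (cases w)
    ultimately show "horizontal u x \<noteq> horizontal x w"
      using y assms(4,5) u unfolding cov_def horizontal_def by simp linarith
  qed
qed

lemma bent_preserved:
  assumes sq: "square_closed C" "square_closed C'" and bij: "bij_betw \<phi> C C'"
    and cov: "\<And>x y. x \<in> C \<Longrightarrow> y \<in> C \<Longrightarrow> cov x y \<longleftrightarrow> cov (\<phi> x) (\<phi> y)"
    and C: "u \<in> C" "x \<in> C" "w \<in> C" "cov u x" "cov x w"
  shows "horizontal u x \<noteq> horizontal x w \<longleftrightarrow> horizontal (\<phi> u) (\<phi> x) \<noteq> horizontal (\<phi> x) (\<phi> w)"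
proof -
  have im: "\<phi> ` C = C'" and inj: "inj_on \<phi> C" using bij by (auto simp: bij_betw_def)
  have "(\<exists>y\<in>C. y \<noteq> x \<and> cov u y \<and> cov y w) \<longleftrightarrow> (\<exists>y\<in>C. \<phi> y \<noteq> \<phi> x \<and> cov (\<phi> u) (\<phi> y) \<and> cov (\<phi> y) (\<phi> w))"
  proof (rule bex_cong[OF refl])
    fix y assume "y \<in> C"
    then show "(y \<noteq> x \<and> cov u y \<and> cov y w) = (\<phi> y \<noteq> \<phi> x \<and> cov (\<phi> u) (\<phi> y) \<and> cov (\<phi> y) (\<phi> w))"
      using cov C inj_on_eq_iff[OF inj] by auto
  qed
  also have "\<dots> \<longleftrightarrow> (\<exists>y\<in>C'. y \<noteq> \<phi> x \<and> cov (\<phi> u) y \<and> cov y (\<phi> w))"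
    unfolding im[symmetric] by blast
  finally show ?thesis
    using bent_iff[OF sq(1) C(1,3,4,5)] bent_iff[OF sq(2), of "\<phi> u" "\<phi> w" "\<phi> x"] im C cov by blast
qed

definition shift_flip :: "bool \<Rightarrow> int \<Rightarrow> int \<Rightarrow> box \<Rightarrow> box" where
  "shift_flip sw p q x = (if sw then (snd x + p, fst x + q) else (fst x + p, snd x + q))"

text \<open>
  The type of an edge records whether its direction is switched by \<open>\<phi>\<close>.  Adjacent edges have the
  same type, hence by connectedness all edges do.
\<close>

theorem cov_isomorphism_rigid:
  assumes sq: "square_closed C" "square_closed C'" and conn: "cov_connected C"
    and bij: "bij_betw \<phi> C C'"
    and cov: "\<And>x y. x \<in> C \<Longrightarrow> y \<in> C \<Longrightarrow> cov x y \<longleftrightarrow> cov (\<phi> x) (\<phi> y)"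
  shows "\<exists>sw p q. \<forall>x\<in>C. \<phi> x = shift_flip sw p q x"
proof (cases "C = {}")
  case False
  then obtain x0 where x0: "x0 \<in> C" by blast
  have inj: "inj_on \<phi> C" using bij by (simp add: bij_betw_def)
  define ty where "ty u v \<longleftrightarrow> horizontal u v \<noteq> horizontal (\<phi> u) (\<phi> v)" for u v
  have ty_sym: "ty u v = ty v u" for u v by (auto simp: ty_def horizontal_def)
  have cov_eq: "v = w" if "cov x v" "cov x w" "horizontal x v = horizontal x w" for x v w
    using that by (auto simp: cov_def horizontal_def)
  have cov_eq': "v = w" if "cov v x" "cov w x" "horizontal v x = horizontal w x" for x v w
  proof -
    obtain a b where "v = (a, b)" by (cases v)
    moreover obtain c d where "w = (c, d)" by (cases w)
    moreover obtain e f where "x = (e, f)" by (cases x)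
    ultimately show ?thesis using that unfolding cov_def horizontal_def by auto
  qed
  \<comment> \<open>Two different edges leaving a box have different directions, and so have their
    images since \<open>\<phi>\<close> is injective. Hence either both edges are switched or neither
    is.\<close>
  have out: "ty x v = ty x w" if "x \<in> C" "v \<in> C" "w \<in> C" "cov x v" "cov x w" for x v w
  proof (cases "v = w")
    case False
    then have "horizontal x v \<noteq> horizontal x w" using cov_eq that by blast
    moreover have "\<phi> v \<noteq> \<phi> w" using False inj that by (meson inj_onD)
    then have "horizontal (\<phi> x) (\<phi> v) \<noteq> horizontal (\<phi> x) (\<phi> w)" using cov_eq that cov by blast
    ultimately show ?thesis by (auto simp: ty_def)
  qed simp
  have inn: "ty v x = ty w x" if "x \<in> C" "v \<in> C" "w \<in> C" "cov v x" "cov w x" for x v w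
  proof (cases "v = w")
    case False
    then have "horizontal v x \<noteq> horizontal w x" using cov_eq' that by blast
    moreover have "\<phi> v \<noteq> \<phi> w" using False inj that by (meson inj_onD)
    then have "horizontal (\<phi> v) (\<phi> x) \<noteq> horizontal (\<phi> w) (\<phi> x)" using cov_eq' that cov by blast
    ultimately show ?thesis by (auto simp: ty_def)
  qed simp
  have thru: "ty u x = ty x w" if "u \<in> C" "x \<in> C" "w \<in> C" "cov u x" "cov x w" for u x w
    using bent_preserved[OF sq bij cov that] by (auto simp: ty_def)
  define adj where "adj u v \<longleftrightarrow> u \<in> C \<and> v \<in> C \<and> (cov u v \<or> cov v u)" for u v
  have adj_ty: "ty x v = ty x w" if "adj x v" "adj x w" for x v w
    using that out inn thru ty_sym unfolding adj_def by metis
  \<comment> \<open>\<open>sw\<close> is the common type of the edges at \<open>x0\<close>; if the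
    component is a single box, any value will do.\<close>
  obtain sw where sw0: "\<And>v. adj x0 v \<Longrightarrow> ty x0 v = sw" using adj_ty by metis
  have step: "\<phi> v = shift_flip sw p q v" if "\<phi> u = shift_flip sw p q u" "adj u v" "ty u v = sw" for u v p q
  proof -
    have uv: "cov u v \<and> cov (\<phi> u) (\<phi> v) \<or> cov v u \<and> cov (\<phi> v) (\<phi> u)"
      using that(2) cov unfolding adj_def by blast
    obtain i j where u: "u = (i, j)" by (cases u)
    obtain i' j' where v: "v = (i', j')" by (cases v)
    obtain k l where w: "\<phi> v = (k, l)" by (cases "\<phi> v")
    obtain m n where w': "\<phi> u = (m, n)" by (cases "\<phi> u")
    show ?thesis
      using uv that(1,3) unfolding ty_def w w' unfolding u v
      by (cases sw) (auto simp: shift_flip_def cov_def horizontal_def)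
  qed
  define p where "p = fst (\<phi> x0) - (if sw then snd x0 else fst x0)"
  define q where "q = snd (\<phi> x0) - (if sw then fst x0 else snd x0)"
  have base: "\<phi> x0 = shift_flip sw p q x0" by (simp add: shift_flip_def p_def q_def)
  have "\<phi> x = shift_flip sw p q x \<and> (\<forall>v. adj x v \<longrightarrow> ty x v = sw)"
    if "(x0, x) \<in> {(u, v). u \<in> C \<and> v \<in> C \<and> (cov u v \<or> cov v u)}\<^sup>*" for x
    using that
  proof (induction rule: rtrancl_induct)
    case base
    then show ?case using \<open>\<phi> x0 = _\<close> sw0 by blast
  next
    case (step y z)
    have yz: "adj y z" "adj z y" using step.hyps(2) by (auto simp: adj_def)
    have t: "ty y z = sw" using step.IH yz by blast
    have "\<phi> z = shift_flip sw p q z" using \<open>\<And>u v p q. \<lbrakk>\<phi> u = shift_flip sw p q u; adj u v; ty u v = sw\<rbrakk> \<Longrightarrow> _\<close> step.IH yz t by blast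
    moreover have "ty z v = sw" if "adj z v" for v
      using adj_ty[OF that yz(2)] t ty_sym by simp
    ultimately show ?case by blast
  qed
  then show ?thesis using conn x0 unfolding cov_connected_def by blast
qed simp

section \<open>Skew shapes and lattice paths\<close>

text \<open>Such sets are the unions of connected components, described without paths.\<close>

definition adj_closed_in :: "box set \<Rightarrow> box set \<Rightarrow> bool" where
  "adj_closed_in \<Theta> C \<longleftrightarrow> C \<subseteq> \<Theta> \<and> (\<forall>x\<in>C. \<forall>y\<in>\<Theta>. cov x y \<or> cov y x \<longrightarrow> y \<in> C)"

text \<open>The shift by \<open>m\<close> makes the contents of row \<open>i\<close> run from
  \<open>a i\<close> to \<open>b i - 1\<close>, in the same numbering as the columns
  \<open>1\<close> to \<open>n\<close>.\<close>

definition box_content :: "int \<Rightarrow> box \<Rightarrow> int" where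
  "box_content m x = snd x - fst x + m"

text \<open>A lattice path that runs along a box of content \<open>c\<close> on either side does so
  with its steps number \<open>c\<close> and \<open>c + 1\<close>.\<close>

definition steps :: "int set \<Rightarrow> int set" where
  "steps Y = Y \<union> (\<lambda>c. c + 1) ` Y"

lemma mem_steps_iff: "s \<in> steps Y \<longleftrightarrow> s \<in> Y \<or> s - 1 \<in> Y"
  by (force simp: steps_def image_iff)

lemma finite_int_filter: "finite {i \<in> {k..m::int}. P i}"
  by (rule finite_subset[of _ "{k..m}"]) auto

text \<open>The upper and lower boundary path take their vertical step in row \<open>i\<close> at
  positions \<open>a i\<close> and \<open>b i\<close>; an empty row has
  \<open>a i = b i\<close>.\<close>

locale skew_shape =
  fixes m n :: int and a b :: "int \<Rightarrow> int"
  assumes m_nonneg: "0 \<le> m"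
    and a_dec: "1 \<le> i \<Longrightarrow> i < j \<Longrightarrow> j \<le> m \<Longrightarrow> a j < a i"
    and b_dec: "1 \<le> i \<Longrightarrow> i < j \<Longrightarrow> j \<le> m \<Longrightarrow> b j < b i"
    and a_pos: "1 \<le> i \<Longrightarrow> i \<le> m \<Longrightarrow> 1 \<le> a i"
    and a_le_b: "1 \<le> i \<Longrightarrow> i \<le> m \<Longrightarrow> a i \<le> b i"
    and b_le_n: "1 \<le> i \<Longrightarrow> i \<le> m \<Longrightarrow> b i \<le> n"
begin

definition boxes :: "box set" where
  "boxes = {x. 1 \<le> fst x \<and> fst x \<le> m \<and> a (fst x) \<le> box_content m x \<and> box_content m x < b (fst x)}"

lemma mem_boxes_iff:
  "(i, j) \<in> boxes \<longleftrightarrow> 1 \<le> i \<and> i \<le> m \<and> a i \<le> j - i + m \<and> j - i + m < b i"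
  by (simp add: boxes_def box_content_def)

lemma a_mono:
  assumes "1 \<le> i" "i \<le> j" "j \<le> m"
  shows "a j + (j - i) \<le> a i"
  using assms(2,3)
proof (induction j rule: int_ge_induct)
  case (step j)
  then show ?case using a_dec[of j "j + 1"] assms(1) by simp
qed auto

lemma b_mono:
  assumes "1 \<le> i" "i \<le> j" "j \<le> m"
  shows "b j + (j - i) \<le> b i"
  using assms(2,3)
proof (induction j rule: int_ge_induct)
  case (step j)
  then show ?case using b_dec[of j "j + 1"] assms(1) by simp
qed auto

lemma square_closed_boxes: "square_closed boxes"
  unfolding square_closed_def mem_boxes_iff
proof (intro allI impI, elim conjE)
  fix i j
  assume h: "1 \<le> i" "a i \<le> j - i + m" "j - i + m < b i" "i + 1 \<le> m"
    "a (i + 1) \<le> j + 1 - (i + 1) + m" "j + 1 - (i + 1) + m < b (i + 1)"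
  then show "(1 \<le> i + 1 \<and> i + 1 \<le> m \<and> a (i + 1) \<le> j - (i + 1) + m \<and> j - (i + 1) + m < b (i + 1)) \<and>
      1 \<le> i \<and> i \<le> m \<and> a i \<le> j + 1 - i + m \<and> j + 1 - i + m < b i"
    using a_mono[of i "i + 1"] b_mono[of i "i + 1"] by simp
qed

lemma adj_closed_cov:
  assumes "adj_closed_in boxes C" "x \<in> boxes" "y \<in> boxes" "cov x y"
  shows "x \<in> C \<longleftrightarrow> y \<in> C"
  using assms unfolding adj_closed_in_def by blast

section \<open>Components are determined by contents\<close>

lemma adj_closed_diagonal:
  assumes C: "adj_closed_in boxes C"
  shows "(i, j) \<in> boxes \<Longrightarrow> (i + int k, j + int k) \<in> boxes \<Longrightarrow> (i, j) \<in> C \<longleftrightarrow> (i + int k, j + int k) \<in> C"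
proof (induction k)
  case (Suc k)
  let ?i = "i + int k" and ?j = "j + int k"
  have h: "1 \<le> i" "?i + 1 \<le> m" "a i \<le> j - i + m" "j - i + m < b (?i + 1)"
    using Suc.prems by (auto simp: mem_boxes_iff algebra_simps)
  have 1: "(?i, ?j) \<in> boxes"
    unfolding mem_boxes_iff using h a_mono[of i ?i] b_mono[of ?i "?i + 1"] by simp
  have 3: "(?i + 1, ?j + 1) \<in> boxes" using Suc.prems(2) by (simp add: algebra_simps)
  have 2: "(?i + 1, ?j) \<in> boxes" using square_closed_boxes 1 3 unfolding square_closed_def by blast
  have "(?i, ?j) \<in> C \<longleftrightarrow> (?i + 1, ?j) \<in> C" by (rule adj_closed_cov[OF C 1 2]) (simp add: cov_def)
  moreover have "(?i + 1, ?j) \<in> C \<longleftrightarrow> (?i + 1, ?j + 1) \<in> C"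
    by (rule adj_closed_cov[OF C 2 3]) (simp add: cov_def)
  ultimately show ?case using Suc.IH[OF Suc.prems(1) 1] by (simp add: algebra_simps)
qed simp

text \<open>Consecutive boxes of a diagonal are joined through a corner of their square. So a
  diagonal never meets two components, and components can be told apart by contents.\<close>

lemma same_content_same_component:
  assumes C: "adj_closed_in boxes C" and x: "x \<in> boxes" and y: "y \<in> boxes"
    and c: "box_content m x = box_content m y"
  shows "x \<in> C \<longleftrightarrow> y \<in> C"
proof -
  have *: "(i, j) \<in> C \<longleftrightarrow> (i', j') \<in> C" if "i \<le> i'" "(i, j) \<in> boxes" "(i', j') \<in> boxes" "j - i = j' - i'" for i j i' j'
  proof -
    define k where "k = nat (i' - i)"
    have "i' = i + int k" "j' = j + int k" using that by (auto simp: k_def)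
    then show ?thesis using adj_closed_diagonal[OF C that(2), of k] that(3) by simp
  qed
  obtain i j where x': "x = (i, j)" by (cases x)
  obtain i' j' where y': "y = (i', j')" by (cases y)
  have e: "j - i = j' - i'" using c by (simp add: x' y' box_content_def)
  show ?thesis
  proof (cases "i \<le> i'")
    case True
    then show ?thesis using * x y e unfolding x' y' by blast
  next
    case False
    then have "i' \<le> i" by simp
    then show ?thesis using *[of i' i j' j] x y e[symmetric] unfolding x' y' by blast
  qed
qed

text \<open>If \<open>y\<close> is in the row of \<open>x\<close> or below, the box to the right of
  \<open>x\<close> belongs to the shape; otherwise the box above \<open>x\<close> does. That box is
  adjacent to \<open>x\<close> and on the diagonal of \<open>y\<close>.\<close>

lemma next_content_same_component:
  assumes C: "adj_closed_in boxes C" and x: "x \<in> boxes" and y: "y \<in> boxes"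
    and c: "box_content m y = box_content m x + 1"
  shows "x \<in> C \<longleftrightarrow> y \<in> C"
proof -
  obtain i j where x': "x = (i, j)" by (cases x)
  obtain i' j' where y': "y = (i', j')" by (cases y)
  have h: "1 \<le> i" "i \<le> m" "a i \<le> j - i + m" "j - i + m < b i"
    "1 \<le> i'" "i' \<le> m" "a i' \<le> j - i + m + 1" "j - i + m + 1 < b i'"
    using x y c by (auto simp: x' y' mem_boxes_iff box_content_def)
  show ?thesis
  proof (cases "i \<le> i'")
    case True
    then have z: "(i, j + 1) \<in> boxes"
      unfolding mem_boxes_iff using h b_mono[of i i'] by simp
    have "x \<in> C \<longleftrightarrow> (i, j + 1) \<in> C" unfolding x'
      by (rule adj_closed_cov[OF C x[unfolded x'] z]) (simp add: cov_def)
    moreover have "(i, j + 1) \<in> C \<longleftrightarrow> y \<in> C"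
      by (rule same_content_same_component[OF C z y]) (use c in \<open>simp add: x' box_content_def\<close>)
    ultimately show ?thesis by blast
  next
    case False
    then have z: "(i - 1, j) \<in> boxes"
      unfolding mem_boxes_iff using h a_mono[of i' "i - 1"] b_mono[of "i - 1" i] by simp
    have "(i - 1, j) \<in> C \<longleftrightarrow> x \<in> C" unfolding x'
      by (rule adj_closed_cov[OF C z x[unfolded x']]) (simp add: cov_def)
    moreover have "(i - 1, j) \<in> C \<longleftrightarrow> y \<in> C"
      by (rule same_content_same_component[OF C z y]) (use c in \<open>simp add: x' box_content_def\<close>)
    ultimately show ?thesis by blast
  qed
qed

text \<open>Hence different components have disjoint sets of steps, so that columns can be treated
  component by component.\<close>

lemma steps_same_component:
  assumes C: "adj_closed_in boxes C" and s: "s \<in> steps (box_content m ` C)"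
    and y: "y \<in> boxes" "box_content m y = s \<or> box_content m y = s - 1"
  shows "y \<in> C"
proof -
  obtain x where x: "x \<in> C" "box_content m x = s \<or> box_content m x = s - 1"
    using s unfolding mem_steps_iff by force
  have "x \<in> boxes" using x C unfolding adj_closed_in_def by blast
  then show ?thesis
    using x y same_content_same_component[OF C, of x y] next_content_same_component[OF C, of x y]
      next_content_same_component[OF C, of y x] by auto
qed

lemma steps_box:
  assumes C: "adj_closed_in boxes C" and s: "s \<in> steps (box_content m ` C)"
  obtains k where "1 \<le> k" "k \<le> m" "a k \<le> s" "s \<le> b k" "a k < b k"
proof -
  obtain x where x: "x \<in> C" "box_content m x = s \<or> box_content m x = s - 1"
    using s unfolding mem_steps_iff by force
  then have "x \<in> boxes" using C unfolding adj_closed_in_def by blast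
  then show thesis using that[of "fst x"] x(2) by (auto simp: boxes_def)
qed

section \<open>Boundary steps read off from a component\<close>

definition A :: "int set" where "A = a ` {1..m}"
definition B :: "int set" where "B = b ` {1..m}"

lemma neighbour_notin:
  assumes C: "adj_closed_in boxes C" and "x \<in> C" "y \<notin> C" "cov x y \<or> cov y x"
  shows "y \<notin> boxes"
  using assms unfolding adj_closed_in_def by blast

text \<open>A vertical step \<open>s\<close> of the upper path has the box of content
  \<open>s\<close> to its right, and nothing to its left. This and the three companions (no right
  neighbour for steps in \<open>B\<close>, no neighbour above or below for horizontal steps) express
  the boundary through the shape of \<open>C\<close> alone, so that it can be followed through a
  placement.\<close>

lemma mem_A_iff:
  assumes C: "adj_closed_in boxes C" and s: "s \<in> steps (box_content m ` C)"
  shows "s \<in> A \<longleftrightarrow> (\<exists>x\<in>C. box_content m x = s \<and> (fst x, snd x - 1) \<notin> C)"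
proof
  assume "s \<in> A"
  then obtain i where i: "1 \<le> i" "i \<le> m" "s = a i" by (auto simp: A_def)
  obtain k where k: "1 \<le> k" "k \<le> m" "a k \<le> s" "s \<le> b k" "a k < b k" using steps_box[OF C s] .
  \<comment> \<open>An empty row ending at \<open>s\<close> is impossible: row \<open>k\<close> is
    nonempty and reaches \<open>s\<close>, and both ends of rows decrease strictly.\<close>
  have "a i < b i"
  proof (rule ccontr)
    assume "\<not> a i < b i"
    then have e: "b i = s" using a_le_b[of i] i by simp
    have "\<not> k < i" using a_dec[of k i] i k e by linarith
    moreover have "\<not> i < k" using b_dec[of i k] i k e by linarith
    moreover have "k \<noteq> i" using k(5) \<open>\<not> a i < b i\<close> by blast
    ultimately show False by linarith
  qed
  then have "(i, s + i - m) \<in> boxes" using i by (simp add: mem_boxes_iff)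
  then have "(i, s + i - m) \<in> C" by (rule steps_same_component[OF C s]) (simp add: box_content_def)
  moreover have "(i, s + i - m - 1) \<notin> C"
  proof -
    have "(i, s + i - m - 1) \<notin> boxes" unfolding mem_boxes_iff using i(3) by linarith
    then show ?thesis using C unfolding adj_closed_in_def by blast
  qed
  ultimately show "\<exists>x\<in>C. box_content m x = s \<and> (fst x, snd x - 1) \<notin> C"
    by (intro bexI[of _ "(i, s + i - m)"]) (auto simp: box_content_def)
next
  assume "\<exists>x\<in>C. box_content m x = s \<and> (fst x, snd x - 1) \<notin> C"
  then obtain i j where x: "(i, j) \<in> C" "box_content m (i, j) = s" "(i, j - 1) \<notin> C" by auto
  have "(i, j - 1) \<notin> boxes" by (rule neighbour_notin[OF C x(1,3)]) (simp add: cov_def)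
  moreover have "(i, j) \<in> boxes" using x C unfolding adj_closed_in_def by blast
  ultimately have "1 \<le> i" "i \<le> m" "s = a i" using x(2) by (auto simp: mem_boxes_iff box_content_def)
  then show "s \<in> A" by (auto simp: A_def)
qed

lemma mem_B_iff:
  assumes C: "adj_closed_in boxes C" and s: "s \<in> steps (box_content m ` C)"
  shows "s \<in> B \<longleftrightarrow> (\<exists>x\<in>C. box_content m x = s - 1 \<and> (fst x, snd x + 1) \<notin> C)"
proof
  assume "s \<in> B"
  then obtain i where i: "1 \<le> i" "i \<le> m" "s = b i" by (auto simp: B_def)
  obtain k where k: "1 \<le> k" "k \<le> m" "a k \<le> s" "s \<le> b k" "a k < b k" using steps_box[OF C s] .
  have "a i < b i"
  proof (rule ccontr)
    assume "\<not> a i < b i"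
    then have e: "a i = s" using a_le_b[of i] i by simp
    have "\<not> k < i" using a_dec[of k i] i k e by linarith
    moreover have "\<not> i < k" using b_dec[of i k] i k e by linarith
    moreover have "k \<noteq> i" using k(5) \<open>\<not> a i < b i\<close> by blast
    ultimately show False by linarith
  qed
  then have "(i, s - 1 + i - m) \<in> boxes" using i by (simp add: mem_boxes_iff)
  then have "(i, s - 1 + i - m) \<in> C" by (rule steps_same_component[OF C s]) (simp add: box_content_def)
  moreover have "(i, s + i - m) \<notin> C"
  proof -
    have "(i, s + i - m) \<notin> boxes" unfolding mem_boxes_iff using i(3) by linarith
    then show ?thesis using C unfolding adj_closed_in_def by blast
  qed
  ultimately show "\<exists>x\<in>C. box_content m x = s - 1 \<and> (fst x, snd x + 1) \<notin> C"
    by (intro bexI[of _ "(i, s - 1 + i - m)"]) (auto simp: box_content_def algebra_simps)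
next
  assume "\<exists>x\<in>C. box_content m x = s - 1 \<and> (fst x, snd x + 1) \<notin> C"
  then obtain i j where x: "(i, j) \<in> C" "box_content m (i, j) = s - 1" "(i, j + 1) \<notin> C" by auto
  have "(i, j + 1) \<notin> boxes" by (rule neighbour_notin[OF C x(1,3)]) (simp add: cov_def)
  moreover have "(i, j) \<in> boxes" using x C unfolding adj_closed_in_def by blast
  ultimately have "1 \<le> i" "i \<le> m" "s = b i" using x(2) by (auto simp: mem_boxes_iff box_content_def)
  then show "s \<in> B" by (auto simp: B_def)
qed

lemma not_mem_A_iff:
  assumes C: "adj_closed_in boxes C" and s: "s \<in> steps (box_content m ` C)"
  shows "s \<notin> A \<longleftrightarrow> (\<exists>x\<in>C. box_content m x = s - 1 \<and> (fst x - 1, snd x) \<notin> C)"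
proof
  assume sA: "s \<notin> A"
  obtain k where k: "1 \<le> k" "k \<le> m" "a k \<le> s" "s \<le> b k" "a k < b k" using steps_box[OF C s] .
  have neq: "a i \<noteq> s" if "1 \<le> i" "i \<le> m" for i using sA that by (auto simp: A_def)
  \<comment> \<open>The topmost row that starts before \<open>s\<close> contains a box of content
    \<open>s - 1\<close>. A box above it would put the previous row into \<open>K\<close> too, as no
    row starts exactly at \<open>s\<close>.\<close>
  define K where "K = {i \<in> {1..k}. a i \<le> s - 1}"
  have "k \<in> K" using k neq[of k] by (auto simp: K_def)
  moreover have "finite K" by (rule finite_subset[of _ "{1..m}"]) (use k in \<open>auto simp: K_def\<close>)
  ultimately have MK: "Min K \<in> K" and le: "\<And>i. i \<in> K \<Longrightarrow> Min K \<le> i" by (auto intro: Min_in)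
  define i where "i = Min K"
  have i: "1 \<le> i" "i \<le> k" "a i \<le> s - 1" using MK by (auto simp: K_def i_def)
  have "b i \<ge> s" using b_mono[of i k] i k by simp
  then have "(i, s - 1 + i - m) \<in> boxes" using i k by (simp add: mem_boxes_iff)
  then have "(i, s - 1 + i - m) \<in> C" by (rule steps_same_component[OF C s]) (simp add: box_content_def)
  moreover have "(i - 1, s - 1 + i - m) \<notin> C"
  proof
    assume "(i - 1, s - 1 + i - m) \<in> C"
    then have "(i - 1, s - 1 + i - m) \<in> boxes" using C unfolding adj_closed_in_def by blast
    then have h: "1 \<le> i - 1" "a (i - 1) \<le> s" by (auto simp: mem_boxes_iff)
    then have "i - 1 \<in> K" using neq[of "i - 1"] i k by (auto simp: K_def)
    then show False using le[of "i - 1"] by (simp add: i_def)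
  qed
  ultimately show "\<exists>x\<in>C. box_content m x = s - 1 \<and> (fst x - 1, snd x) \<notin> C"
    by (intro bexI[of _ "(i, s - 1 + i - m)"]) (auto simp: box_content_def)
next
  assume "\<exists>x\<in>C. box_content m x = s - 1 \<and> (fst x - 1, snd x) \<notin> C"
  then obtain i j where x: "(i, j) \<in> C" "box_content m (i, j) = s - 1" "(i - 1, j) \<notin> C" by auto
  have up: "(i - 1, j) \<notin> boxes" by (rule neighbour_notin[OF C x(1,3)]) (simp add: cov_def)
  have "(i, j) \<in> boxes" using x C unfolding adj_closed_in_def by blast
  then have i: "1 \<le> i" "i \<le> m" "a i \<le> s - 1" "s - 1 < b i" using x(2) by (auto simp: mem_boxes_iff box_content_def)
  show "s \<notin> A"
  proof
    assume "s \<in> A"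
    then obtain k where k: "1 \<le> k" "k \<le> m" "s = a k" by (auto simp: A_def)
    have "k < i" using a_mono[of i k] i k by (cases "k < i") auto
    then have "(i - 1, j) \<in> boxes"
      using a_mono[of k "i - 1"] b_mono[of "i - 1" i] i k x(2) by (simp add: mem_boxes_iff box_content_def)
    then show False using up by blast
  qed
qed

lemma not_mem_B_iff:
  assumes C: "adj_closed_in boxes C" and s: "s \<in> steps (box_content m ` C)"
  shows "s \<notin> B \<longleftrightarrow> (\<exists>x\<in>C. box_content m x = s \<and> (fst x + 1, snd x) \<notin> C)"
proof
  assume sB: "s \<notin> B"
  obtain k where k: "1 \<le> k" "k \<le> m" "a k \<le> s" "s \<le> b k" "a k < b k" using steps_box[OF C s] .
  have neq: "b i \<noteq> s" if "1 \<le> i" "i \<le> m" for i using sB that by (auto simp: B_def)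
  \<comment> \<open>Symmetrically, the lowest row that extends beyond \<open>s\<close> contains a
    box of content \<open>s\<close> with nothing below it.\<close>
  define K where "K = {i \<in> {k..m}. s < b i}"
  have "k \<in> K" using k neq[of k] by (auto simp: K_def)
  moreover have "finite K" by (rule finite_subset[of _ "{1..m}"]) (use k in \<open>auto simp: K_def\<close>)
  ultimately have MK: "Max K \<in> K" and le: "\<And>i. i \<in> K \<Longrightarrow> i \<le> Max K" by (auto intro: Max_in)
  define i where "i = Max K"
  have i: "k \<le> i" "i \<le> m" "s < b i" using MK by (auto simp: K_def i_def)
  have "a i \<le> s" using a_mono[of k i] i k by simp
  then have "(i, s + i - m) \<in> boxes" using i k by (simp add: mem_boxes_iff)
  then have "(i, s + i - m) \<in> C" by (rule steps_same_component[OF C s]) (simp add: box_content_def)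
  moreover have "(i + 1, s + i - m) \<notin> C"
  proof
    assume "(i + 1, s + i - m) \<in> C"
    then have "(i + 1, s + i - m) \<in> boxes" using C unfolding adj_closed_in_def by blast
    then have h: "i + 1 \<le> m" "s \<le> b (i + 1)" by (auto simp: mem_boxes_iff)
    then have "i + 1 \<in> K" using neq[of "i + 1"] i k by (auto simp: K_def)
    then show False using le[of "i + 1"] by (simp add: i_def)
  qed
  ultimately show "\<exists>x\<in>C. box_content m x = s \<and> (fst x + 1, snd x) \<notin> C"
    by (intro bexI[of _ "(i, s + i - m)"]) (auto simp: box_content_def)
next
  assume "\<exists>x\<in>C. box_content m x = s \<and> (fst x + 1, snd x) \<notin> C"
  then obtain i j where x: "(i, j) \<in> C" "box_content m (i, j) = s" "(i + 1, j) \<notin> C" by auto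
  have up: "(i + 1, j) \<notin> boxes" by (rule neighbour_notin[OF C x(1,3)]) (simp add: cov_def)
  have "(i, j) \<in> boxes" using x C unfolding adj_closed_in_def by blast
  then have i: "1 \<le> i" "i \<le> m" "a i \<le> s" "s < b i" using x(2) by (auto simp: mem_boxes_iff box_content_def)
  show "s \<notin> B"
  proof
    assume "s \<in> B"
    then obtain k where k: "1 \<le> k" "k \<le> m" "s = b k" by (auto simp: B_def)
    have "i < k" using b_mono[of k i] i k by (cases "i < k") auto
    then have "(i + 1, j) \<in> boxes"
      using a_mono[of i "i + 1"] b_mono[of "i + 1" k] i k x(2) by (simp add: mem_boxes_iff box_content_def)
    then show False using up by blast
  qed
qed

section \<open>Numbers of boxes on the diagonals\<close>

definition N :: "int \<Rightarrow> int" where "N c = int (card {x \<in> boxes. box_content m x = c})"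

lemma N_rows: "N c = int (card {i \<in> {1..m}. a i \<le> c \<and> c < b i})"
proof -
  have "bij_betw fst {x \<in> boxes. box_content m x = c} {i \<in> {1..m}. a i \<le> c \<and> c < b i}"
    by (rule bij_betw_byWitness[where f' = "\<lambda>i. (i, c + i - m)"])
       (auto simp: boxes_def box_content_def prod_eq_iff)
  then show ?thesis using bij_betw_same_card by (force simp: N_def)
qed

lemma N_nonneg: "0 \<le> N c" by (simp add: N_def)

lemma finite_content: "finite {x \<in> boxes. box_content m x = c}"
proof (rule finite_subset)
  show "{x \<in> boxes. box_content m x = c} \<subseteq> (\<lambda>i. (i, c + i - m)) ` {1..m}"
    by (auto simp: boxes_def box_content_def image_iff prod_eq_iff)
qed simp

lemma N_eq_0: "c \<notin> box_content m ` boxes \<Longrightarrow> N c = 0"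
  by (auto simp: N_def card_eq_0_iff)

lemma inj_on_a: "inj_on a {1..m}"
proof (rule inj_onI)
  fix i j assume "i \<in> {1..m}" "j \<in> {1..m}" "a i = a j"
  then show "i = j" using a_dec[of i j] a_dec[of j i] by (cases i j rule: linorder_cases) auto
qed

lemma inj_on_b: "inj_on b {1..m}"
proof (rule inj_onI)
  fix i j assume "i \<in> {1..m}" "j \<in> {1..m}" "b i = b j"
  then show "i = j" using b_dec[of i j] b_dec[of j i] by (cases i j rule: linorder_cases) auto
qed

lemma card_A_atMost: "card (A \<inter> {..c}) = card {i \<in> {1..m}. a i \<le> c}"
proof -
  have "A \<inter> {..c} = a ` {i \<in> {1..m}. a i \<le> c}" by (auto simp: A_def)
  moreover have "{i \<in> {1..m}. a i \<le> c} \<subseteq> {1..m}" by blast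
  ultimately show ?thesis by (simp only: card_image[OF inj_on_subset[OF inj_on_a]])
qed

lemma card_B_atMost: "card (B \<inter> {..c}) = card {i \<in> {1..m}. b i \<le> c}"
proof -
  have "B \<inter> {..c} = b ` {i \<in> {1..m}. b i \<le> c}" by (auto simp: B_def)
  moreover have "{i \<in> {1..m}. b i \<le> c} \<subseteq> {1..m}" by blast
  ultimately show ?thesis by (simp only: card_image[OF inj_on_subset[OF inj_on_b]])
qed

text \<open>Rows with a box of content \<open>c\<close> are those already begun but not yet ended at
  \<open>c\<close>. So \<open>N c\<close> is the distance between the boundary paths after
  \<open>c\<close> steps.\<close>

lemma N_eq_diff: "N c = int (card (A \<inter> {..c})) - int (card (B \<inter> {..c}))"
proof -
  have "{i \<in> {1..m}. a i \<le> c \<and> c < b i} = {i \<in> {1..m}. a i \<le> c} - {i \<in> {1..m}. b i \<le> c}" by auto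
  moreover have sub: "{i \<in> {1..m}. b i \<le> c} \<subseteq> {i \<in> {1..m}. a i \<le> c}" using a_le_b by force
  ultimately have "N c = int (card {i \<in> {1..m}. a i \<le> c} - card {i \<in> {1..m}. b i \<le> c})"
    unfolding N_rows using card_Diff_subset[OF finite_int_filter sub] by simp
  also have "\<dots> = int (card {i \<in> {1..m}. a i \<le> c}) - int (card {i \<in> {1..m}. b i \<le> c})"
    by (rule of_nat_diff) (rule card_mono[OF finite_int_filter sub])
  finally show ?thesis by (simp add: card_A_atMost card_B_atMost)
qed

end

section \<open>Lattice paths between the two boundary paths\<close>

definition ind :: "int set \<Rightarrow> int \<Rightarrow> int" where "ind X s = of_bool (s \<in> X)"

text \<open>
  \<open>d c\<close> counts the boxes of content \<open>c\<close> between the lattice paths with vertical steps \<open>A\<close> and \<open>I\<close>.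
  This description of the paths inside a skew shape involves adjacent steps only, so it can be
  transported component by component.
\<close>

definition step_sets :: "int set \<Rightarrow> (int \<Rightarrow> int) \<Rightarrow> int set set" where
  "step_sets A N = {I. \<exists>d. (\<forall>c. 0 \<le> d c \<and> d c \<le> N c) \<and> (\<forall>s. ind I s = ind A s + d (s - 1) - d s)}"

lemma card_Int_atMost_step:
  assumes "finite (X \<inter> {..s})"
  shows "int (card (X \<inter> {..s})) = int (card (X \<inter> {..s - 1})) + ind X s"
proof -
  have "x \<le> s \<longleftrightarrow> x = s \<or> x \<le> s - 1" for x by auto
  then have "X \<inter> {..s} = (if s \<in> X then insert s (X \<inter> {..s - 1}) else X \<inter> {..s - 1})"
    by (auto simp del: zle_diff1_eq)
  moreover have "finite (X \<inter> {..s - 1})" by (rule finite_subset[OF _ assms]) auto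
  ultimately show ?thesis by (auto simp: ind_def)
qed

context skew_shape begin

lemma ind_B: "ind B s = ind A s + N (s - 1) - N s"
proof -
  have "finite A" "finite B" by (simp_all add: A_def B_def)
  then show ?thesis using card_Int_atMost_step[of A s] card_Int_atMost_step[of B s] by (simp add: N_eq_diff)
qed

lemma card_index_le:
  assumes "finite I" "int (card I) = m"
    and low: "\<And>i. 1 \<le> i \<Longrightarrow> i \<le> m \<Longrightarrow> i \<le> int (card (I \<inter> {a i..n}))"
  shows "card (I \<inter> {..c}) \<le> card (A \<inter> {..c})"
proof (cases "int (card (A \<inter> {..c})) < m")
  case False
  have "card (I \<inter> {..c}) \<le> card I" using assms by (intro card_mono) auto
  then show ?thesis using False assms by simp
next
  case True
  let ?P = "{i \<in> {1..m}. a i \<le> c}"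
  let ?p = "int (card ?P)"
  have p: "?p < m" using True by (simp add: card_A_atMost)
  \<comment> \<open>The rows with \<open>a i \<le> c\<close> are the last \<open>?p\<close> ones, so
    row \<open>m - ?p\<close> starts beyond \<open>c\<close> and forces \<open>m - ?p\<close>
    elements of \<open>I\<close> to exceed \<open>c\<close>.\<close>
  let ?i = "m - ?p"
  have "c < a ?i"
  proof (rule ccontr)
    assume "\<not> c < a ?i"
    then have "{?i..m} \<subseteq> ?P" using a_mono[of ?i] p by fastforce
    then have "card {?i..m} \<le> card ?P" by (rule card_mono[OF finite_int_filter])
    then show False by simp
  qed
  then have "(I \<inter> {..c}) \<inter> (I \<inter> {a ?i..n}) = {}" by auto
  then have "card (I \<inter> {..c}) + card (I \<inter> {a ?i..n}) = card ((I \<inter> {..c}) \<union> (I \<inter> {a ?i..n}))"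
    using assms by (subst card_Un_disjoint) auto
  also have "\<dots> \<le> card I" using assms by (intro card_mono) auto
  finally have "int (card (I \<inter> {..c})) + ?i \<le> m" using low[of ?i] p assms(2) by linarith
  then show ?thesis by (simp add: card_A_atMost)
qed

lemma card_index_ge:
  assumes "finite I"
    and up: "\<And>i. 1 \<le> i \<Longrightarrow> i \<le> m \<Longrightarrow> m - i + 1 \<le> int (card (I \<inter> {1..b i}))"
  shows "card (B \<inter> {..c}) \<le> card (I \<inter> {..c})"
proof (cases "card (B \<inter> {..c}) = 0")
  case False
  let ?P = "{i \<in> {1..m}. b i \<le> c}"
  let ?p = "int (card ?P)"
  have p0: "0 < ?p" using False by (simp add: card_B_atMost)
  have "card ?P \<le> card {1..m}" by (intro card_mono) auto
  then have pm: "?p \<le> m" using m_nonneg by simp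
  \<comment> \<open>This is the topmost row that ends by \<open>c\<close>; its condition forces
    \<open>?p\<close> elements of \<open>I\<close> up to \<open>c\<close>.\<close>
  let ?i = "m - ?p + 1"
  have "b ?i \<le> c"
  proof (rule ccontr)
    assume n: "\<not> b ?i \<le> c"
    have "?P \<subseteq> {?i + 1..m}"
    proof
      fix j assume j: "j \<in> ?P"
      then have "\<not> j \<le> ?i" using b_mono[of j ?i] n p0 by auto
      then show "j \<in> {?i + 1..m}" using j by auto
    qed
    then have "card ?P \<le> card {?i + 1..m}" by (intro card_mono) auto
    then show False using p0 by simp
  qed
  then have "card (I \<inter> {1..b ?i}) \<le> card (I \<inter> {..c})" using assms(1) by (intro card_mono) auto
  moreover have "?p \<le> int (card (I \<inter> {1..b ?i}))" using up[of ?i] p0 pm by simp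
  ultimately show ?thesis by (simp add: card_B_atMost)
qed simp

text \<open>The rowwise conditions amount to comparing prefix counts of \<open>I\<close> with those
  of \<open>A\<close> and \<open>B\<close>. The function \<open>d\<close> is the prefix count of
  \<open>A\<close> minus that of \<open>I\<close>; conversely it is recovered from its increments,
  starting at 0.\<close>

lemma step_sets_eq:
  "step_sets A N = {I. I \<subseteq> {1..n} \<and> int (card I) = m \<and>
     (\<forall>i\<in>{1..m}. m - i + 1 \<le> int (card (I \<inter> {1..b i})) \<and> i \<le> int (card (I \<inter> {a i..n})))}"
proof (intro equalityI subsetI)
  fix I assume "I \<in> {I. I \<subseteq> {1..n} \<and> int (card I) = m \<and>
     (\<forall>i\<in>{1..m}. m - i + 1 \<le> int (card (I \<inter> {1..b i})) \<and> i \<le> int (card (I \<inter> {a i..n})))}"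
  then have I: "I \<subseteq> {1..n}" "int (card I) = m"
    "\<And>i. 1 \<le> i \<Longrightarrow> i \<le> m \<Longrightarrow> m - i + 1 \<le> int (card (I \<inter> {1..b i}))"
    "\<And>i. 1 \<le> i \<Longrightarrow> i \<le> m \<Longrightarrow> i \<le> int (card (I \<inter> {a i..n}))" by auto
  have fI: "finite I" using I(1) finite_subset by blast
  have fA: "finite A" by (simp add: A_def)
  define d where "d c = int (card (A \<inter> {..c})) - int (card (I \<inter> {..c}))" for c
  have "0 \<le> d c" "d c \<le> N c" for c
    using card_index_le[OF fI I(2) I(4), of c] card_index_ge[OF fI I(3), of c] by (auto simp: d_def N_eq_diff)
  moreover have "ind I s = ind A s + d (s - 1) - d s" for s
    using card_Int_atMost_step[of I s] card_Int_atMost_step[of A s] fI fA by (simp add: d_def)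
  ultimately show "I \<in> step_sets A N" unfolding step_sets_def by blast
next
  fix I assume "I \<in> step_sets A N"
  then obtain d where d: "\<And>c. 0 \<le> d c" "\<And>c. d c \<le> N c" "\<And>s. ind I s = ind A s + d (s - 1) - d s"
    unfolding step_sets_def by blast
  have fA: "finite A" by (simp add: A_def)
  have An: "A \<subseteq> {1..n}" using a_pos a_le_b b_le_n by (fastforce simp: A_def)
  have Bn: "B \<subseteq> {1..n}" using a_pos a_le_b b_le_n by (fastforce simp: B_def)
  have cA: "int (card A) = m" using m_nonneg by (simp add: A_def card_image[OF inj_on_a])
  have cB: "int (card B) = m" using m_nonneg by (simp add: B_def card_image[OF inj_on_b])
  have N_low: "N c = 0" if "c \<le> 0" for c
  proof -
    have "A \<inter> {..c} = {}" "B \<inter> {..c} = {}" using that An Bn by auto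
    then show ?thesis by (simp add: N_eq_diff)
  qed
  have N_high: "N c = 0" if "n \<le> c" for c
  proof -
    have "A \<inter> {..c} = A" "B \<inter> {..c} = B" using that An Bn by auto
    then show ?thesis by (simp add: N_eq_diff cA cB)
  qed
  have d0: "d c = 0" if "N c = 0" for c using d(1)[of c] d(2)[of c] that by simp
  have In: "I \<subseteq> {1..n}"
  proof
    fix s assume s: "s \<in> I"
    show "s \<in> {1..n}"
    proof (rule ccontr)
      assume "s \<notin> {1..n}"
      then have "ind A s = 0" "d (s - 1) = 0" "d s = 0" using An d0 N_low N_high by (auto simp: ind_def)
      then show False using d(3)[of s] s by (simp add: ind_def)
    qed
  qed
  then have fI: "finite I" using finite_subset by blast
  have hI: "int (card (I \<inter> {..c})) = int (card (A \<inter> {..c})) - d c" if "0 \<le> c" for c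
    using that
  proof (induction c rule: int_ge_induct)
    case base
    have "A \<inter> {..0} = {}" "I \<inter> {..0} = {}" using An In by auto
    then show ?case using d0[of 0] N_low[of 0] by simp
  next
    case (step c)
    then show ?case using card_Int_atMost_step[of I "c + 1"] card_Int_atMost_step[of A "c + 1"] fI fA d(3)[of "c + 1"] by simp
  qed
  have n0: "0 \<le> n" if "1 \<le> m" using a_pos[of 1] a_le_b[of 1] b_le_n[of 1] that by simp
  have cI: "int (card I) = m"
  proof (cases "0 \<le> n")
    case True
    have "I \<inter> {..n} = I" "A \<inter> {..n} = A" using In An by auto
    then show ?thesis using hI[OF True] cA d0[OF N_high] by simp
  next
    case False
    then have "m = 0" "I = {}" using n0 m_nonneg In by (force, auto)
    then show ?thesis by simp
  qed
  have 1: "m - i + 1 \<le> int (card (I \<inter> {1..b i}))" if i: "i \<in> {1..m}" for i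
  proof -
    have "I \<inter> {1..b i} = I \<inter> {..b i}" using In by auto
    moreover have "int (card (B \<inter> {..b i})) \<le> int (card (I \<inter> {..b i}))"
      using hI[of "b i"] d(2)[of "b i"] a_pos[of i] a_le_b[of i] i by (simp add: N_eq_diff)
    moreover have "card {i..m} \<le> card {j \<in> {1..m}. b j \<le> b i}"
      using b_mono[of i] i by (intro card_mono) fastforce+
    ultimately show ?thesis using i by (simp add: card_B_atMost)
  qed
  have 2: "i \<le> int (card (I \<inter> {a i..n}))" if i: "i \<in> {1..m}" for i
  proof -
    have "int (card (I \<inter> {..a i - 1})) \<le> int (card (A \<inter> {..a i - 1}))"
      using hI[of "a i - 1"] d(1)[of "a i - 1"] a_pos[of i] i by simp
    moreover have "card (A \<inter> {..a i - 1}) \<le> card {i + 1..m}"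
      unfolding card_A_atMost
    proof (rule card_mono)
      show "{j \<in> {1..m}. a j \<le> a i - 1} \<subseteq> {i + 1..m}"
      proof
        fix j assume j: "j \<in> {j \<in> {1..m}. a j \<le> a i - 1}"
        then have "\<not> j \<le> i" using a_mono[of j i] i by auto
        then show "j \<in> {i + 1..m}" using j by auto
      qed
    qed simp
    moreover have "card I \<le> card (I \<inter> {..a i - 1}) + card (I \<inter> {a i..n})"
    proof -
      have "I = (I \<inter> {..a i - 1}) \<union> (I \<inter> {a i..n})" using In by auto
      then show ?thesis by (metis card_Un_le)
    qed
    moreover have "int (card {i + 1..m}) = m - i" using i by simp
    ultimately show ?thesis using cI by linarith
  qed
  show "I \<in> {I. I \<subseteq> {1..n} \<and> int (card I) = m \<and>
     (\<forall>i\<in>{1..m}. m - i + 1 \<le> int (card (I \<inter> {1..b i})) \<and> i \<le> int (card (I \<inter> {a i..n})))}"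
    using In cI 1 2 by blast
qed

end

section \<open>Matching the components of two skew shapes\<close>

lemma ind_symdiff: "ind (symdiff I D) s = (if s \<in> D then 1 - ind I s else ind I s)"
  by (auto simp: ind_def symdiff_def)

text \<open>\<open>d\<close> is squeezed between 0 and \<open>L\<close>, so it vanishes off all
  contents. A content next to a step of one component cannot belong to another, as the two would
  share that step; so \<open>d\<close> also vanishes just before and just after a component.\<close>

lemma steps_support:
  assumes disj: "\<forall>C\<in>Q. \<forall>C'\<in>Q. \<forall>s\<in>steps (Z C) \<inter> steps (Z C'). C = C'"
    and L: "\<forall>c. L c \<noteq> 0 \<longrightarrow> (\<exists>C\<in>Q. c \<in> Z C)" and d: "\<And>c. 0 \<le> d c" "\<And>c. d c \<le> (L c :: int)"
  shows "s \<notin> (\<Union>C\<in>Q. steps (Z C)) \<Longrightarrow> d s = 0 \<and> d (s - 1) = 0"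
    and "C \<in> Q \<Longrightarrow> s \<in> steps (Z C) \<Longrightarrow> s \<notin> Z C \<Longrightarrow> d s = 0"
    and "C \<in> Q \<Longrightarrow> s \<in> steps (Z C) \<Longrightarrow> s - 1 \<notin> Z C \<Longrightarrow> d (s - 1) = 0"
proof -
  have z: "d c = 0" if "\<And>C. C \<in> Q \<Longrightarrow> c \<notin> Z C" for c
  proof -
    have "L c = 0" using L that by blast
    then show ?thesis using d[of c] by simp
  qed
  show "d s = 0 \<and> d (s - 1) = 0" if "s \<notin> (\<Union>C\<in>Q. steps (Z C))"
    using z[of s] z[of "s - 1"] that by (auto simp: mem_steps_iff)
  have "d e = 0" if "C \<in> Q" "s \<in> steps (Z C)" "e \<notin> Z C" "e = s \<or> e = s - 1" for e
  proof (rule z, rule notI)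
    fix C' assume C': "C' \<in> Q" "e \<in> Z C'"
    then have "s \<in> steps (Z C')" using that(4) by (auto simp: mem_steps_iff)
    then have "C = C'" using disj C'(1) that(1,2) by blast
    then show False using C' that by blast
  qed
  then show "C \<in> Q \<Longrightarrow> s \<in> steps (Z C) \<Longrightarrow> s \<notin> Z C \<Longrightarrow> d s = 0"
    and "C \<in> Q \<Longrightarrow> s \<in> steps (Z C) \<Longrightarrow> s - 1 \<notin> Z C \<Longrightarrow> d (s - 1) = 0" by blast+
qed

text \<open>
  Components are indexed by \<open>Q\<close>; \<open>Y C\<close> and \<open>Y' C\<close> are the contents of the boxes of a component and
  of its partner.  The sets \<open>A\<close> and \<open>B\<close> are the vertical steps of the upper and lower boundary
  path.  A component with \<open>rev C \<noteq> dual C\<close> is matched by an anti-isomorphism, which exchanges the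
  two boundary paths.
\<close>

locale matching =
  fixes Q :: "'c set" and Y Y' :: "'c \<Rightarrow> int set" and rev dual :: "'c \<Rightarrow> bool" and k :: "'c \<Rightarrow> int"
    and A B A' :: "int set" and N N' :: "int \<Rightarrow> int"
  assumes Y'_eq: "C \<in> Q \<Longrightarrow> Y' C = (\<lambda>c. if rev C then k C - c else c + k C) ` Y C"
    and disj: "C \<in> Q \<Longrightarrow> C' \<in> Q \<Longrightarrow> s \<in> steps (Y C) \<Longrightarrow> s \<in> steps (Y C') \<Longrightarrow> C = C'"
    and disj': "C \<in> Q \<Longrightarrow> C' \<in> Q \<Longrightarrow> s \<in> steps (Y' C) \<Longrightarrow> s \<in> steps (Y' C') \<Longrightarrow> C = C'"
    and N_nonneg: "0 \<le> N c" "0 \<le> N' c"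
    and N_supp: "N c \<noteq> 0 \<Longrightarrow> \<exists>C\<in>Q. c \<in> Y C" "N' c \<noteq> 0 \<Longrightarrow> \<exists>C\<in>Q. c \<in> Y' C"
    and N_pos: "C \<in> Q \<Longrightarrow> c \<in> Y C \<Longrightarrow> 0 < N c"
    and N_eq: "C \<in> Q \<Longrightarrow> c \<in> Y C \<Longrightarrow> N' (if rev C then k C - c else c + k C) = N c"
    and ind_B: "ind B s = ind A s + N (s - 1) - N s"
    and mem_A': "C \<in> Q \<Longrightarrow> s \<in> steps (Y C) \<Longrightarrow>
      (if rev C then k C + 1 - s else s + k C) \<in> A' \<longleftrightarrow> dual C \<noteq> (s \<in> (if rev C \<noteq> dual C then B else A))"
begin

definition contmap :: "'c \<Rightarrow> int \<Rightarrow> int" where "contmap C c = (if rev C then k C - c else c + k C)"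
text \<open>A box of content \<open>c\<close> has the steps \<open>c\<close> and
  \<open>c + 1\<close>. If contents are reversed by \<open>k - c\<close>, this pair must go to
  \<open>k - c + 1\<close> and \<open>k - c\<close>, which explains the additional 1.\<close>

definition stepmap :: "'c \<Rightarrow> int \<Rightarrow> int" where "stepmap C s = (if rev C then k C + 1 - s else s + k C)"
definition U :: "int set" where "U = (\<Union>C\<in>Q. steps (Y C))"
definition U' :: "int set" where "U' = (\<Union>C\<in>Q. steps (Y' C))"
text \<open>Off \<open>U\<close> every admissible set agrees with \<open>A\<close>, so taking the
  symmetric difference with \<open>A - U\<close> empties all those columns. Inside \<open>U\<close>
  exactly the components marked \<open>dual\<close> are complemented.\<close>

definition D :: "int set" where "D = (A - U) \<union> (\<Union>C\<in>{C \<in> Q. dual C}. steps (Y C))"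
definition g :: "int \<Rightarrow> int" where "g s = stepmap (THE C. C \<in> Q \<and> s \<in> steps (Y C)) s"

lemma g_eq: "C \<in> Q \<Longrightarrow> s \<in> steps (Y C) \<Longrightarrow> g s = stepmap C s"
  unfolding g_def by (subst the_equality[of _ C]) (auto dest: disj)

lemma contmap_mem: "C \<in> Q \<Longrightarrow> contmap C c \<in> Y' C \<longleftrightarrow> c \<in> Y C"
  by (auto simp: Y'_eq contmap_def)

lemma contmap_image: "C \<in> Q \<Longrightarrow> Y' C = contmap C ` Y C"
  by (simp add: Y'_eq contmap_def[abs_def])

lemma stepmap_contmap:
  "stepmap C s - 1 = contmap C (if rev C then s else s - 1)"
  "stepmap C s = contmap C (if rev C then s - 1 else s)"
  by (auto simp: stepmap_def contmap_def)

lemma stepmap_mem: "C \<in> Q \<Longrightarrow> stepmap C s \<in> steps (Y' C) \<longleftrightarrow> s \<in> steps (Y C)"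
  unfolding mem_steps_iff stepmap_contmap(1)
  by (subst stepmap_contmap(2)) (auto simp: contmap_mem)

lemma stepmap_image: "C \<in> Q \<Longrightarrow> stepmap C ` steps (Y C) = steps (Y' C)"
proof (intro equalityI subsetI)
  fix s' assume C: "C \<in> Q" and s': "s' \<in> steps (Y' C)"
  define s where "s = (if rev C then k C + 1 - s' else s' - k C)"
  have "s' = stepmap C s" by (simp add: s_def stepmap_def)
  then show "s' \<in> stepmap C ` steps (Y C)" using s' stepmap_mem[OF C, of s] by blast
qed (auto simp: stepmap_mem)

lemma g_image: "g ` U = U'"
proof -
  have "g ` U = (\<Union>C\<in>Q. g ` steps (Y C))" by (auto simp: U_def)
  also have "\<dots> = (\<Union>C\<in>Q. stepmap C ` steps (Y C))"
    by (intro SUP_cong image_cong refl g_eq)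
  finally show ?thesis by (simp add: stepmap_image U'_def)
qed

lemma inj_on_g: "inj_on g U"
proof (rule inj_onI)
  fix s t assume "s \<in> U" "t \<in> U" and eq: "g s = g t"
  then obtain C C' where C: "C \<in> Q" "s \<in> steps (Y C)" "C' \<in> Q" "t \<in> steps (Y C')" by (auto simp: U_def)
  have "stepmap C s = stepmap C' t" using eq C by (simp add: g_eq)
  moreover have "C = C'"
    using disj'[OF C(1,3), of "g s"] stepmap_mem[OF C(1), of s] stepmap_mem[OF C(3), of t] C eq
    by (simp add: g_eq)
  ultimately show "s = t" by (auto simp: stepmap_def split: if_splits)
qed

lemma mem_D_iff: "C \<in> Q \<Longrightarrow> s \<in> steps (Y C) \<Longrightarrow> s \<in> D \<longleftrightarrow> dual C"
  unfolding D_def U_def by (auto dest: disj)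

lemma mem_D_outside: "s \<notin> U \<Longrightarrow> s \<in> D \<longleftrightarrow> s \<in> A"
  unfolding D_def U_def by auto

lemma steps_disjoint:
  "\<forall>C\<in>Q. \<forall>C'\<in>Q. \<forall>s\<in>steps (Y C) \<inter> steps (Y C'). C = C'"
  "\<forall>C\<in>Q. \<forall>C'\<in>Q. \<forall>s\<in>steps (Y' C) \<inter> steps (Y' C'). C = C'"
  using disj disj' by blast+

lemma N_support:
  "\<forall>c. N c \<noteq> 0 \<longrightarrow> (\<exists>C\<in>Q. c \<in> Y C)" "\<forall>c. N' c \<noteq> 0 \<longrightarrow> (\<exists>C\<in>Q. c \<in> Y' C)"
  using N_supp by blast+

lemmas supp = steps_support[OF steps_disjoint(1) N_support(1), folded U_def]
lemmas supp' = steps_support[OF steps_disjoint(2) N_support(2), folded U'_def]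

lemma step_sets_outside: "I \<in> step_sets A N \<Longrightarrow> s \<notin> U \<Longrightarrow> s \<in> I \<longleftrightarrow> s \<in> A"
proof -
  assume "I \<in> step_sets A N" "s \<notin> U"
  then obtain d where d: "\<And>c. 0 \<le> d c" "\<And>c. d c \<le> N c" "\<And>s. ind I s = ind A s + d (s - 1) - d s"
    unfolding step_sets_def by blast
  then have "ind I s = ind A s" using supp(1)[OF d(1,2) \<open>s \<notin> U\<close>] by simp
  then show ?thesis by (auto simp: ind_def split: if_splits)
qed

lemma step_sets_outside': "I \<in> step_sets A' N' \<Longrightarrow> s \<notin> U' \<Longrightarrow> s \<in> I \<longleftrightarrow> s \<in> A'"
proof -
  assume "I \<in> step_sets A' N'" "s \<notin> U'"
  then obtain d where d: "\<And>c. 0 \<le> d c" "\<And>c. d c \<le> N' c" "\<And>s. ind I s = ind A' s + d (s - 1) - d s"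
    unfolding step_sets_def by blast
  then have "ind I s = ind A' s" using supp'(1)[OF d(1,2) \<open>s \<notin> U'\<close>] by simp
  then show ?thesis by (auto simp: ind_def split: if_splits)
qed

text \<open>If the boundary paths are exchanged, that is if \<open>rev C \<noteq> dual C\<close>,
  the distance from the upper path becomes the distance from the lower one,
  \<open>N c - d c\<close>.\<close>

definition related :: "(int \<Rightarrow> int) \<Rightarrow> (int \<Rightarrow> int) \<Rightarrow> bool" where
  "related d d' \<longleftrightarrow> (\<forall>c. 0 \<le> d c \<and> d c \<le> N c) \<and> (\<forall>c. 0 \<le> d' c \<and> d' c \<le> N' c) \<and>
     (\<forall>C\<in>Q. \<forall>c\<in>Y C. d' (contmap C c) = (if rev C \<noteq> dual C then N c - d c else d c))"

text \<open>The equation at a step involves two contents, one of which may lie just outside the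
  component. There \<open>N\<close>, \<open>d\<close> and \<open>d'\<close> vanish, so the relation
  persists.\<close>

lemma related_step:
  assumes r: "related d d'" and C: "C \<in> Q" "s \<in> steps (Y C)" and c: "c = s \<or> c = s - 1"
  shows "d' (contmap C c) = (if rev C \<noteq> dual C then N c - d c else d c)"
proof (cases "c \<in> Y C")
  case True
  then show ?thesis using r C unfolding related_def by blast
next
  case False
  have d: "\<And>c. 0 \<le> d c" "\<And>c. d c \<le> N c" and d': "\<And>c. 0 \<le> d' c" "\<And>c. d' c \<le> N' c"
    using r unfolding related_def by auto
  have "d c = 0" using supp(2,3)[OF d C] False c by auto
  moreover have "N c = 0" using supp(2,3)[OF N_nonneg(1) order_refl C] False c by auto
  moreover have "d' (contmap C c) = 0"
  proof -
    have n: "contmap C c \<notin> Y' C" using contmap_mem[OF C(1)] False by blast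
    have s': "stepmap C s \<in> steps (Y' C)" using stepmap_mem[OF C(1)] C(2) by blast
    have "contmap C c = stepmap C s \<or> contmap C c = stepmap C s - 1"
      using c by (auto simp: contmap_def stepmap_def)
    then show ?thesis using supp'(2,3)[OF d' C(1) s'] n by auto
  qed
  ultimately show ?thesis by simp
qed

text \<open>The condition at \<open>s\<close> involves only \<open>d (s - 1)\<close> and
  \<open>d s\<close>. Complementing a component negates the increments and reversing it swaps the
  two terms; if only one of these happens, the exchange of the boundary paths makes up for it
  through \<open>ind_B\<close>.\<close>

lemma related_transfer:
  assumes r: "related d d'" and J: "J \<subseteq> U"
  shows "(\<forall>s. ind (symdiff J D) s = ind A s + d (s - 1) - d s) \<longleftrightarrow>
    (\<forall>s. ind (g ` J \<union> (A' - U')) s = ind A' s + d' (s - 1) - d' s)"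
proof -
  have d: "\<And>c. 0 \<le> d c" "\<And>c. d c \<le> N c" and d': "\<And>c. 0 \<le> d' c" "\<And>c. d' c \<le> N' c"
    using r unfolding related_def by auto
  have out: "ind (symdiff J D) s = ind A s + d (s - 1) - d s" if "s \<notin> U" for s
    using supp(1)[OF d that] mem_D_outside[OF that] J that by (auto simp: ind_def symdiff_def)
  have gJ: "g ` J \<subseteq> U'" using J g_image by blast
  have out': "ind (g ` J \<union> (A' - U')) s = ind A' s + d' (s - 1) - d' s" if "s \<notin> U'" for s
    using supp'(1)[OF d' that] gJ that by (auto simp: ind_def)
  have inn: "ind (symdiff J D) s = ind A s + d (s - 1) - d s \<longleftrightarrow>
      ind (g ` J \<union> (A' - U')) (g s) = ind A' (g s) + d' (g s - 1) - d' (g s)" if s: "s \<in> U" for s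
  proof -
    obtain C where C: "C \<in> Q" "s \<in> steps (Y C)" using s by (auto simp: U_def)
    have gs: "g s = stepmap C s" by (rule g_eq[OF C])
    have "g s \<in> U'" using g_image s by blast
    then have L: "ind (g ` J \<union> (A' - U')) (g s) = ind J s"
      using inj_on_image_mem_iff[OF inj_on_g s J] by (simp add: ind_def)
    have S: "ind (symdiff J D) s = (if dual C then 1 - ind J s else ind J s)"
      using mem_D_iff[OF C] by (simp add: ind_symdiff)
    have A': "ind A' (g s) = (let x = (if rev C \<noteq> dual C then ind B s else ind A s) in if dual C then 1 - x else x)"
      using mem_A'[OF C] unfolding gs stepmap_def by (auto simp: ind_def Let_def)
    have d1: "d' (g s - 1) = d' (contmap C (if rev C then s else s - 1))"
      "d' (g s) = d' (contmap C (if rev C then s - 1 else s))"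
      unfolding gs using stepmap_contmap[of C s] by metis+
    have d2: "d' (contmap C s) = (if rev C \<noteq> dual C then N s - d s else d s)"
      "d' (contmap C (s - 1)) = (if rev C \<noteq> dual C then N (s - 1) - d (s - 1) else d (s - 1))"
      using related_step[OF r C] by blast+
    show ?thesis unfolding L S A' d1 Let_def
      using ind_B[of s] by (cases "rev C"; cases "dual C") (simp_all add: d2, linarith+)
  qed
  show ?thesis
  proof
    assume *: "\<forall>s. ind (symdiff J D) s = ind A s + d (s - 1) - d s"
    show "\<forall>s. ind (g ` J \<union> (A' - U')) s = ind A' s + d' (s - 1) - d' s"
    proof
      fix s' show "ind (g ` J \<union> (A' - U')) s' = ind A' s' + d' (s' - 1) - d' s'"
      proof (cases "s' \<in> U'")
        case True
        then obtain s where "s \<in> U" "s' = g s" using g_image by blast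
        then show ?thesis using inn[of s] * by blast
      qed (rule out')
    qed
  next
    assume "\<forall>s. ind (g ` J \<union> (A' - U')) s = ind A' s + d' (s - 1) - d' s"
    then show "\<forall>s. ind (symdiff J D) s = ind A s + d (s - 1) - d s"
      using inn out by blast
  qed
qed

lemma step_sets_transfer:
  assumes J: "J \<subseteq> U"
  shows "symdiff J D \<in> step_sets A N \<longleftrightarrow> g ` J \<union> (A' - U') \<in> step_sets A' N'"
proof
  assume "symdiff J D \<in> step_sets A N"
  then obtain d where d: "\<And>c. 0 \<le> d c" "\<And>c. d c \<le> N c" and e: "\<forall>s. ind (symdiff J D) s = ind A s + d (s - 1) - d s"
    unfolding step_sets_def by blast
  \<comment> \<open>The distances are carried to the partner of each component; elsewhere
    \<open>N'\<close> is 0 and forces the value 0.\<close>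
  define d' where "d' c' = (if \<exists>C\<in>Q. c' \<in> Y' C
     then let C = (THE C. C \<in> Q \<and> c' \<in> Y' C); c = (if rev C then k C - c' else c' - k C)
       in if rev C \<noteq> dual C then N c - d c else d c else 0)" for c'
  have d'_eq: "d' (contmap C c) = (if rev C \<noteq> dual C then N c - d c else d c)" if C: "C \<in> Q" "c \<in> Y C" for C c
  proof -
    have m: "contmap C c \<in> Y' C" using contmap_mem[OF C(1)] C(2) by blast
    have the: "(THE C'. C' \<in> Q \<and> contmap C c \<in> Y' C') = C"
    proof (rule the_equality)
      fix C' assume C': "C' \<in> Q \<and> contmap C c \<in> Y' C'"
      then show "C' = C" using disj'[of C C' "contmap C c"] C(1) m by (simp add: mem_steps_iff)
    qed (use m C in blast)
    show ?thesis unfolding d'_def the using m C by (auto simp: contmap_def Let_def)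
  qed
  have "related d d'"
    unfolding related_def
  proof (intro conjI allI ballI)
    fix c' show "0 \<le> d' c'" "d' c' \<le> N' c'"
    proof (atomize (full), cases "\<exists>C\<in>Q. c' \<in> Y' C")
      case True
      then obtain C c where C: "C \<in> Q" "c \<in> Y C" "c' = contmap C c" using contmap_image by blast
      then have "N' c' = N c" using N_eq by (simp add: contmap_def)
      then show "0 \<le> d' c' \<and> d' c' \<le> N' c'" using d'_eq[OF C(1,2)] d[of c] C(3) by auto
    qed (use N_nonneg in \<open>auto simp: d'_def\<close>)
  qed (use d d'_eq in auto)
  then have "(\<forall>c. 0 \<le> d' c \<and> d' c \<le> N' c) \<and> (\<forall>s. ind (g ` J \<union> (A' - U')) s = ind A' s + d' (s - 1) - d' s)"
    using related_transfer[OF _ J] e unfolding related_def by blast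
  then show "g ` J \<union> (A' - U') \<in> step_sets A' N'" unfolding step_sets_def by blast
next
  assume "g ` J \<union> (A' - U') \<in> step_sets A' N'"
  then obtain d' where d': "\<And>c. 0 \<le> d' c" "\<And>c. d' c \<le> N' c"
    and e: "\<forall>s. ind (g ` J \<union> (A' - U')) s = ind A' s + d' (s - 1) - d' s"
    unfolding step_sets_def by blast
  define d where "d c = (if \<exists>C\<in>Q. c \<in> Y C
     then let C = (THE C. C \<in> Q \<and> c \<in> Y C) in if rev C \<noteq> dual C then N c - d' (contmap C c) else d' (contmap C c)
     else 0)" for c
  have d_eq: "d c = (if rev C \<noteq> dual C then N c - d' (contmap C c) else d' (contmap C c))" if C: "C \<in> Q" "c \<in> Y C" for C c
  proof -
    have the: "(THE C'. C' \<in> Q \<and> c \<in> Y C') = C"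
    proof (rule the_equality)
      fix C' assume C': "C' \<in> Q \<and> c \<in> Y C'"
      then show "C' = C" using disj[of C C' c] C by (simp add: mem_steps_iff)
    qed (use C in blast)
    show ?thesis unfolding d_def the using C by (auto simp: Let_def)
  qed
  have "related d d'"
    unfolding related_def
  proof (intro conjI allI ballI)
    fix c show "0 \<le> d c" "d c \<le> N c"
    proof (atomize (full), cases "\<exists>C\<in>Q. c \<in> Y C")
      case True
      then obtain C where C: "C \<in> Q" "c \<in> Y C" by blast
      then have "N' (contmap C c) = N c" using N_eq by (simp add: contmap_def)
      then show "0 \<le> d c \<and> d c \<le> N c" using d_eq[OF C] d'[of "contmap C c"] by auto
    qed (use N_nonneg in \<open>auto simp: d_def\<close>)
  qed (use d' d_eq in auto)
  then have "(\<forall>c. 0 \<le> d c \<and> d c \<le> N c) \<and> (\<forall>s. ind (symdiff J D) s = ind A s + d (s - 1) - d s)"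
    using related_transfer[OF _ J] e unfolding related_def by blast
  then show "symdiff J D \<in> step_sets A N" unfolding step_sets_def by blast
qed

text \<open>Summed over \<open>D\<close>, the increments \<open>d (s - 1) - d s\<close> telescope to
  0, because the paths meet at both ends of a component.\<close>

lemma card_Int_D:
  assumes I: "I \<in> step_sets A N" and fin: "finite A" "finite U"
  shows "card (I \<inter> D) = card (A \<inter> D)"
proof -
  obtain d where d: "\<And>c. 0 \<le> d c" "\<And>c. d c \<le> N c" "\<And>s. ind I s = ind A s + d (s - 1) - d s"
    using I unfolding step_sets_def by blast
  \<comment> \<open>Both sums over \<open>D\<close> reduce to the sum of \<open>d\<close> over the
    contents \<open>Z\<close> of the dualised components.\<close>
  define Z where "Z = (\<Union>C\<in>{C \<in> Q. dual C}. Y C)"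
  have fD: "finite D" by (rule finite_subset[of _ "A \<union> U"]) (use fin in \<open>auto simp: D_def U_def\<close>)
  have ZD: "Z \<subseteq> D" "(\<lambda>c. c + 1) ` Z \<subseteq> D" by (auto simp: Z_def D_def mem_steps_iff)
  have z: "d s = 0" if "s \<in> D" "s \<notin> Z" for s
  proof (cases "s \<in> U")
    case True
    then obtain C where C: "C \<in> Q" "s \<in> steps (Y C)" by (auto simp: U_def)
    then show ?thesis using supp(2)[OF d(1,2) C] that mem_D_iff[OF C] by (auto simp: Z_def)
  qed (use supp(1)[OF d(1,2)] in blast)
  have z1: "d (s - 1) = 0" if "s \<in> D" "s \<notin> (\<lambda>c. c + 1) ` Z" for s
  proof (cases "s \<in> U")
    case True
    then obtain C where C: "C \<in> Q" "s \<in> steps (Y C)" by (auto simp: U_def)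
    have "s - 1 \<notin> Z" using that(2) by (metis add.commute add_diff_cancel_left' diff_add_cancel image_eqI)
    then show ?thesis using supp(3)[OF d(1,2) C] that mem_D_iff[OF C] C by (auto simp: Z_def)
  qed (use supp(1)[OF d(1,2)] in blast)
  have "(\<Sum>s\<in>D. d (s - 1)) = (\<Sum>s\<in>(\<lambda>c. c + 1) ` Z. d (s - 1))"
    by (rule sum.mono_neutral_right[OF fD ZD(2)]) (use z1 in auto)
  also have "\<dots> = (\<Sum>c\<in>Z. d c)" by (subst sum.reindex) (auto simp: inj_on_def)
  also have "\<dots> = (\<Sum>s\<in>D. d s)" by (rule sum.mono_neutral_left[OF fD ZD(1)]) (use z in auto)
  finally have "(\<Sum>s\<in>D. ind I s) = (\<Sum>s\<in>D. ind A s)" by (simp add: d(3) sum.distrib sum_subtractf)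
  moreover have "(\<Sum>s\<in>D. ind X s) = int (card (X \<inter> D))" for X
    using fD by (simp add: ind_def of_bool_def sum.If_cases Int_commute)
  ultimately show ?thesis by simp
qed

end

section \<open>From box posets to matchings\<close>

text \<open>The four admissible placements: \<open>sw\<close> transposes and \<open>op\<close> rotates by 180 degrees.\<close>

definition place :: "bool \<Rightarrow> bool \<Rightarrow> int \<Rightarrow> int \<Rightarrow> box \<Rightarrow> box" where
  "place sw op p q x = (let y = shift_flip sw p q x in if op then (- fst y, - snd y) else y)"

lemma inj_place: "inj (place sw op p q)"
  by (rule injI) (auto simp: place_def shift_flip_def Let_def prod_eq_iff split: if_splits)

text \<open>This is the constant in the affine action of a placement on contents: the translation
  contributes \<open>p\<close> and \<open>q\<close>, the two normalisations of content contribute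
  \<open>m\<close> and \<open>m'\<close>.\<close>

definition place_shift :: "bool \<Rightarrow> bool \<Rightarrow> int \<Rightarrow> int \<Rightarrow> int \<Rightarrow> int \<Rightarrow> int" where
  "place_shift sw op p q m m' = (if op then p - q else q - p) + m' + (if sw \<noteq> op then m else - m)"

lemma content_place:
  "box_content m' (place sw op p q x) =
    (if sw \<noteq> op then place_shift sw op p q m m' - box_content m x else box_content m x + place_shift sw op p q m m')"
  by (auto simp: box_content_def place_def shift_flip_def Let_def place_shift_def)

lemma left_of_place:
  "(fst (place sw op p q x), snd (place sw op p q x) - 1) = place sw op p q
    (if sw then (if op then (fst x + 1, snd x) else (fst x - 1, snd x))
     else (if op then (fst x, snd x + 1) else (fst x, snd x - 1)))"
  by (auto simp: place_def shift_flip_def Let_def)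

lemma square_closed_adj_closed:
  assumes "adj_closed_in \<Theta> C" "square_closed \<Theta>"
  shows "square_closed C"
  unfolding square_closed_def
proof (intro allI impI, elim conjE)
  fix i j assume h: "(i, j) \<in> C" "(i + 1, j + 1) \<in> C"
  then have "(i + 1, j) \<in> \<Theta>" "(i, j + 1) \<in> \<Theta>"
    using assms unfolding adj_closed_in_def square_closed_def by blast+
  moreover have "cov (i, j) (i + 1, j)" "cov (i, j) (i, j + 1)" by (simp_all add: cov_def)
  ultimately show "(i + 1, j) \<in> C \<and> (i, j + 1) \<in> C"
    using assms(1) h unfolding adj_closed_in_def by blast
qed

text \<open>A vertical step of the upper path is a box without left neighbour. Pulled back through
  the placement, "left" becomes left, right, above or below, which selects one of the four
  descriptions of the boundary of \<open>C\<close>.\<close>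

lemma mem_A_place:
  assumes S: "skew_shape m n a b" and S': "skew_shape m' n' a' b'"
    and C: "adj_closed_in (skew_shape.boxes m a b) C"
    and C': "adj_closed_in (skew_shape.boxes m' a' b') C'" "C' = place sw op p q ` C"
    and s: "s \<in> steps (box_content m ` C)"
  defines "k \<equiv> place_shift sw op p q m m'"
  shows "(if sw \<noteq> op then k + 1 - s else s + k) \<in> skew_shape.A m' a' \<longleftrightarrow>
    sw \<noteq> (s \<in> (if op then skew_shape.B m b else skew_shape.A m a))"
proof -
  interpret S: skew_shape m n a b by fact
  interpret S': skew_shape m' n' a' b' by fact
  let ?s' = "if sw \<noteq> op then k + 1 - s else s + k"
  let ?nb = "\<lambda>x. if sw then (if op then (fst x + 1, snd x) else (fst x - 1, snd x))
     else (if op then (fst x, snd x + 1) else (fst x, snd x - 1))"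
  \<comment> \<open>The content of the preimage box: solving \<open>k - c = k + 1 - s\<close> gives
    \<open>s - 1\<close> when contents are reversed, and \<open>c + k = s + k\<close> gives
    \<open>s\<close> otherwise.\<close>
  let ?t = "if sw \<noteq> op then s - 1 else s"
  have img: "box_content m' ` C' = (\<lambda>c. if sw \<noteq> op then k - c else c + k) ` box_content m ` C"
    unfolding C'(2) image_image content_place[of m' sw op p q _ m] k_def by simp
  have s': "?s' \<in> steps (box_content m' ` C')"
    using s unfolding mem_steps_iff img by (cases "sw \<noteq> op") (auto simp: image_iff, force+)
  have "?s' \<in> S'.A \<longleftrightarrow> (\<exists>x\<in>C'. box_content m' x = ?s' \<and> (fst x, snd x - 1) \<notin> C')"
    by (rule S'.mem_A_iff[OF C'(1) s'])
  also have "\<dots> \<longleftrightarrow> (\<exists>x\<in>C. box_content m' (place sw op p q x) = ?s' \<and> ?nb x \<notin> C)"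
    unfolding C'(2) bex_simps(7) left_of_place inj_image_mem_iff[OF inj_place] ..
  also have "\<dots> \<longleftrightarrow> (\<exists>x\<in>C. box_content m x = ?t \<and> ?nb x \<notin> C)"
    unfolding content_place[of m' sw op p q _ m] k_def by (intro bex_cong refl conj_cong) auto
  also have "\<dots> \<longleftrightarrow> sw \<noteq> (s \<in> (if op then S.B else S.A))"
    using S.mem_A_iff[OF C s] S.not_mem_A_iff[OF C s] S.mem_B_iff[OF C s] S.not_mem_B_iff[OF C s]
    by (cases sw; cases op) auto
  finally show ?thesis .
qed

section \<open>Components of the box poset\<close>

definition emb :: "nat \<times> nat \<Rightarrow> box" where "emb x = (int (fst x), int (snd x))"

lemma inj_emb: "inj emb"
  by (rule injI) (auto simp: emb_def prod_eq_iff)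

lemma box_cover_iff: "(x, y) \<in> box_cover \<theta> \<longleftrightarrow> x \<in> \<theta> \<and> y \<in> \<theta> \<and> cov (emb x) (emb y)"
  by (cases x; cases y) (auto simp: box_cover_def cov_def emb_def)

text \<open>A height function: coverings raise it by exactly one, so nothing fits strictly between
  adjacent boxes.\<close>

definition rank :: "nat \<times> nat \<Rightarrow> nat" where "rank x = fst x + snd x"

lemma box_cover_rank: "(x, y) \<in> box_cover \<theta> \<Longrightarrow> rank y = rank x + 1"
  by (auto simp: box_cover_def rank_def)

lemma box_cover_rtrancl_rank:
  "(x, y) \<in> (box_cover \<theta>)\<^sup>* \<Longrightarrow> x = y \<or> rank x < rank y"
  by (induction rule: rtrancl_induct) (auto dest: box_cover_rank)

abbreviation box_link :: "(nat \<times> nat) set \<Rightarrow> ((nat \<times> nat) \<times> (nat \<times> nat)) set" where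
  "box_link \<theta> \<equiv> (box_cover \<theta> \<union> (box_cover \<theta>)\<inverse>)\<^sup>*"

text \<open>Every comparability is a chain of adjacent boxes, so the order components are connected
  by adjacency as well.\<close>

lemma box_order_link: "(box_order \<theta> \<union> (box_order \<theta>)\<inverse>)\<^sup>* \<subseteq> box_link \<theta>"
proof -
  have "box_order \<theta> \<subseteq> box_link \<theta>" unfolding box_order_def by (auto intro: in_rtrancl_UnI)
  moreover have "(box_order \<theta>)\<inverse> \<subseteq> box_link \<theta>"
  proof -
    have "(box_order \<theta>)\<inverse> \<subseteq> ((box_cover \<theta>)\<inverse>)\<^sup>*" unfolding box_order_def rtrancl_converse by auto
    then show ?thesis by (auto intro: in_rtrancl_UnI)
  qed
  ultimately have "box_order \<theta> \<union> (box_order \<theta>)\<inverse> \<subseteq> box_link \<theta>" by blast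
  then show ?thesis by (metis rtrancl_idemp rtrancl_mono)
qed

lemma box_cover_order: "box_cover \<theta> \<subseteq> box_order \<theta>"
  unfolding box_order_def by (auto simp: box_cover_iff)

lemma component_equiv: "equiv \<theta> (Restr ((box_order \<theta> \<union> (box_order \<theta>)\<inverse>)\<^sup>*) \<theta>)"
proof (rule equivI)
  show "refl_on \<theta> (Restr ((box_order \<theta> \<union> (box_order \<theta>)\<inverse>)\<^sup>*) \<theta>)" by (auto simp: refl_on_def)
  have "sym ((box_order \<theta> \<union> (box_order \<theta>)\<inverse>)\<^sup>*)"
    by (rule sym_rtrancl) (auto simp: sym_def)
  then show "sym (Restr ((box_order \<theta> \<union> (box_order \<theta>)\<inverse>)\<^sup>*) \<theta>)" by (auto simp: sym_def)
  show "trans (Restr ((box_order \<theta> \<union> (box_order \<theta>)\<inverse>)\<^sup>*) \<theta>)"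
    by (rule transI) (auto intro: rtrancl_trans)
qed auto

lemma component_props:
  assumes C: "C \<in> components \<theta> (box_order \<theta>)"
  shows "C \<subseteq> \<theta>" and "C \<noteq> {}"
    and "\<And>x y. x \<in> C \<Longrightarrow> (x, y) \<in> box_cover \<theta> \<or> (y, x) \<in> box_cover \<theta> \<Longrightarrow> y \<in> C"
    and "\<And>x y. x \<in> C \<Longrightarrow> y \<in> C \<Longrightarrow> (x, y) \<in> box_link \<theta>"
proof -
  let ?E = "Restr ((box_order \<theta> \<union> (box_order \<theta>)\<inverse>)\<^sup>*) \<theta>"
  have C': "C \<in> \<theta> // ?E" using C by (simp add: components_def)
  note eq = component_equiv[of \<theta>]
  show sub: "C \<subseteq> \<theta>" using in_quotient_imp_subset[OF eq C'] .
  show "C \<noteq> {}" using in_quotient_imp_non_empty[OF eq C'] .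
  show "y \<in> C" if "x \<in> C" "(x, y) \<in> box_cover \<theta> \<or> (y, x) \<in> box_cover \<theta>" for x y
  proof -
    have "x \<in> \<theta>" "y \<in> \<theta>" using that by (auto simp: box_cover_iff)
    moreover have "(x, y) \<in> box_order \<theta> \<union> (box_order \<theta>)\<inverse>" using that(2) box_cover_order[of \<theta>] by blast
    ultimately have "(x, y) \<in> ?E" by blast
    then show ?thesis using in_quotient_imp_closed[OF eq C' that(1)] by blast
  qed
  show "(x, y) \<in> box_link \<theta>" if "x \<in> C" "y \<in> C" for x y
    using in_quotient_imp_in_rel[OF eq C', of x y] that box_order_link[of \<theta>] by blast
qed

lemma component_adj_closed:
  assumes C: "C \<in> components \<theta> (box_order \<theta>)"
  shows "adj_closed_in (emb ` \<theta>) (emb ` C)"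
  unfolding adj_closed_in_def
proof (intro conjI ballI impI)
  show "emb ` C \<subseteq> emb ` \<theta>" using component_props(1)[OF C] by blast
  fix u v assume "u \<in> emb ` C" "v \<in> emb ` \<theta>" "cov u v \<or> cov v u"
  then obtain x y where "x \<in> C" "y \<in> \<theta>" "u = emb x" "v = emb y" "cov (emb x) (emb y) \<or> cov (emb y) (emb x)" by blast
  then show "v \<in> emb ` C" using component_props(1)[OF C] component_props(3)[OF C, of x y]
    unfolding box_cover_iff by blast
qed

lemma component_connected:
  assumes C: "C \<in> components \<theta> (box_order \<theta>)"
  shows "cov_connected (emb ` C)"
  unfolding cov_connected_def
proof (intro ballI)
  let ?R = "{(u, v). u \<in> emb ` C \<and> v \<in> emb ` C \<and> (cov u v \<or> cov v u)}"
  fix u v assume "u \<in> emb ` C" "v \<in> emb ` C"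
  then obtain x y where x: "x \<in> C" "y \<in> C" "u = emb x" "v = emb y" by blast
  have "(x, y) \<in> box_link \<theta>" by (rule component_props(4)[OF C x(1,2)])
  then have "y \<in> C \<and> (emb x, emb y) \<in> ?R\<^sup>*"
  proof (induction rule: rtrancl_induct)
    case (step y z)
    have z: "z \<in> C" using component_props(3)[OF C] step by blast
    have "(emb y, emb z) \<in> ?R" using step z by (auto simp: box_cover_iff)
    then show ?case using step z by (meson rtrancl.rtrancl_into_rtrancl)
  qed (use x in auto)
  then show "(u, v) \<in> ?R\<^sup>*" using x by simp
qed

text \<open>Adjacency is the covering relation of the order restricted to the component, so every
  isomorphism preserves it and every anti-isomorphism reverses it.\<close>

lemma cover_iff_order:
  assumes C: "C \<in> components \<theta> (box_order \<theta>)" and x: "x \<in> C" and y: "y \<in> C"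
  defines "r \<equiv> Restr (box_order \<theta>) C"
  shows "cov (emb x) (emb y) \<longleftrightarrow> (x, y) \<in> r \<and> x \<noteq> y \<and> (\<forall>z\<in>C. (x, z) \<in> r \<and> (z, y) \<in> r \<longrightarrow> z = x \<or> z = y)"
proof
  have xy: "x \<in> \<theta>" "y \<in> \<theta>" using component_props(1)[OF C] x y by auto
  assume "cov (emb x) (emb y)"
  then have c: "(x, y) \<in> box_cover \<theta>" using xy by (simp add: box_cover_iff)
  have "z = x \<or> z = y" if "(x, z) \<in> r" "(z, y) \<in> r" for z
  proof -
    have "x = z \<or> rank x < rank z" "z = y \<or> rank z < rank y"
      using that box_cover_rtrancl_rank unfolding r_def box_order_def by blast+
    then show ?thesis using box_cover_rank[OF c] by auto
  qed
  moreover have "(x, y) \<in> r" using c box_cover_order x y by (auto simp: r_def)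
  moreover have "x \<noteq> y" using box_cover_rank[OF c] by auto
  ultimately show "(x, y) \<in> r \<and> x \<noteq> y \<and> (\<forall>z\<in>C. (x, z) \<in> r \<and> (z, y) \<in> r \<longrightarrow> z = x \<or> z = y)" by blast
next
  have xy: "x \<in> \<theta>" "y \<in> \<theta>" using component_props(1)[OF C] x y by auto
  assume h: "(x, y) \<in> r \<and> x \<noteq> y \<and> (\<forall>z\<in>C. (x, z) \<in> r \<and> (z, y) \<in> r \<longrightarrow> z = x \<or> z = y)"
  then have "(x, y) \<in> (box_cover \<theta>)\<^sup>*" by (auto simp: r_def box_order_def)
  then obtain z where z: "(x, z) \<in> box_cover \<theta>" "(z, y) \<in> (box_cover \<theta>)\<^sup>*"
    using h by (metis converse_rtranclE)
  have zC: "z \<in> C" using component_props(3)[OF C x] z(1) by blast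
  have "(x, z) \<in> r" using z(1) box_cover_order zC x by (auto simp: r_def)
  moreover have "(z, y) \<in> r" using z zC y xy component_props(1)[OF C] by (auto simp: r_def box_order_def)
  moreover have "z \<noteq> x" using box_cover_rank[OF z(1)] by auto
  ultimately have "z = y" using h zC by blast
  then show "cov (emb x) (emb y)" using z(1) by (simp add: box_cover_iff)
qed

text \<open>An anti-isomorphism followed by a point reflection preserves adjacency with its
  direction, so rigidity applies to both cases at once.\<close>

lemma component_placement:
  assumes C: "C \<in> components \<theta> (box_order \<theta>)" and C': "C' \<in> components \<theta>' (box_order \<theta>')"
    and sq: "square_closed (emb ` \<theta>)" "square_closed (emb ` \<theta>')"
    and iso: "poset_isomorphic C (Restr (box_order \<theta>) C) C' (Restr (box_order \<theta>') C') \<or>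
      poset_isomorphic C ((Restr (box_order \<theta>) C)\<inverse>) C' (Restr (box_order \<theta>') C')"
  shows "\<exists>sw op p q. emb ` C' = place sw op p q ` emb ` C"
proof -
  let ?r = "Restr (box_order \<theta>) C" and ?r' = "Restr (box_order \<theta>') C'"
  obtain op h where h: "bij_betw h C C'"
    and ord: "\<And>x y. x \<in> C \<Longrightarrow> y \<in> C \<Longrightarrow> (x, y) \<in> (if op then ?r\<inverse> else ?r) \<longleftrightarrow> (h x, h y) \<in> ?r'"
  proof -
    from iso show thesis
    proof
      assume "poset_isomorphic C ?r C' ?r'"
      then show thesis using that[where op = False] unfolding poset_isomorphic_def by auto
    next
      assume "poset_isomorphic C (?r\<inverse>) C' ?r'"
      then show thesis using that[where op = True] unfolding poset_isomorphic_def by auto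
    qed
  qed
  have hC: "h ` C = C'" and hinj: "inj_on h C" using h by (auto simp: bij_betw_def)
  have cov_h: "cov (emb (h x)) (emb (h y)) \<longleftrightarrow> (if op then cov (emb y) (emb x) else cov (emb x) (emb y))"
    if x: "x \<in> C" and y: "y \<in> C" for x y
  proof -
    have hx: "h x \<in> C'" "h y \<in> C'" using x y hC by auto
    have "cov (emb (h x)) (emb (h y)) \<longleftrightarrow> (h x, h y) \<in> ?r' \<and> h x \<noteq> h y \<and>
        (\<forall>z\<in>C. (h x, h z) \<in> ?r' \<and> (h z, h y) \<in> ?r' \<longrightarrow> h z = h x \<or> h z = h y)"
      unfolding cover_iff_order[OF C' hx] by (simp add: hC[symmetric])
    also have "\<dots> \<longleftrightarrow> (x, y) \<in> (if op then ?r\<inverse> else ?r) \<and> x \<noteq> y \<and>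
        (\<forall>z\<in>C. (x, z) \<in> (if op then ?r\<inverse> else ?r) \<and> (z, y) \<in> (if op then ?r\<inverse> else ?r) \<longrightarrow> z = x \<or> z = y)"
      using ord x y inj_on_eq_iff[OF hinj] by auto
    also have "\<dots> \<longleftrightarrow> (if op then cov (emb y) (emb x) else cov (emb x) (emb y))"
      using cover_iff_order[OF C x y] cover_iff_order[OF C y x] by auto
    finally show ?thesis .
  qed
  \<comment> \<open>The reflection in the origin if \<open>op\<close> holds, and the identity
    otherwise; it is its own inverse and preserves \<open>square_closed\<close>.\<close>
  define sg :: "box \<Rightarrow> box" where "sg x = (if op then (- fst x, - snd x) else x)" for x
  have sg_sg: "sg (sg x) = x" for x by (simp add: sg_def)
  have sg_inj: "inj sg" by (metis injI sg_sg)
  have cov_sg: "cov (sg x) (sg y) \<longleftrightarrow> (if op then cov y x else cov x y)" for x y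
    by (cases x; cases y) (auto simp: cov_def sg_def)
  define \<phi> where "\<phi> u = sg (emb (h (inv_into UNIV emb u)))" for u
  have \<phi>_emb: "\<phi> (emb x) = sg (emb (h x))" for x by (simp add: \<phi>_def inv_f_f[OF inj_emb])
  have "inj_on \<phi> (emb ` C)"
  proof (rule inj_onI)
    fix u v assume "u \<in> emb ` C" "v \<in> emb ` C" "\<phi> u = \<phi> v"
    then show "u = v" using hinj inj_emb sg_inj by (auto simp: \<phi>_emb inj_eq inj_on_eq_iff)
  qed
  then have bij: "bij_betw \<phi> (emb ` C) (sg ` emb ` C')"
    by (simp add: bij_betw_def image_image \<phi>_emb hC[symmetric])
  have sqC: "square_closed (emb ` C)" by (rule square_closed_adj_closed[OF component_adj_closed[OF C] sq(1)])
  have sqC': "square_closed (emb ` C')" by (rule square_closed_adj_closed[OF component_adj_closed[OF C'] sq(2)])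
  have mem_sg: "x \<in> sg ` X \<longleftrightarrow> sg x \<in> X" for x X using sg_sg by (metis imageE imageI)
  have sqsg: "square_closed (sg ` emb ` C')"
  proof (cases op)
    case True
    show ?thesis unfolding square_closed_def mem_sg
    proof (intro allI impI, elim conjE)
      fix i j assume "sg (i, j) \<in> emb ` C'" "sg (i + 1, j + 1) \<in> emb ` C'"
      then have "(- i - 1 + 1, - j - 1 + 1) \<in> emb ` C'" "(- i - 1, - j - 1) \<in> emb ` C'"
        using True by (simp_all add: sg_def)
      then have "(- i - 1 + 1, - j - 1) \<in> emb ` C' \<and> (- i - 1, - j - 1 + 1) \<in> emb ` C'"
        using sqC' unfolding square_closed_def by blast
      then show "sg (i + 1, j) \<in> emb ` C' \<and> sg (i, j + 1) \<in> emb ` C'" using True by (simp add: sg_def)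
    qed
  next
    case False
    then have "sg ` emb ` C' = emb ` C'" by (simp add: sg_def)
    then show ?thesis using sqC' by simp
  qed
  have "\<exists>sw p q. \<forall>x\<in>emb ` C. \<phi> x = shift_flip sw p q x"
  proof (rule cov_isomorphism_rigid[OF sqC sqsg component_connected[OF C] bij])
    fix u v assume "u \<in> emb ` C" "v \<in> emb ` C"
    then obtain x y where xy: "x \<in> C" "y \<in> C" "u = emb x" "v = emb y" by blast
    show "cov u v \<longleftrightarrow> cov (\<phi> u) (\<phi> v)"
      unfolding xy(3,4) \<phi>_emb cov_sg using cov_h[OF xy(1,2)] cov_h[OF xy(2,1)] by simp
  qed
  then obtain sw p q where sf: "\<And>x. x \<in> emb ` C \<Longrightarrow> \<phi> x = shift_flip sw p q x" by blast
  have "emb ` C' = sg ` \<phi> ` emb ` C"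
    using bij by (simp add: bij_betw_def image_image sg_sg)
  also have "\<dots> = place sw op p q ` emb ` C"
    unfolding image_image[of sg] by (rule image_cong) (simp_all add: sf place_def sg_def Let_def)
  finally show ?thesis by blast
qed

lemma matching_of_semi_isomorphic:
  assumes S: "skew_shape m n a b" and S': "skew_shape m' n' a' b'"
    and \<theta>: "emb ` \<theta> = skew_shape.boxes m a b" and \<theta>': "emb ` \<theta>' = skew_shape.boxes m' a' b'"
    and semi: "semi_isomorphic \<theta> (box_order \<theta>) \<theta>' (box_order \<theta>')"
  shows "\<exists>(Q :: (nat \<times> nat) set set) Y Y' rev dual k. matching Q Y Y' rev dual k
    (skew_shape.A m a) (skew_shape.B m b) (skew_shape.A m' a') (skew_shape.N m a b) (skew_shape.N m' a' b')"
proof -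
  interpret S: skew_shape m n a b by fact
  interpret S': skew_shape m' n' a' b' by fact
  let ?Q = "components \<theta> (box_order \<theta>)" and ?Q' = "components \<theta>' (box_order \<theta>')"
  obtain f where f: "bij_betw f ?Q ?Q'" and iso: "\<And>C. C \<in> ?Q \<Longrightarrow>
        poset_isomorphic C (Restr (box_order \<theta>) C) (f C) (Restr (box_order \<theta>') (f C)) \<or>
        poset_isomorphic C ((Restr (box_order \<theta>) C)\<inverse>) (f C) (Restr (box_order \<theta>') (f C))"
    using semi unfolding semi_isomorphic_def by blast
  have fQ: "f C \<in> ?Q'" if "C \<in> ?Q" for C using f that by (auto simp: bij_betw_def)
  have finj: "C = D" if "C \<in> ?Q" "D \<in> ?Q" "f C = f D" for C D using f that by (auto simp: bij_betw_def inj_on_def)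
  have sq: "square_closed (emb ` \<theta>)" "square_closed (emb ` \<theta>')"
    unfolding \<theta> \<theta>' by (rule S.square_closed_boxes S'.square_closed_boxes)+
  have "\<exists>sw op p q. emb ` f C = place sw op p q ` emb ` C" if "C \<in> ?Q" for C
    by (rule component_placement[OF that fQ[OF that] sq iso[OF that]])
  then obtain sw op p q where pl: "\<And>C. C \<in> ?Q \<Longrightarrow> emb ` f C = place (sw C) (op C) (p C) (q C) ` emb ` C"
    by metis
  define k where "k C = place_shift (sw C) (op C) (p C) (q C) m m'" for C
  define Y where "Y C = box_content m ` emb ` C" for C
  define Y' where "Y' C = box_content m' ` emb ` f C" for C
  have adj: "adj_closed_in S.boxes (emb ` C)" if "C \<in> ?Q" for C
    using component_adj_closed[OF that] by (simp add: \<theta>)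
  have adj': "adj_closed_in S'.boxes (emb ` C)" if "C \<in> ?Q'" for C
    using component_adj_closed[OF that] by (simp add: \<theta>')
  \<comment> \<open>Stated for an arbitrary shape, since it is needed for the components of both
    diagrams.\<close>
  have disj: "C = D" if CD: "C \<in> components \<eta> (box_order \<eta>)" "D \<in> components \<eta> (box_order \<eta>)"
      and SS: "skew_shape l l0 c d" "emb ` \<eta> = skew_shape.boxes l c d"
      and s: "s \<in> steps (box_content l ` emb ` C)" "s \<in> steps (box_content l ` emb ` D)" for C D \<eta> l l0 c d s
  proof -
    interpret T: skew_shape l l0 c d by fact
    obtain y where y: "y \<in> emb ` D" "box_content l y = s \<or> box_content l y = s - 1"
      using s(2) unfolding mem_steps_iff by force
    have "y \<in> T.boxes" using y(1) component_props(1)[OF CD(2)] SS(2) by blast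
    then have "y \<in> emb ` C"
      using T.steps_same_component[OF _ s(1) _ y(2)] component_adj_closed[OF CD(1)] SS(2) by simp
    then have "C \<inter> D \<noteq> {}" using y(1) inj_emb by (auto simp: inj_eq)
    then show ?thesis
      using quotient_disj[OF component_equiv] CD unfolding components_def by blast
  qed
  have cover: "\<exists>C\<in>components \<eta> (box_order \<eta>). x \<in> C" if "x \<in> \<eta>" for x \<eta>
    using Union_quotient[OF component_equiv[of \<eta>]] that unfolding components_def by blast
  \<comment> \<open>Transposition and rotation each reverse the contents, so \<open>rev\<close> is
    \<open>sw C \<noteq> op C\<close>. Only transposition exchanges horizontal and vertical steps,
    so \<open>dual\<close> is \<open>sw\<close>; then \<open>rev\<close> and \<open>dual\<close>
    differ exactly when \<open>op\<close> holds.\<close>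
  have "matching ?Q Y Y' (\<lambda>C. sw C \<noteq> op C) sw k S.A S.B S'.A S.N S'.N"
  proof
    fix C assume C: "C \<in> ?Q"
    show Y'_eq: "Y' C = (\<lambda>c. if sw C \<noteq> op C then k C - c else c + k C) ` Y C"
      unfolding Y'_def Y_def pl[OF C] image_image content_place[of m' _ _ _ _ _ m] k_def ..
    {
      fix D s assume D: "D \<in> ?Q"
      show "C = D" if "s \<in> steps (Y C)" "s \<in> steps (Y D)"
        using disj[OF C D S \<theta>] that by (simp add: Y_def)
      show "C = D" if "s \<in> steps (Y' C)" "s \<in> steps (Y' D)"
        using finj[OF C D disj[OF fQ[OF C] fQ[OF D] S' \<theta>']] that by (simp add: Y'_def)
    }
    show "0 < S.N c" if c: "c \<in> Y C" for c
    proof -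
      obtain x where "x \<in> emb ` C" "box_content m x = c" using c unfolding Y_def by blast
      then have "x \<in> {x \<in> S.boxes. box_content m x = c}" using adj[OF C] unfolding adj_closed_in_def by blast
      then show ?thesis using S.finite_content[of c] unfolding S.N_def of_nat_0_less_iff card_gt_0_iff by blast
    qed
    show "S'.N (if sw C \<noteq> op C then k C - c else c + k C) = S.N c" if c: "c \<in> Y C" for c
    proof -
      let ?c' = "if sw C \<noteq> op C then k C - c else c + k C"
      let ?pl = "place (sw C) (op C) (p C) (q C)"
      \<comment> \<open>A diagonal that meets \<open>C\<close> lies in \<open>C\<close> entirely, so
        \<open>N\<close> counts boxes of one component, and the injective placement preserves this
        number.\<close>
      have 1: "{x \<in> S.boxes. box_content m x = c} = {x \<in> emb ` C. box_content m x = c}"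
        using S.steps_same_component[OF adj[OF C], of c] c adj[OF C]
        unfolding Y_def mem_steps_iff adj_closed_in_def by blast
      have c': "?c' \<in> box_content m' ` emb ` f C" using Y'_eq c unfolding Y'_def by blast
      have 2: "{x \<in> S'.boxes. box_content m' x = ?c'} = {x \<in> emb ` f C. box_content m' x = ?c'}"
        using S'.steps_same_component[OF adj'[OF fQ[OF C]], of ?c'] c' adj'[OF fQ[OF C]]
        unfolding mem_steps_iff adj_closed_in_def by blast
      have "{x \<in> emb ` f C. box_content m' x = ?c'} = ?pl ` {x \<in> emb ` C. box_content m x = c}"
        unfolding pl[OF C] by (auto simp: content_place[of m' _ _ _ _ _ m] k_def split: if_splits)
      then have "card {x \<in> emb ` f C. box_content m' x = ?c'} = card {x \<in> emb ` C. box_content m x = c}"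
        by (simp add: card_image[OF inj_on_subset[OF inj_place]])
      then show ?thesis unfolding S.N_def S'.N_def 1 2 by simp
    qed
    show "(if sw C \<noteq> op C then k C + 1 - s else s + k C) \<in> S'.A \<longleftrightarrow>
        sw C \<noteq> (s \<in> (if (sw C \<noteq> op C) \<noteq> sw C then S.B else S.A))" if "s \<in> steps (Y C)" for s
    proof -
      have e: "(sw C \<noteq> op C) \<noteq> sw C \<longleftrightarrow> op C" by blast
      show ?thesis unfolding e k_def
        by (rule mem_A_place[OF S S' adj[OF C] adj'[OF fQ[OF C]] pl[OF C]]) (use that in \<open>simp add: Y_def\<close>)
    qed
  next
    fix c
    show "0 \<le> S.N c" "0 \<le> S'.N c" by (rule S.N_nonneg S'.N_nonneg)+
    show "\<exists>C\<in>?Q. c \<in> Y C" if "S.N c \<noteq> 0"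
    proof -
      have "c \<in> box_content m ` emb ` \<theta>" unfolding \<theta> by (rule ccontr) (use S.N_eq_0[of c] that in simp)
      then obtain x where x: "x \<in> \<theta>" "c = box_content m (emb x)" by blast
      then obtain C where "C \<in> ?Q" "x \<in> C" using cover by blast
      then show ?thesis using x(2) unfolding Y_def by blast
    qed
    show "\<exists>C\<in>?Q. c \<in> Y' C" if "S'.N c \<noteq> 0"
    proof -
      have "c \<in> box_content m' ` emb ` \<theta>'" unfolding \<theta>' by (rule ccontr) (use S'.N_eq_0[of c] that in simp)
      then obtain x where x: "x \<in> \<theta>'" "c = box_content m' (emb x)" by blast
      then obtain C' where C': "C' \<in> ?Q'" "x \<in> C'" using cover by blast
      then obtain C where "C \<in> ?Q" "C' = f C" using bij_betw_imp_surj_on[OF f] by blast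
      then show ?thesis using x C' unfolding Y'_def by blast
    qed
    show "ind S.B c = ind S.A c + S.N (c - 1) - S.N c" by (rule S.ind_B)
  qed
  then show ?thesis by blast
qed

section \<open>Richardson varieties of semi-isomorphic skew shapes\<close>

text \<open>The integer version of the index that bounds the coordinate subspace in the Schubert
  conditions; on the lattice path it is the position of the vertical step in row
  \<open>i\<close>.\<close>

definition row_end :: "nat \<Rightarrow> (nat \<Rightarrow> nat) \<Rightarrow> int \<Rightarrow> int" where
  "row_end m lam i = int (lam (nat i)) + int m - i + 1"

lemma skew_shape_row_end:
  assumes mn: "m \<le> n" and lam: "partition_in_box m (n - m) lam" and mu: "partition_in_box m (n - m) mu"
    and sub: "young_diagram m lam \<subseteq> young_diagram m (dual_partition m (n - m) mu)"
  shows "skew_shape (int m) (int n) (row_end m lam) (row_end m (dual_partition m (n - m) mu))"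
proof -
  let ?nu = "dual_partition m (n - m) mu"
  have le: "lam i \<le> ?nu i" if "i \<in> {1..m}" for i
  proof (cases "lam i = 0")
    case False
    then have "(i, lam i) \<in> young_diagram m lam" using that by (auto simp: young_diagram_def)
    then have "(i, lam i) \<in> young_diagram m ?nu" using sub by blast
    then show ?thesis by (simp add: young_diagram_def)
  qed simp
  have nu_anti: "?nu j \<le> ?nu i" if "i \<in> {1..m}" "j \<in> {1..m}" "i \<le> j" for i j
  proof -
    have "m + 1 - j \<in> {1..m}" "m + 1 - i \<in> {1..m}" "m + 1 - j \<le> m + 1 - i" using that by auto
    then have "mu (m + 1 - i) \<le> mu (m + 1 - j)"
      using mu unfolding partition_in_box_def by blast
    then show ?thesis by (simp add: dual_partition_def)
  qed
  have lam_anti: "lam j \<le> lam i" if "i \<in> {1..m}" "j \<in> {1..m}" "i \<le> j" for i j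
    using lam that unfolding partition_in_box_def by blast
  have nat_mem: "nat i \<in> {1..m}" if "1 \<le> i" "i \<le> int m" for i using that by auto
  show ?thesis
  proof
    fix i j :: int assume ij: "1 \<le> i" "i < j" "j \<le> int m"
    then have "nat i \<in> {1..m}" "nat j \<in> {1..m}" "nat i \<le> nat j" by auto
    then have "lam (nat j) \<le> lam (nat i)" "?nu (nat j) \<le> ?nu (nat i)" by (auto intro: lam_anti nu_anti)
    then show "row_end m lam j < row_end m lam i" "row_end m ?nu j < row_end m ?nu i"
      using ij by (simp_all add: row_end_def)
  next
    fix i :: int assume i: "1 \<le> i" "i \<le> int m"
    show "1 \<le> row_end m lam i" using i by (simp add: row_end_def)
    show "row_end m lam i \<le> row_end m ?nu i" using le[OF nat_mem[OF i]] by (simp add: row_end_def)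
    have "int (?nu (nat i)) \<le> int n - int m" using mn by (simp add: dual_partition_def)
    then show "row_end m ?nu i \<le> int n" using i unfolding row_end_def by linarith
  qed simp
qed

lemma emb_skew_diagram:
  assumes S: "skew_shape (int m) (int n) (row_end m lam) (row_end m (dual_partition m (n - m) mu))"
  shows "emb ` skew_diagram m n lam mu =
    skew_shape.boxes (int m) (row_end m lam) (row_end m (dual_partition m (n - m) mu))"
proof -
  interpret S: skew_shape "int m" "int n" "row_end m lam" "row_end m (dual_partition m (n - m) mu)" by fact
  let ?nu = "dual_partition m (n - m) mu"
  have skew: "(i, j) \<in> skew_diagram m n lam mu \<longleftrightarrow> 1 \<le> i \<and> i \<le> m \<and> lam i < j \<and> j \<le> ?nu i" for i j
    by (auto simp: skew_diagram_def young_diagram_def)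
  have box: "(int i, int j) \<in> S.boxes \<longleftrightarrow> (i, j) \<in> skew_diagram m n lam mu" for i j
    unfolding S.mem_boxes_iff skew row_end_def by auto
  show ?thesis
  proof (intro equalityI subsetI)
    fix x assume "x \<in> emb ` skew_diagram m n lam mu"
    then show "x \<in> S.boxes" using box by (auto simp: emb_def)
  next
    fix x assume x: "x \<in> S.boxes"
    obtain i j where ij: "x = (i, j)" by (cases x)
    have "0 \<le> i" "0 \<le> j" using x unfolding ij S.mem_boxes_iff row_end_def by auto
    then obtain i' j' where e: "x = (int i', int j')" using ij by (metis zero_le_imp_eq_int)
    then have "(i', j') \<in> skew_diagram m n lam mu" using x box by blast
    moreover have "x = emb (i', j')" by (simp add: e emb_def)
    ultimately show "x \<in> emb ` skew_diagram m n lam mu" by blast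
  qed
qed

lemma richardson_index_iff:
  assumes S: "skew_shape (int m) (int n) (row_end m lam) (row_end m nu)"
  shows "I \<in> richardson_index m n (\<lambda>i. lam i + m - i + 1) (\<lambda>i. nu i + m - i + 1) \<longleftrightarrow>
    int ` I \<in> step_sets (skew_shape.A (int m) (row_end m lam)) (skew_shape.N (int m) (row_end m lam) (row_end m nu))"
proof -
  interpret S: skew_shape "int m" "int n" "row_end m lam" "row_end m nu" by fact
  have sub: "int ` I \<subseteq> {1..int n} \<longleftrightarrow> I \<subseteq> {1..n}" by auto
  have card_int: "card (int ` X) = card X" for X by (simp add: card_image)
  have Int: "int ` I \<inter> {int k..int l} = int ` (I \<inter> {k..l})" for k l by auto
  have e: "(int m - int i + 1 \<le> int (card (int ` I \<inter> {1..row_end m nu (int i)})) \<and>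
      int i \<le> int (card (int ` I \<inter> {row_end m lam (int i)..int n}))) \<longleftrightarrow>
      (m - i + 1 \<le> card (I \<inter> {1..nu i + m - i + 1}) \<and> i \<le> card (I \<inter> {lam i + m - i + 1..n}))"
    if "i \<in> {1..m}" for i
  proof -
    have r: "row_end m f (int i) = int (f i + m - i + 1)" for f using that by (simp add: row_end_def)
    have 1: "card (int ` I \<inter> {1..int l}) = card (I \<inter> {1..l})" for l
      using Int[of 1 l] by (simp add: card_int)
    have 2: "int m - int i + 1 = int (m - i + 1)" using that by simp
    show ?thesis unfolding r Int card_int 1 2 of_nat_le_iff ..
  qed
  have "(\<forall>i\<in>{1..int m}. P i) \<longleftrightarrow> (\<forall>i\<in>{1..m}. P (int i))" for P
  proof
    assume h: "\<forall>i\<in>{1..m}. P (int i)"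
    show "\<forall>i\<in>{1..int m}. P i"
    proof
      fix i assume "i \<in> {1..int m}"
      then have "nat i \<in> {1..m}" "int (nat i) = i" by auto
      then show "P i" using h by metis
    qed
  qed auto
  then show ?thesis unfolding S.step_sets_eq richardson_index_def mem_Collect_eq sub card_int using e by simp
qed

lemma card_symdiff:
  assumes "finite I" "finite D"
  shows "card (symdiff I D) = (card D - card (I \<inter> D)) + (card I - card (I \<inter> D))"
proof -
  have "card (symdiff I D) = card (I - D) + card (D - I)"
    unfolding symdiff_def using assms by (intro card_Un_disjoint) auto
  moreover have "card (I - D) = card I - card (I \<inter> D)" "card (D - I) = card D - card (I \<inter> D)"
    using card_Diff_subset_Int[of I D] card_Diff_subset_Int[of D I] assms by (simp_all add: Int_commute)
  ultimately show ?thesis by simp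
qed

lemma pluecker_cone_dual_restrict:
  assumes S: "finite S" and D: "D \<subseteq> S" and U: "U \<subseteq> S"
    and I0: "I0 \<in> \<I>"
    and \<I>: "\<And>I. I \<in> \<I> \<Longrightarrow> I \<subseteq> S \<and> card I = m \<and> card (I \<inter> D) = r \<and> symdiff I D \<subseteq> U"
  shows "monomial_equiv (pluecker_cone m S \<I>)
    (pluecker_cone (card (symdiff I0 D)) U ((\<lambda>I. symdiff I D) ` \<I>))"
proof -
  have fin: "finite I0" "finite D" using \<I>[OF I0] S D finite_subset by blast+
  have r: "r \<le> card D" "r \<le> m"
    using \<I>[OF I0] card_mono[OF fin(2), of "I0 \<inter> D"] card_mono[OF fin(1), of "I0 \<inter> D"] by auto
  have "card (symdiff I0 D) = (card D - r) + (m - r)" using card_symdiff[OF fin] \<I>[OF I0] by simp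
  moreover have "monomial_equiv (pluecker_cone m S \<I>)
      (pluecker_cone ((card D - r) + (m - r)) S ((\<lambda>I. symdiff I D) ` \<I>))"
    by (rule pluecker_cone_partial_dual[OF S D _ r]) (use \<I> in blast)
  moreover have "pluecker_cone l S ((\<lambda>I. symdiff I D) ` \<I>) = pluecker_cone l U ((\<lambda>I. symdiff I D) ` \<I>)" for l
    by (rule pluecker_cone_restrict[OF S U]) (use \<I> in blast)
  ultimately show ?thesis by simp
qed

text \<open>Both cones are reduced to the columns that touch a box, the source by dualising
  \<open>M.D\<close> and the target by dualising its shared vertical steps. The reduced cones differ
  by the relabelling \<open>M.g\<close>.\<close>

theorem monomial_equiv_richardson_cones:
  assumes S: "skew_shape (int m) (int n) (row_end m lam) (row_end m nu)"
    and S': "skew_shape (int m') (int n') (row_end m' lam') (row_end m' nu')"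
    and match: "matching Q Y Y' rv dual k (skew_shape.A (int m) (row_end m lam)) (skew_shape.B (int m) (row_end m nu))
      (skew_shape.A (int m') (row_end m' lam')) (skew_shape.N (int m) (row_end m lam) (row_end m nu))
      (skew_shape.N (int m') (row_end m' lam') (row_end m' nu'))"
  shows "monomial_equiv
    (pluecker_cone m {1..n} (richardson_index m n (\<lambda>i. lam i + m - i + 1) (\<lambda>i. nu i + m - i + 1)))
    (pluecker_cone m' {1..n'} (richardson_index m' n' (\<lambda>i. lam' i + m' - i + 1) (\<lambda>i. nu' i + m' - i + 1)))"
proof -
  interpret S: skew_shape "int m" "int n" "row_end m lam" "row_end m nu" by fact
  interpret S': skew_shape "int m'" "int n'" "row_end m' lam'" "row_end m' nu'" by fact
  interpret M: matching Q Y Y' rv dual k S.A S.B S'.A S.N S'.N by fact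
  let ?R = "richardson_index m n (\<lambda>i. lam i + m - i + 1) (\<lambda>i. nu i + m - i + 1)"
  let ?R' = "richardson_index m' n' (\<lambda>i. lam' i + m' - i + 1) (\<lambda>i. nu' i + m' - i + 1)"
  have R: "I \<in> ?R \<longleftrightarrow> int ` I \<in> step_sets S.A S.N" for I by (rule richardson_index_iff[OF S])
  have R': "I \<in> ?R' \<longleftrightarrow> int ` I \<in> step_sets S'.A S'.N" for I by (rule richardson_index_iff[OF S'])
  have Rn: "I \<subseteq> {1..n} \<and> card I = m" if "I \<in> ?R" for I using that by (simp add: richardson_index_def)
  have Rn': "I \<subseteq> {1..n'} \<and> card I = m'" if "I \<in> ?R'" for I using that by (simp add: richardson_index_def)
  have Y_bounds: "1 \<le> c \<and> c < int n" if "C \<in> Q" "c \<in> Y C" for C c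
  proof -
    have "c \<in> box_content (int m) ` S.boxes" using S.N_eq_0[of c] M.N_pos[OF that] by fastforce
    then obtain x where "x \<in> S.boxes" "c = box_content (int m) x" by blast
    then show ?thesis using S.a_pos[of "fst x"] S.b_le_n[of "fst x"] by (auto simp: S.boxes_def)
  qed
  have Y'_bounds: "1 \<le> c \<and> c < int n'" if "C \<in> Q" "c \<in> Y' C" for C c
  proof -
    have "c \<in> M.contmap C ` Y C" using M.contmap_image[OF that(1)] that(2) by blast
    then obtain c0 where "c0 \<in> Y C" "c = M.contmap C c0" by blast
    then have "0 < S'.N c" using M.N_eq[OF that(1)] M.N_pos[OF that(1)] by (simp add: M.contmap_def)
    then have "c \<in> box_content (int m') ` S'.boxes" using S'.N_eq_0[of c] by fastforce
    then obtain x where "x \<in> S'.boxes" "c = box_content (int m') x" by blast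
    then show ?thesis using S'.a_pos[of "fst x"] S'.b_le_n[of "fst x"] by (auto simp: S'.boxes_def)
  qed
  have Ub: "M.U \<subseteq> {1..int n}" using Y_bounds by (force simp: M.U_def mem_steps_iff)
  have U'b: "M.U' \<subseteq> {1..int n'}" using Y'_bounds by (force simp: M.U'_def mem_steps_iff)
  have Ab: "S.A \<subseteq> {1..int n}" using S.a_pos S.a_le_b S.b_le_n by (fastforce simp: S.A_def)
  have A'b: "S'.A \<subseteq> {1..int n'}" using S'.a_pos S'.a_le_b S'.b_le_n by (fastforce simp: S'.A_def)
  have Db: "M.D \<subseteq> {1..int n}" using Ab Ub by (auto simp: M.D_def M.U_def)
  have nat_set: "int ` nat ` X = X" "nat ` X \<subseteq> {1..l}" if "X \<subseteq> {1..int l}" for X l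
    using that by (force simp: image_image)+
  define Dn where "Dn = nat ` M.D"
  define Vn where "Vn = nat ` M.U"
  define Vn' where "Vn' = nat ` M.U'"
  \<comment> \<open>The vertical steps of the target that touch no box. No component is complemented
    on this side, since \<open>M.D\<close> has done so on the source.\<close>
  define E where "E = nat ` (S'.A - M.U')"
  define gn where "gn s = nat (M.g (int s))" for s
  have A'U'b: "S'.A - M.U' \<subseteq> {1..int n'}" using A'b by blast
  have iD: "int ` Dn = M.D" and iU: "int ` Vn = M.U" and iU': "int ` Vn' = M.U'" and iE: "int ` E = S'.A - M.U'"
    unfolding Dn_def Vn_def Vn'_def E_def using nat_set(1)[OF Db] nat_set(1)[OF Ub] nat_set(1)[OF U'b] nat_set(1)[OF A'U'b] by blast+
  have Dn: "Dn \<subseteq> {1..n}" and Vn: "Vn \<subseteq> {1..n}" and Vn': "Vn' \<subseteq> {1..n'}" and E: "E \<subseteq> {1..n'}"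
    unfolding Dn_def Vn_def Vn'_def E_def using nat_set(2)[OF Db] nat_set(2)[OF Ub] nat_set(2)[OF U'b] nat_set(2)[OF A'U'b] by blast+
  have int_symdiff: "int ` symdiff X Z = symdiff (int ` X) (int ` Z)" for X Z
    by (rule image_symdiff[of int UNIV]) auto
  have card_int: "card (int ` X) = card X" for X by (simp add: card_image)
  have int_sub: "int ` X \<subseteq> int ` Z \<longleftrightarrow> X \<subseteq> Z" for X Z by auto
  have ign: "int ` gn ` J = M.g ` int ` J" if "J \<subseteq> Vn" for J
  proof -
    have "int (gn s) = M.g (int s)" if "s \<in> J" for s
    proof -
      have "int s \<in> M.U" using that \<open>J \<subseteq> Vn\<close> iU by blast
      then have "M.g (int s) \<in> M.U'" using M.g_image by blast
      then show ?thesis using U'b by (auto simp: gn_def)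
    qed
    then show ?thesis by (simp add: image_image)
  qed
  have gU: "gn ` Vn = Vn'"
  proof -
    have "int ` gn ` Vn = int ` Vn'" using ign[OF order_refl] by (simp add: iU iU' M.g_image)
    then show ?thesis by (simp add: inj_image_eq_iff)
  qed
  have ginj: "inj_on gn Vn"
  proof (rule inj_onI)
    fix s t assume st: "s \<in> Vn" "t \<in> Vn" "gn s = gn t"
    have "M.g (int s) = M.g (int t)" using ign[of "{s}"] ign[of "{t}"] st by auto
    moreover have "int s \<in> M.U" "int t \<in> M.U" using st iU by blast+
    ultimately have "int s = int t" by (rule inj_onD[OF M.inj_on_g])
    then show "s = t" by simp
  qed
  have transfer: "symdiff J Dn \<in> ?R \<longleftrightarrow> gn ` J \<union> E \<in> ?R'" if "J \<subseteq> Vn" for J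
  proof -
    have "int ` J \<subseteq> M.U" using that iU by blast
    then show ?thesis
      unfolding R R' int_symdiff image_Un ign[OF that] iD iE by (rule M.step_sets_transfer)
  qed
  have finU: "finite M.U" using Ub finite_subset by blast
  have symU: "symdiff I Dn \<subseteq> Vn" if "I \<in> ?R" for I
  proof -
    have "symdiff (int ` I) M.D \<subseteq> M.U"
      using M.step_sets_outside[of "int ` I"] M.mem_D_outside that R by (auto simp: symdiff_def)
    then show ?thesis unfolding int_sub[symmetric] int_symdiff iD iU .
  qed
  have cardD: "card (I \<inter> Dn) = card (S.A \<inter> M.D)" if "I \<in> ?R" for I
  proof -
    have "card (I \<inter> Dn) = card (int ` I \<inter> M.D)"
      using card_int[of "I \<inter> Dn"] by (simp add: image_Int iD)
    also have "\<dots> = card (S.A \<inter> M.D)"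
      by (rule M.card_Int_D) (use that R finU in \<open>auto simp: S.A_def\<close>)
    finally show ?thesis .
  qed
  have E_sub: "E \<subseteq> I" if "I \<in> ?R'" for I
  proof -
    have "S'.A - M.U' \<subseteq> int ` I" using M.step_sets_outside'[of "int ` I"] that R' by blast
    then show ?thesis unfolding iE[symmetric] int_sub .
  qed
  have E_U: "E \<inter> Vn' = {}"
  proof -
    have "int s \<notin> M.U'" if "s \<in> E" for s using that iE by blast
    moreover have "int s \<in> M.U'" if "s \<in> Vn'" for s using that iU' by blast
    ultimately show ?thesis by blast
  qed
  have symU': "symdiff I E \<subseteq> Vn'" if "I \<in> ?R'" for I
  proof -
    have I: "int ` I - (S'.A - M.U') \<subseteq> M.U'"
    proof
      fix s assume s: "s \<in> int ` I - (S'.A - M.U')"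
      show "s \<in> M.U'"
      proof (rule ccontr)
        assume "s \<notin> M.U'"
        then have "s \<in> S'.A" using M.step_sets_outside'[of "int ` I" s] R' that s by blast
        then show False using s \<open>s \<notin> M.U'\<close> by blast
      qed
    qed
    have "S'.A - M.U' \<subseteq> int ` I" using image_mono[OF E_sub[OF that], of int] unfolding iE .
    then have "(S'.A - M.U') - int ` I = {}" by (simp only: Diff_eq_empty_iff)
    with I have "int ` symdiff I E \<subseteq> int ` Vn'"
      unfolding int_symdiff iE iU' unfolding symdiff_def by (simp only: Un_empty_right)
    then show ?thesis unfolding int_sub .
  qed
  define I0 where "I0 = nat ` S.A"
  have I0: "I0 \<in> ?R"
  \<comment> \<open>The upper boundary path itself is admissible, with \<open>d\<close> equal to
    0.\<close>
  proof -
    have "S.A \<in> step_sets S.A S.N"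
      unfolding step_sets_def using S.N_nonneg by (auto intro!: exI[of _ "\<lambda>_. 0"])
    then show ?thesis unfolding R I0_def nat_set(1)[OF Ab] .
  qed
  \<comment> \<open>The partner of \<open>I0\<close>, chosen so that both reduced cones consist of
    minors with the same number of rows.\<close>
  define I0' where "I0' = gn ` symdiff I0 Dn \<union> E"
  have sd: "symdiff (gn ` J \<union> E) E = gn ` J" if "J \<subseteq> Vn" for J
    using image_mono[OF that, of gn] gU E_U unfolding symdiff_def by blast
  have I0': "I0' \<in> ?R'" unfolding I0'_def using transfer[OF symU[OF I0]] I0 by simp
  have card_eq: "card (symdiff I0' E) = card (symdiff I0 Dn)"
    unfolding I0'_def sd[OF symU[OF I0]] by (rule card_image[OF inj_on_subset[OF ginj symU[OF I0]]])
  have imR: "(`) gn ` (\<lambda>I. symdiff I Dn) ` ?R = (\<lambda>I. symdiff I E) ` ?R'"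
  proof (intro equalityI subsetI)
    fix X assume "X \<in> (`) gn ` (\<lambda>I. symdiff I Dn) ` ?R"
    then obtain I where I: "I \<in> ?R" "X = gn ` symdiff I Dn" by blast
    have "gn ` symdiff I Dn \<union> E \<in> ?R'" using transfer[OF symU[OF I(1)]] I(1) by simp
    moreover have "X = symdiff (gn ` symdiff I Dn \<union> E) E" unfolding sd[OF symU[OF I(1)]] by (rule I(2))
    ultimately show "X \<in> (\<lambda>I. symdiff I E) ` ?R'" by (rule rev_image_eqI)
  next
    fix X assume "X \<in> (\<lambda>I. symdiff I E) ` ?R'"
    then obtain I where I: "I \<in> ?R'" "X = symdiff I E" by blast
    have "X \<subseteq> gn ` Vn" using symU'[OF I(1)] I(2) gU by simp
    then obtain J where J: "J \<subseteq> Vn" "X = gn ` J" by (meson subset_imageE)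
    have "gn ` J \<union> E = I" using E_sub[OF I(1)] J(2) I(2) by (auto simp: symdiff_def)
    then have "symdiff J Dn \<in> ?R" using transfer[OF J(1)] I(1) by simp
    then have "gn ` symdiff (symdiff J Dn) Dn \<in> (`) gn ` (\<lambda>I. symdiff I Dn) ` ?R" by (intro imageI)
    then show "X \<in> (`) gn ` (\<lambda>I. symdiff I Dn) ` ?R" using J(2) by simp
  qed
  let ?c = "card (symdiff I0 Dn)"
  have 1: "monomial_equiv (pluecker_cone m {1..n} ?R) (pluecker_cone ?c Vn ((\<lambda>I. symdiff I Dn) ` ?R))"
    by (rule pluecker_cone_dual_restrict[OF _ Dn Vn I0]) (use Rn cardD symU in auto)
  have 2: "monomial_equiv (pluecker_cone ?c Vn ((\<lambda>I. symdiff I Dn) ` ?R))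
      (pluecker_cone ?c Vn' ((\<lambda>I. symdiff I E) ` ?R'))"
    unfolding gU[symmetric] imR[symmetric]
    by (rule pluecker_cone_relabel[OF finite_subset[OF Vn] ginj]) (use symU in auto)
  have cardE: "card (I \<inter> E) = card E" if "I \<in> ?R'" for I
    using E_sub[OF that] by (simp add: Int_absorb1)
  have 3: "monomial_equiv (pluecker_cone m' {1..n'} ?R') (pluecker_cone ?c Vn' ((\<lambda>I. symdiff I E) ` ?R'))"
    unfolding card_eq[symmetric]
    by (rule pluecker_cone_dual_restrict[OF _ E Vn' I0']) (use Rn' cardE symU' in auto)
  show ?thesis
    using monomial_equiv_trans[OF monomial_equiv_trans[OF 1 2] monomial_equiv_sym[OF 3]] .
qed

lemma pluecker_cone_supported:
  assumes "v \<in> pluecker_cone m {1..n} (richardson_index m n a b)"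
  shows "v \<noteq> 0 \<and> (\<forall>I. I \<notin> pluecker_index m n \<longrightarrow> v I = 0)"
  using assms unfolding pluecker_cone_def richardson_index_def pluecker_index_def by auto

theorem proposition2:
  fixes m n m' n' :: nat and lam mu lam' mu' :: "nat \<Rightarrow> nat"
  assumes "m \<le> n" and "partition_in_box m (n - m) lam" and "partition_in_box m (n - m) mu"
    and "young_diagram m lam \<subseteq> young_diagram m (dual_partition m (n - m) mu)"
    and "m' \<le> n'" and "partition_in_box m' (n' - m') lam'" and "partition_in_box m' (n' - m') mu'"
    and "young_diagram m' lam' \<subseteq> young_diagram m' (dual_partition m' (n' - m') mu')"
    and "semi_isomorphic
           (skew_diagram m n lam mu) (box_order (skew_diagram m n lam mu))
           (skew_diagram m' n' lam' mu') (box_order (skew_diagram m' n' lam' mu'))"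
  shows "isomorphic_varieties
           (pluecker_index m n) (pluecker m n ` richardson m n lam mu)
           (pluecker_index m' n') (pluecker m' n' ` richardson m' n' lam' mu')"
proof -
  note S = skew_shape_row_end[OF assms(1-4)] and S' = skew_shape_row_end[OF assms(5-8)]
  obtain Q :: "(nat \<times> nat) set set" and Y Y' rv dual k where "matching Q Y Y' rv dual k
      (skew_shape.A (int m) (row_end m lam)) (skew_shape.B (int m) (row_end m (dual_partition m (n - m) mu)))
      (skew_shape.A (int m') (row_end m' lam'))
      (skew_shape.N (int m) (row_end m lam) (row_end m (dual_partition m (n - m) mu)))
      (skew_shape.N (int m') (row_end m' lam') (row_end m' (dual_partition m' (n' - m') mu')))"
    using matching_of_semi_isomorphic[OF S S' emb_skew_diagram[OF S] emb_skew_diagram[OF S'] assms(9)] by blast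
  note equiv = monomial_equiv_richardson_cones[OF S S' this]
  show ?thesis
    unfolding pluecker_richardson[OF assms(1)] pluecker_richardson[OF assms(5)]
    by (rule monomial_equiv_isomorphic[OF equiv pluecker_cone_supported pluecker_cone_supported])
qed

end
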